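(* Let $w=\{a_1\widetilde w_1,\;a_1^{-1}\widetilde w_2\}$ be a signed Gauss paragraph with two component words on letters $a_1,\dots,a_n$, and let $(S_w,\gamma_w=\lambda\cup\sigma)$ be a realization of $w$ on a closed connected surface $S_w$, where $\lambda$ reads $a_1\widetilde w_1$ and $\sigma$ reads $a_1^{-1}\widetilde w_2$. Let $(S_w,\widehat\gamma_w=\lambda\vee\sigma)$ be the join of $\lambda$ and $\sigma$ at the crossing $a_1$, which is a realization of the signed Gauss word $$\widehat w=a_1\widetilde w_1a_{n+1}a_1^{-1}\widetilde w_2a_{n+1}^{-1}.$$ Then $(S_w,\gamma_w)$ is a minimal realization of $w$ if and only if $(S_w,\widehat\gamma_w)$ is a minimal realization of $\widehat w$.
   Context: Surfaces: a surface is a compact, oriented, triangulated (PL) 2-manifold, possibly with boundary. PL-normal curves: an oriented PL-normal curve on $\Sigma$ is an oriented closed trail in the 1-skeleton of $\Sigma$ whose vertices have valency 4 in the curve (crossing points) or valency 2 (ordinary points), such that at each crossing point (interior to $\Sigma$) the two strands cross transversally. An oriented PL-normal curve of several components is a finite union of such curves meeting each other in finitely many transverse double points; these also count as crossings. At a crossing one of the two strands travels the crossing positively and the other negatively: a strand travels it positively iff the other strand crosses it from its left to its right. Signed Gauss paragraphs: a signed Gauss paragraph on letters $a_1,\dots,a_n$ is a finite collection of words, considered up to cyclic permutation, such that each of the symbols $a_1,\dots,a_n,a_1^{-1},\dots,a_n^{-1}$ occurs exactly once in total; with a single word it is called a signed Gauss word. The signed Gauss paragraph $w_\gamma$ of a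 curve $\gamma$ on a connected surface $\Sigma$ with crossings labelled $a_1,\dots,a_n$ is obtained by following each component and writing $a_i$ (resp. $a_i^{-1}$) each time crossing $a_i$ is travelled positively (resp. negatively). $(\Sigma,\gamma)$ is a realization of $w$ if $w_\gamma=w$. A minimal realization of $w$ is a realization on a closed connected surface of minimum genus among all realizations of $w$ on closed connected surfaces. Join: choose a small disc $D$ around $a_1$ (the closed star of $a_1$ in the second barycentric subdivision) meeting $\gamma_w$ only in the two arcs through $a_1$. Inside $D$ choose ordinary points $a'_{n+1}$ on $\lambda$ and $a''_{n+1}$ on $\sigma$, each on the strand arriving at $a_1$, and modify the two incoming strands inside the sector of $D$ between them so that they cross each other transversally once, at a new crossing $a_{n+1}$ (the identification $a'_{n+1}=a''_{n+1}$), before reaching $a_1$; nothing else is changed. Thus $a_{n+1}$ and $a_1$ are the corners of a new bigon contained in $D$; $\lambda$'s incoming strand travels $a_{n+1}$ positively and then continues to $a_1$ along the strand travelling $a_1$ negatively, while $\sigma$'s incoming strand travels $a_{n+1}$ negatively and continues to $a_1$ along the strand travelling $a_1$ positively. The result is a one-component oriented PL-normal curve $\widehat\gamma_w=\lambda\vee\sigma$ on $S_w$ (up to subdividing). *)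

theory Defs
  imports Main "HOL-Library.Multiset" "HOL-Library.Sublist" "HOL-Library.Nat_Bijection"
begin

section \<open>Closed oriented triangulated surfaces\<close>

text \<open>
  Every finite complex can be relabelled by natural numbers, so vertices are of type \<^typ>\<open>nat\<close>.
  An oriented triangulated surface is given by the set of its positively (counterclockwise)
  oriented triangles; each triangle is listed with all three cyclic rotations of its vertices.
\<close>

type_synonym triangles = "(nat \<times> nat \<times> nat) set"

definition verts :: "triangles \<Rightarrow> nat set" where
  "verts T = (\<Union>(x, y, z)\<in>T. {x, y, z})"

definition edges :: "triangles \<Rightarrow> nat set set" where
  "edges T = (\<Union>(x, y, z)\<in>T. {{x, y}, {y, z}, {z, x}})"

definition faces :: "triangles \<Rightarrow> nat set set" where
  "faces T = (\<lambda>(x, y, z). {x, y, z}) ` T"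

text \<open>The pairs of cyclically consecutive entries of a list.\<close>

definition cyc_pairs :: "nat list \<Rightarrow> (nat \<times> nat) list" where
  "cyc_pairs xs = zip xs (rotate1 xs)"

text \<open>
  The link of \<open>v\<close> is the cycle \<open>xs\<close>, traversed counterclockwise as seen from \<open>v\<close>.
\<close>

definition link_cycle :: "triangles \<Rightarrow> nat \<Rightarrow> nat list \<Rightarrow> bool" where
  "link_cycle T v xs \<longleftrightarrow>
     distinct xs \<and> 3 \<le> length xs \<and> {(y, z). (v, y, z) \<in> T} = set (cyc_pairs xs)"

text \<open>
  Since all links are cycles of length at least 3, the three vertices of a triangle are distinct,
  every edge lies on exactly two triangles, these induce opposite orientations on it, and no
  triangle occurs with both orientations.
\<close>

definition closed_connected_surface :: "triangles \<Rightarrow> bool" where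
  "closed_connected_surface T \<longleftrightarrow>
     finite T \<and> T \<noteq> {} \<and>
     (\<forall>x y z. (x, y, z) \<in> T \<longrightarrow> (y, z, x) \<in> T) \<and>
     (\<forall>v\<in>verts T. \<exists>xs. link_cycle T v xs) \<and>
     (\<forall>x\<in>verts T. \<forall>y\<in>verts T. (x, y) \<in> {(a, b). {a, b} \<in> edges T}\<^sup>*)"

definition euler_char :: "triangles \<Rightarrow> int" where
  "euler_char T = int (card (verts T)) - int (card (edges T)) + int (card (faces T))"

text \<open>For closed connected oriented surfaces: \<open>\<chi> = 2 - 2 g\<close>.\<close>

definition genus :: "triangles \<Rightarrow> int" where
  "genus T = (2 - euler_char T) div 2"


section \<open>PL-normal curves\<close>

text \<open>
  A curve is the multiset of its components; a component is the cyclic sequence of the vertices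
  it passes through.  A strand \<open>(u, v, w)\<close> passes from \<open>u\<close> through \<open>v\<close> to \<open>w\<close>.  The strands of
  \<open>c\<close> are listed in cyclic order, the first being the one through the second entry of \<open>c\<close>.
\<close>

type_synonym curve = "nat list multiset"

definition strands :: "nat list \<Rightarrow> (nat \<times> nat \<times> nat) list" where
  "strands c = zip c (cyc_pairs (rotate1 c))"

definition strands_of :: "curve \<Rightarrow> (nat \<times> nat \<times> nat) set" where
  "strands_of \<gamma> = (\<Union>c\<in>set_mset \<gamma>. set (strands c))"

definition visits :: "curve \<Rightarrow> nat multiset" where
  "visits \<gamma> = (\<Sum>c\<in>#\<gamma>. mset c)"

definition edge_visits :: "curve \<Rightarrow> nat set multiset" where
  "edge_visits \<gamma> = (\<Sum>c\<in>#\<gamma>. mset (map (\<lambda>(x, y). {x, y}) (cyc_pairs c)))"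

text \<open>A vertex visited \<open>k\<close> times by a trail has valency \<open>2 k\<close> in it.\<close>

definition crossings :: "curve \<Rightarrow> nat set" where
  "crossings \<gamma> = {v. count (visits \<gamma>) v = 2}"

text \<open>The vertices \<open>as\<close> occur in this counterclockwise cyclic order in the link of \<open>v\<close>.\<close>

definition ccw :: "triangles \<Rightarrow> nat \<Rightarrow> nat list \<Rightarrow> bool" where
  "ccw T v as \<longleftrightarrow> (\<exists>xs. link_cycle T v xs \<and> subseq as xs)"

text \<open>
  The second strand crosses the first one transversally, from the left of the first to its
  right: counterclockwise from the forward direction \<open>w\<close> of the first strand one meets first its
  left side, then the backward direction \<open>u\<close>, then its right side.
\<close>

fun crossed_left_to_right ::
  "triangles \<Rightarrow> nat \<times> nat \<times> nat \<Rightarrow> nat \<times> nat \<times> nat \<Rightarrow> bool" where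
  "crossed_left_to_right T (u, v, w) (u', v', w') \<longleftrightarrow> v' = v \<and> ccw T v [w, u', u, w']"

definition pl_normal :: "triangles \<Rightarrow> curve \<Rightarrow> bool" where
  "pl_normal T \<gamma> \<longleftrightarrow>
     (\<forall>c\<in>#\<gamma>. c \<noteq> []) \<and>
     set_mset (edge_visits \<gamma>) \<subseteq> edges T \<and>
     (\<forall>e. count (edge_visits \<gamma>) e \<le> 1) \<and>
     (\<forall>v. count (visits \<gamma>) v \<le> 2) \<and>
     (\<forall>v\<in>crossings \<gamma>. \<forall>s\<in>strands_of \<gamma>. \<forall>t\<in>strands_of \<gamma>.
        fst (snd s) = v \<longrightarrow> fst (snd t) = v \<longrightarrow> s \<noteq> t \<longrightarrow>
        crossed_left_to_right T s t \<or> crossed_left_to_right T t s)"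

definition travels_positively :: "triangles \<Rightarrow> curve \<Rightarrow> nat \<times> nat \<times> nat \<Rightarrow> bool" where
  "travels_positively T \<gamma> s \<longleftrightarrow> (\<exists>t\<in>strands_of \<gamma>. crossed_left_to_right T s t)"


section \<open>Signed Gauss paragraphs and realizations\<close>

text \<open>The symbol \<open>a\<^sub>i\<close> is \<open>(i, True)\<close> and the symbol \<open>a\<^sub>i\<inverse>\<close> is \<open>(i, False)\<close>.\<close>

type_synonym word = "(nat \<times> bool) list"

definition cyc_class :: "'a list \<Rightarrow> 'a list set" where
  "cyc_class w = {rotate k w | k. True}"

definition signed_gauss_paragraph :: "nat \<Rightarrow> word multiset \<Rightarrow> bool" where
  "signed_gauss_paragraph n W \<longleftrightarrow> (\<Sum>w\<in>#W. mset w) = mset_set ({1..n} \<times> UNIV)"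

text \<open>In the following, \<open>lab\<close> assigns to each crossing \<open>x\<close> the index of its letter.\<close>

definition gauss_word :: "triangles \<Rightarrow> curve \<Rightarrow> (nat \<Rightarrow> nat) \<Rightarrow> nat list \<Rightarrow> word" where
  "gauss_word T \<gamma> lab c =
     map (\<lambda>s. (lab (fst (snd s)), travels_positively T \<gamma> s))
       (filter (\<lambda>s. fst (snd s) \<in> crossings \<gamma>) (strands c))"

definition gauss_paragraph :: "triangles \<Rightarrow> curve \<Rightarrow> (nat \<Rightarrow> nat) \<Rightarrow> word set multiset" where
  "gauss_paragraph T \<gamma> lab = image_mset (\<lambda>c. cyc_class (gauss_word T \<gamma> lab c)) \<gamma>"

text \<open>Realizations on closed connected surfaces.\<close>

definition realization ::
  "triangles \<Rightarrow> curve \<Rightarrow> (nat \<Rightarrow> nat) \<Rightarrow> word multiset \<Rightarrow> bool" where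
  "realization T \<gamma> lab W \<longleftrightarrow>
     closed_connected_surface T \<and> pl_normal T \<gamma> \<and> inj_on lab (crossings \<gamma>) \<and>
     gauss_paragraph T \<gamma> lab = image_mset cyc_class W"

definition minimal_realization ::
  "triangles \<Rightarrow> curve \<Rightarrow> (nat \<Rightarrow> nat) \<Rightarrow> word multiset \<Rightarrow> bool" where
  "minimal_realization T \<gamma> lab W \<longleftrightarrow>
     realization T \<gamma> lab W \<and>
     (\<forall>T' \<gamma>' lab'. realization T' \<gamma>' lab' W \<longrightarrow> genus T \<le> genus T')"


section \<open>Barycentric subdivision\<close>

text \<open>
  The new vertices are the simplices of the old complex, coded as natural numbers by
  \<^const>\<open>set_encode\<close> (injective on finite sets).
\<close>

definition rots :: "nat \<times> nat \<times> nat \<Rightarrow> triangles" where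
  "rots = (\<lambda>(x, y, z). {(x, y, z), (y, z, x), (z, x, y)})"

definition sd :: "triangles \<Rightarrow> triangles" where
  "sd T = (\<Union>(x, y, z)\<in>T.
     rots (set_encode {x}, set_encode {x, y}, set_encode {x, y, z}) \<union>
     rots (set_encode {x, y}, set_encode {y}, set_encode {x, y, z}))"

definition sd_vertex :: "nat \<Rightarrow> nat" where
  "sd_vertex x = set_encode {x}"

definition sd_path :: "nat list \<Rightarrow> nat list" where
  "sd_path c = concat (map (\<lambda>(x, y). [set_encode {x}, set_encode {x, y}]) (cyc_pairs c))"


section \<open>The join\<close>

definition star :: "triangles \<Rightarrow> nat \<Rightarrow> triangles" where
  "star T v = {(x, y, z) \<in> T. v \<in> {x, y, z}}"

text \<open>The part of the star of \<open>v\<close> swept out counterclockwise from the edge \<open>vq\<close> to \<open>vp\<close>.\<close>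

definition sector :: "triangles \<Rightarrow> nat \<Rightarrow> nat \<Rightarrow> nat \<Rightarrow> triangles" where
  "sector T v q p =
     \<Union>{rots (v, xs ! i, xs ! Suc i) | xs i j.
        link_cycle T v xs \<and> i < j \<and> j < length xs \<and> xs ! 0 = q \<and> xs ! j = p}"

text \<open>
  The join of \<open>\<lambda>\<close> = \<open>lam\<close> and \<open>\<sigma>\<close> = \<open>sig\<close> at a crossing \<open>v\<close> which \<open>\<lambda>\<close> travels positively is a curve \<open>\<delta>\<close> with one
  additional crossing \<open>c\<close>.  The disc \<open>D\<close> is the closed star of \<open>v\<close> in the second barycentric
  subdivision \<open>T2\<close>; to make room for the modified strands inside \<open>D\<close>, \<open>T2\<close> is subdivided \<open>m\<close>
  more times, to \<open>T'\<close>.  Up to rotation, in \<open>T'\<close>,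

    \<^item> \<open>\<lambda>\<close> is \<open>v, A, a', P\<close> and \<open>\<sigma>\<close> is \<open>v, B, a'', R\<close>, where \<open>a', P, v\<close> and \<open>a'', R, v\<close> are the final
      pieces, inside \<open>D\<close>, of the two strands arriving at \<open>v\<close>;
    \<^item> the incoming strand of \<open>\<lambda>\<close> is rerouted as \<open>a', X1, c, X2, v\<close>, where it now enters \<open>v\<close> along
      the last edge of \<open>\<sigma>\<close> and continues along \<open>\<sigma>\<close>;
    \<^item> the incoming strand of \<open>\<sigma>\<close> is rerouted as \<open>a'', Y1, c, Y2, v\<close>, where it now enters \<open>v\<close> along
      the last edge of \<open>\<lambda>\<close> and continues along \<open>\<lambda>\<close>.

  The rerouted strands stay in the sector \<open>Q\<close> between the two incoming strands; as \<open>\<lambda>\<close> travels \<open>v\<close>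
  positively, this is the sector counterclockwise from the one of \<open>\<sigma>\<close> to the one of \<open>\<lambda>\<close>.  They
  meet each other only in \<open>c\<close> and \<open>v\<close>, they do not meet the rest of the curve, and at \<open>c\<close> the
  strand coming from \<open>\<sigma>\<close> crosses the one coming from \<open>\<lambda>\<close> from its left to its right.
\<close>

definition is_join ::
  "triangles \<Rightarrow> nat list \<Rightarrow> nat list \<Rightarrow> nat \<Rightarrow> nat \<Rightarrow> nat list \<Rightarrow> nat \<Rightarrow> bool" where
  "is_join T lam sig v0 m \<delta> c \<longleftrightarrow>
     (\<exists>A B P R X1 X2 Y1 Y2 a' a'' p p' q q' v T2 v2 D Q.
        T2 = (sd ^^ 2) T \<and> v2 = (sd_vertex ^^ 2) v0 \<and> v = (sd_vertex ^^ (m + 2)) v0 \<and>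
        (p, v2, p') \<in> set (strands ((sd_path ^^ 2) lam)) \<and>
        (q, v2, q') \<in> set (strands ((sd_path ^^ 2) sig)) \<and>
        D = (sd ^^ m) (star T2 v2) \<and>
        Q = (sd ^^ m) (sector T2 v2 q p) \<and>
        v # A @ a' # P \<in> cyc_class ((sd_path ^^ (m + 2)) lam) \<and>
        v # B @ a'' # R \<in> cyc_class ((sd_path ^^ (m + 2)) sig) \<and>
        set (a' # P) \<subseteq> verts D \<and> set (a'' # R) \<subseteq> verts D \<and>
        successively (\<lambda>x y. {x, y} \<in> edges Q) (a' # X1 @ c # X2 @ [v]) \<and>
        successively (\<lambda>x y. {x, y} \<in> edges Q) (a'' # Y1 @ c # Y2 @ [v]) \<and>
        last (c # X2) = last (a'' # R) \<and> last (c # Y2) = last (a' # P) \<and>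
        distinct (c # X1 @ X2 @ Y1 @ Y2) \<and>
        set (c # X1 @ X2 @ Y1 @ Y2) \<inter> set (v # A @ a' # B @ [a'']) = {} \<and>
        crossed_left_to_right ((sd ^^ (m + 2)) T)
          (last (a' # X1), c, hd (X2 @ [v])) (last (a'' # Y1), c, hd (Y2 @ [v])) \<and>
        \<delta> \<in> cyc_class (v # A @ a' # X1 @ c # X2 @ v # B @ a'' # Y1 @ c # Y2))"

end

theory Submission
  imports Defs
begin

text \<open>
  Both paragraphs have realizations of exactly the same genera.  The join turns a realization of \<open>w\<close>
  into one of \<open>w_hat\<close> on the same surface: the strands through the old crossings are unchanged, and
  the two rerouted strands meet once more, in \<open>a\<^sub>n\<^sub>+\<^sub>1\<close>.  Conversely, the oriented smoothing of any
  realization of \<open>w_hat\<close> at \<open>a\<^sub>n\<^sub>+\<^sub>1\<close> reads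
  \<open>a\<^sub>1 w\<^sub>1\<close> and \<open>a\<^sub>1\<inverse> w\<^sub>2\<close>, hence is a realization of \<open>w\<close> on the same surface.  Since subdividing a surface
  does not change its genus, a realization of one of the two has minimal genus if and only if the
  other one has.
\<close>

text \<open>Minimality quantifies over all realizations, so transforming the given curve is not
  enough: every realization of either paragraph, on any closed connected surface, must be turned
  into a realization of the other of the same genus. Smoothing succeeds without a bigon, because
  cutting the cyclic word of \<open>w_hat\<close> at its two letters of index n + 1 leaves exactly
  the words of a_1 w_1 and a_1^-1 w_2, whatever the curve looks like elsewhere. The obstacle is
  room. The smoothed curves touch at the former crossing, and the rerouted strands of a join need a
  sector that the rest of the curve avoids; an arbitrary triangulation guarantees neither. After one
  barycentric subdivision the neighbours of a crossing alternate between midpoints of edges, visited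
  only when the curve runs along the edge, and barycentres of faces, never visited, so sectors
  between consecutive strands are free. Signs survive at all other crossings, because the sign of a
  strand depends only on the strands through the same vertex.\<close>

declare set_encode_insert [simp del]

section \<open>Cyclic lists\<close>

lemma cyc_class_self: "xs \<in> cyc_class xs"
  unfolding cyc_class_def by (metis (mono_tags, lifting) mem_Collect_eq rotate0 id_apply)

lemma cyc_class_rotate: "rotate k xs \<in> cyc_class xs"
  unfolding cyc_class_def by blast

text \<open>A rotation is undone by continuing to a full turn; this makes \<open>cyc_class\<close>
  symmetric.\<close>

lemma rotate_cancel: "rotate (length xs - k mod length xs) (rotate k xs) = xs"
proof (cases "xs = []")
  case False
  then have "k mod length xs < length xs" by simp
  then have "(length xs - k mod length xs) + k mod length xs = length xs" by simp
  then have "((length xs - k mod length xs) + k) mod length xs = 0"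
    by (metis mod_add_right_eq mod_self)
  then show ?thesis by (simp add: rotate_rotate)
qed simp

lemma cyc_class_sym: "ys \<in> cyc_class xs \<Longrightarrow> xs \<in> cyc_class ys"
  unfolding cyc_class_def by (auto intro: rotate_cancel[symmetric])

lemma cyc_class_trans: "zs \<in> cyc_class ys \<Longrightarrow> ys \<in> cyc_class xs \<Longrightarrow> zs \<in> cyc_class xs"
  unfolding cyc_class_def by (auto simp: rotate_rotate)

lemma cyc_class_eq_iff: "cyc_class xs = cyc_class ys \<longleftrightarrow> xs \<in> cyc_class ys"
  using cyc_class_self cyc_class_sym cyc_class_trans by blast

lemma cyc_class_append: "ys @ xs \<in> cyc_class (xs @ ys)"
  by (metis cyc_class_rotate rotate_append)

lemma cyc_class_rotate1: "rotate1 xs \<in> cyc_class xs"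
  by (metis cyc_class_rotate rotate0 id_apply rotate_Suc)

lemma cyc_class_map: "ys \<in> cyc_class xs \<Longrightarrow> map f ys \<in> cyc_class (map f xs)"
  unfolding cyc_class_def by (auto simp: rotate_map[symmetric])

lemma cyc_class_filter: "ys \<in> cyc_class xs \<Longrightarrow> filter P ys \<in> cyc_class (filter P xs)"
proof -
  \<comment> \<open>One rotation step moves the head to the end of the filtered list if the head is
    kept, and leaves that list alone otherwise.\<close>
  have 1: "filter P (rotate1 xs) \<in> cyc_class (filter P xs)" for xs
    using cyc_class_append[of _ "[_]"] by (cases xs) (auto simp: cyc_class_self)
  have "filter P (rotate k xs) \<in> cyc_class (filter P xs)" for k
    by (induction k) (auto simp: cyc_class_self intro: 1 cyc_class_trans)
  then show "ys \<in> cyc_class xs \<Longrightarrow> filter P ys \<in> cyc_class (filter P xs)"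
    unfolding cyc_class_def by auto
qed

lemma cyc_class_mset: "ys \<in> cyc_class xs \<Longrightarrow> mset ys = mset xs"
proof -
  have "mset (rotate k xs) = mset xs" for k
  proof (induction k)
    case (Suc k)
    have "mset (rotate1 zs) = mset zs" for zs :: "'a list" by (cases zs) auto
    with Suc show ?case by simp
  qed simp
  then show "ys \<in> cyc_class xs \<Longrightarrow> mset ys = mset xs"
    unfolding cyc_class_def by auto
qed

lemma cyc_class_set: "ys \<in> cyc_class xs \<Longrightarrow> set ys = set xs"
  by (metis cyc_class_mset set_mset_mset)

lemma cyc_class_distinct: "ys \<in> cyc_class xs \<Longrightarrow> distinct ys = distinct xs"
  unfolding cyc_class_def by auto

lemma cyc_class_length: "ys \<in> cyc_class xs \<Longrightarrow> length ys = length xs"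
  unfolding cyc_class_def by auto

lemma cyc_class_hd_in: "x \<in> set xs \<Longrightarrow> \<exists>ys. x # ys \<in> cyc_class xs"
  by (metis append_Cons cyc_class_append split_list)

text \<open>Distinctness pins the head to index 0, so a rotation that keeps the head is trivial.
  This is how words and link cycles known only up to rotation become equal lists.\<close>

lemma cyc_class_Cons_distinct:
  assumes "x # ys \<in> cyc_class (x # zs)" "distinct (x # zs)"
  shows "ys = zs"
proof -
  obtain k where k: "x # ys = rotate k (x # zs)" using assms(1) unfolding cyc_class_def by auto
  define n where "n = length (x # zs)"
  have n: "n > 0" by (simp add: n_def)
  have "hd (rotate k (x # zs)) = (x # zs) ! (k mod n)"
    unfolding n_def by (rule hd_rotate_conv_nth) simp
  then have "(x # zs) ! (k mod n) = (x # zs) ! 0" using k by (metis list.sel(1) nth_Cons_0)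
  then have "k mod n = 0"
    using assms(2) n by (metis n_def distinct_conv_nth mod_less_divisor)
  then have "rotate k (x # zs) = x # zs" unfolding n_def by (rule rotate_id)
  with k show ?thesis by simp
qed

section \<open>Consecutive pairs and strands of a cyclic sequence\<close>

lemma length_cyc_pairs [simp]: "length (cyc_pairs xs) = length xs"
  by (simp add: cyc_pairs_def)

lemma cyc_pairs_Nil [simp]: "cyc_pairs [] = []"
  by (simp add: cyc_pairs_def)

lemma nth_cyc_pairs:
  "i < length xs \<Longrightarrow> cyc_pairs xs ! i = (xs ! i, xs ! (Suc i mod length xs))"
  by (simp add: cyc_pairs_def nth_rotate1)

lemma cyc_pairs_rotate1: "cyc_pairs (rotate1 xs) = rotate1 (cyc_pairs xs)"
proof (cases "xs = []")
  case False
  then have "Suc i mod length xs < length xs" for i by simp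
  then show ?thesis
    by (intro nth_equalityI) (auto simp: nth_cyc_pairs nth_rotate1)
qed simp

lemma cyc_pairs_rotate: "cyc_pairs (rotate k xs) = rotate k (cyc_pairs xs)"
  by (induction k) (auto simp: cyc_pairs_rotate1)

lemma cyc_pairs_cyc_class: "ys \<in> cyc_class xs \<Longrightarrow> cyc_pairs ys \<in> cyc_class (cyc_pairs xs)"
  unfolding cyc_class_def by (auto simp: cyc_pairs_rotate)

lemma length_strands [simp]: "length (strands c) = length c"
  by (simp add: strands_def)

lemma nth_strands:
  assumes "i < length c"
  shows "strands c ! i = (c ! i, c ! (Suc i mod length c), c ! (Suc (Suc i) mod length c))"
proof -
  have "c \<noteq> []" using assms by auto
  moreover from this have "Suc i mod length c < length c" by simp
  ultimately show ?thesis using assms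
    by (simp add: strands_def nth_cyc_pairs nth_rotate1 mod_Suc_eq)
qed

lemma strands_rotate1: "strands (rotate1 c) = rotate1 (strands c)"
proof (cases "c = []")
  case False
  then have "Suc i mod length c < length c" for i by simp
  moreover have "Suc (Suc (Suc i mod n)) mod n = Suc (Suc (Suc i)) mod n" for i n
    by (metis mod_Suc_eq)
  ultimately show ?thesis
    by (intro nth_equalityI) (simp_all add: nth_strands nth_rotate1 mod_Suc_eq)
qed (simp add: strands_def)

lemma strands_rotate: "strands (rotate k c) = rotate k (strands c)"
  by (induction k) (auto simp: strands_rotate1)

lemma strands_cyc_class: "d \<in> cyc_class c \<Longrightarrow> strands d \<in> cyc_class (strands c)"
  unfolding cyc_class_def by (auto simp: strands_rotate)

text \<open>
  The strands through a path that is entered from \<open>a\<close> and left towards \<open>b\<close>.  For a closed curve this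
  lists the strand through the first vertex first, whereas \<^const>\<open>strands\<close> lists it last.
\<close>

fun path_strands :: "'a \<Rightarrow> 'a list \<Rightarrow> 'a \<Rightarrow> ('a \<times> 'a \<times> 'a) list" where
  "path_strands a [] b = []"
| "path_strands a (x # xs) b = (a, x, hd (xs @ [b])) # path_strands x xs b"

lemma length_path_strands [simp]: "length (path_strands a xs b) = length xs"
  by (induction xs arbitrary: a) auto

lemma nth_path_strands:
  "i < length xs \<Longrightarrow> path_strands a xs b ! i = ((a # xs) ! i, xs ! i, (xs @ [b]) ! Suc i)"
proof (induction xs arbitrary: a i)
  case (Cons x xs)
  then show ?case by (cases i) (auto simp: hd_conv_nth)
qed simp

lemma path_strands_append: "path_strands a (xs @ ys) b = path_strands a xs (hd (ys @ [b])) @ path_strands (last (a # xs)) ys b"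
  by (induction xs arbitrary: a) (auto simp: hd_append)

lemma map_mid_path_strands: "map (fst \<circ> snd) (path_strands a xs b) = xs"
  by (induction xs arbitrary: a) auto

lemma path_strands_mid: "(u, x, w) \<in> set (path_strands a xs b) \<Longrightarrow> x \<in> set xs"
  by (induction xs arbitrary: a) auto

text \<open>Entry i of \<open>strands c\<close> is centred at index i + 1, entry i of the path
  version at index i; this is the shift by one. The case splits inside treat the places where an
  index wraps around.\<close>

lemma rotate1_cyc_strands: "c \<noteq> [] \<Longrightarrow> strands c = rotate1 (path_strands (last c) c (hd c))"
proof (rule nth_equalityI)
  fix i assume c: "c \<noteq> []" and "i < length (strands c)"
  then have i: "i < length c" by simp
  let ?n = "length c"
  have lt: "Suc i mod ?n < ?n" using c by simp
  have "rotate1 (path_strands (last c) c (hd c)) ! i = path_strands (last c) c (hd c) ! (Suc i mod ?n)"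
    using i by (simp add: nth_rotate1)
  also have "\<dots> = ((last c # c) ! (Suc i mod ?n), c ! (Suc i mod ?n), (c @ [hd c]) ! Suc (Suc i mod ?n))"
    using lt by (simp add: nth_path_strands)
  also have "(last c # c) ! (Suc i mod ?n) = c ! i"
  proof (cases "Suc i = ?n")
    case True
    then show ?thesis using c by (simp add: last_conv_nth flip: True)
  next
    case False then show ?thesis using i by simp
  qed
  also have "(c @ [hd c]) ! Suc (Suc i mod ?n) = c ! (Suc (Suc i) mod ?n)"
  proof (cases "Suc (Suc i mod ?n) = ?n")
    case True
    then have "Suc (Suc i) mod ?n = 0" by (metis mod_Suc_eq mod_self)
    with True c show ?thesis by (simp add: nth_append hd_conv_nth)
  next
    case False
    then have "Suc (Suc i mod ?n) < ?n" using lt by linarith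
    moreover from this have "Suc (Suc i) mod ?n = Suc (Suc i mod ?n)"
      by (metis mod_Suc_eq mod_less)
    ultimately show ?thesis by (simp add: nth_append)
  qed
  finally show "strands c ! i = rotate1 (path_strands (last c) c (hd c)) ! i"
    using i by (simp add: nth_strands)
qed simp

definition cyc_strands :: "nat list \<Rightarrow> (nat \<times> nat \<times> nat) list" where
  "cyc_strands c = path_strands (last c) c (hd c)"

lemma cyc_strands_cyc_class: 
  assumes "d \<in> cyc_class c" 
  shows "cyc_strands d \<in> cyc_class (strands c)"
proof (cases "d = []")
  case True
  then have "c = []" using assms cyc_class_length by fastforce
  then show ?thesis using True by (simp add: cyc_strands_def strands_def cyc_class_self)
next
  case False
  then have "strands d \<in> cyc_class (cyc_strands d)"
    by (simp add: rotate1_cyc_strands cyc_class_rotate1 cyc_strands_def)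
  then show ?thesis using assms strands_cyc_class cyc_class_sym cyc_class_trans by blast
qed

lemma set_cyc_strands: "d \<in> cyc_class c \<Longrightarrow> set (cyc_strands d) = set (strands c)"
  by (rule cyc_class_set[OF cyc_strands_cyc_class])

section \<open>Edges of paths, and cycles determined by their consecutive pairs\<close>

fun path_edges :: "nat list \<Rightarrow> nat set list" where
  "path_edges (x # y # xs) = {x, y} # path_edges (y # xs)"
| "path_edges _ = []"

lemma path_edges_append: "path_edges (xs @ a # ys) = path_edges (xs @ [a]) @ path_edges (a # ys)"
  by (induction xs rule: path_edges.induct) auto

lemma path_edges_edge_cyc: "map (\<lambda>(x, y). {x, y}) (cyc_pairs (x # xs)) = path_edges (x # xs @ [x])"
proof -
  have "map (\<lambda>(x, y). {x, y}) (zip (y # xs) (xs @ [z])) = path_edges (y # xs @ [z])" for y z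
    by (induction xs arbitrary: y) auto
  then show ?thesis by (simp add: cyc_pairs_def)
qed

lemma path_edges_verts: "e \<in> set (path_edges xs) \<Longrightarrow> e \<subseteq> set xs"
  by (induction xs rule: path_edges.induct) auto

lemma path_edges_E: "e \<in> set (path_edges xs) \<Longrightarrow> \<exists>us a b vs. e = {a, b} \<and> xs = us @ a # b # vs"
proof (induction xs rule: path_edges.induct)
  case (1 x y xs)
  then consider "e = {x,y}" | "e \<in> set (path_edges (y # xs))" by auto
  then show ?case
  proof cases
    case 1 then show ?thesis by (metis append_Nil)
  next
    case 2
    with 1(1) obtain us a b vs where "e = {a, b}" "y # xs = us @ a # b # vs" by blast
    then have "e = {a, b} \<and> x # y # xs = (x # us) @ a # b # vs" by simp
    then show ?thesis by blast
  qed
qed auto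

lemma path_edges_distinct: "distinct xs \<Longrightarrow> distinct (path_edges xs)"
  by (induction xs rule: path_edges.induct) (auto dest: path_edges_verts)

lemma successively_path_edges: "successively (\<lambda>x y. {x, y} \<in> E) xs \<longleftrightarrow> set (path_edges xs) \<subseteq> E"
  by (induction xs rule: path_edges.induct) auto

lemma cyc_pairs_mem: "(a, b) \<in> set (cyc_pairs xs) \<longleftrightarrow>
    (\<exists>i < length xs. a = xs ! i \<and> b = xs ! (Suc i mod length xs))"
  by (auto simp: in_set_conv_nth nth_cyc_pairs)

lemma cyc_pairs_in: "(a, b) \<in> set (cyc_pairs xs) \<Longrightarrow> a \<in> set xs \<and> b \<in> set xs"
  unfolding cyc_pairs_def by (metis in_set_zipE set_rotate1)

lemma cyc_pairs_succ: "a \<in> set xs \<Longrightarrow> \<exists>b. (a, b) \<in> set (cyc_pairs xs)"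
  unfolding cyc_pairs_mem by (metis in_set_conv_nth)

lemma cyc_pairs_pred: "b \<in> set xs \<Longrightarrow> \<exists>a. (a, b) \<in> set (cyc_pairs xs)"
  unfolding cyc_pairs_def
  by (metis length_rotate1 set_rotate1 set_zip_rightD in_set_impl_in_set_zip2)

lemma cyc_pairs_unique_succ:
  "distinct xs \<Longrightarrow> (a, b) \<in> set (cyc_pairs xs) \<Longrightarrow> (a, b') \<in> set (cyc_pairs xs) \<Longrightarrow> b = b'"
  unfolding cyc_pairs_mem by (metis nth_eq_iff_index_eq)

text \<open>Both pairs together would force i + 2 = i modulo the length, which is at least 3. This
  is the source of consistent orientation: no triangle occurs with both orders.\<close>

lemma cyc_pairs_asym:
  assumes "distinct xs" "3 \<le> length xs" "(a, b) \<in> set (cyc_pairs xs)" "(b, a) \<in> set (cyc_pairs xs)"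
  shows False
proof -
  let ?n = "length xs"
  obtain i j where ij: "i < ?n" "j < ?n" "a = xs ! i" "b = xs ! (Suc i mod ?n)"
     "b = xs ! j" "a = xs ! (Suc j mod ?n)"
    using assms(3,4) unfolding cyc_pairs_mem by blast
  have "?n > 0" using assms(2) by linarith
  then have lt: "Suc i mod ?n < ?n" "Suc j mod ?n < ?n" by (simp_all del: length_greater_0_conv)
  have "j = Suc i mod ?n" "i = Suc j mod ?n"
    using ij lt nth_eq_iff_index_eq[OF assms(1)] by metis+
  moreover have "Suc k mod ?n = (if Suc k = ?n then 0 else Suc k)" if "k < ?n" for k
    using that by (simp add: mod_Suc)
  ultimately have "j = (if Suc i = ?n then 0 else Suc i)" "i = (if Suc j = ?n then 0 else Suc j)"
    using ij(1,2) by metis+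
  then show False using assms(2) by presburger
qed

lemma cyc_pairs_Cons2: "(x, y) \<in> set (cyc_pairs (us @ x # y # vs))"
proof -
  have "(us @ x # y # vs) ! length us = x" "(us @ x # y # vs) ! Suc (length us) = y"
    by (auto simp: nth_append)
  then show ?thesis unfolding cyc_pairs_mem by (intro exI[of _ "length us"]) auto
qed

text \<open>The pairs define a successor function. Once one cycle is rotated to start at the head of
  the other, induction along the successors identifies them entry by entry.\<close>

lemma cycle_unique:
  assumes "distinct xs" "distinct ys" "xs \<noteq> []" "set (cyc_pairs xs) = set (cyc_pairs ys)"
  shows "ys \<in> cyc_class xs"
proof -
  have "set xs = set ys" using assms(4) cyc_pairs_in cyc_pairs_succ by (metis subsetI subset_antisym)
  then have len: "length xs = length ys" using assms(1,2) by (metis distinct_card)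
  then have "ys \<noteq> []" using assms(3) by auto
  then have "hd ys \<in> set xs" using \<open>set xs = set ys\<close> by simp
  then obtain zs where zs: "hd ys # zs \<in> cyc_class xs" using cyc_class_hd_in by metis
  let ?z = "hd ys # zs"
  have z: "distinct ?z" "length ?z = length ys" "set (cyc_pairs ?z) = set (cyc_pairs ys)"
    using cyc_class_distinct[OF zs] assms(1,4) cyc_class_length[OF zs] len
      cyc_class_set[OF cyc_pairs_cyc_class[OF zs]] by metis+
  have "i < length ys \<Longrightarrow> ?z ! i = ys ! i" for i
  proof (induction i)
    case 0 then show ?case by (simp add: hd_conv_nth)
  next
    case (Suc i)
    have "(?z ! i, ?z ! Suc i) \<in> set (cyc_pairs ?z)" using Suc.prems z(2)
      unfolding cyc_pairs_mem by (intro exI[of _ i]) auto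
    moreover have "(ys ! i, ys ! Suc i) \<in> set (cyc_pairs ys)" using Suc.prems
      unfolding cyc_pairs_mem by (intro exI[of _ i]) auto
    ultimately show ?case using Suc z(3) cyc_pairs_unique_succ[OF assms(2)] by auto
  qed
  then have "?z = ys" using z(2) by (intro nth_equalityI) auto
  then show ?thesis using zs by simp
qed

section \<open>Closed surfaces\<close>

lemma link_cycle_iff:
  "link_cycle T v xs \<Longrightarrow> (v, y, z) \<in> T \<longleftrightarrow> (y, z) \<in> set (cyc_pairs xs)"
  unfolding link_cycle_def by blast

lemma link_cycle_unique:
  assumes "link_cycle T v xs" "link_cycle T v ys" 
  shows "ys \<in> cyc_class xs"
  by (rule cycle_unique) (use assms in \<open>auto simp: link_cycle_def\<close>)

lemma link_cycle_cyc_class: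
  assumes "link_cycle T v xs" "ys \<in> cyc_class xs"
  shows "link_cycle T v ys"
  using assms cyc_class_distinct[OF assms(2)] cyc_class_length[OF assms(2)]
    cyc_class_set[OF cyc_pairs_cyc_class[OF assms(2)]]
  unfolding link_cycle_def by auto

context
  fixes T :: triangles
  assumes S: "closed_connected_surface T"
begin

lemma surface_rot: "(x, y, z) \<in> T \<Longrightarrow> (y, z, x) \<in> T"
  using S unfolding closed_connected_surface_def by blast

lemma surface_link: "(x, y, z) \<in> T \<Longrightarrow> \<exists>xs. link_cycle T x xs"
  using S unfolding closed_connected_surface_def verts_def by fast

text \<open>Otherwise y, z and z, y would both be consecutive in the link of x.\<close>

lemma surface_no_opposite: "(x, y, z) \<in> T \<Longrightarrow> (x, z, y) \<notin> T"
  using surface_link[of x y z] cyc_pairs_asym[of _ y z] unfolding link_cycle_def by auto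

lemma surface_neq:
  assumes "(x, y, z) \<in> T"
  shows "x \<noteq> y" "y \<noteq> z" "z \<noteq> x"
proof -
  have "b \<noteq> c" if "(a, b, c) \<in> T" for a b c
    using surface_no_opposite[OF that] that by auto
  then show "x \<noteq> y" "y \<noteq> z" "z \<noteq> x" using assms surface_rot by blast+
qed

lemma surface_unique: "(x, y, z) \<in> T \<Longrightarrow> (x, y, z') \<in> T \<Longrightarrow> z = z'"
  using surface_link[of x y z] cyc_pairs_unique_succ link_cycle_def link_cycle_iff by metis

text \<open>The triangle across the edge comes from the predecessor of y in the link of x; it is a
  different one because no triangle occurs with both orientations.\<close>

lemma surface_adjacent: 
  assumes "(x, y, z) \<in> T" 
  shows "\<exists>w. (y, x, w) \<in> T \<and> w \<noteq> z"
proof -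
  obtain xs where xs: "link_cycle T x xs" using surface_link assms by blast
  then have "y \<in> set xs" using assms link_cycle_iff cyc_pairs_in by metis
  then obtain w where "(x, w, y) \<in> T" using cyc_pairs_pred xs link_cycle_iff by metis
  then show ?thesis using surface_no_opposite surface_rot assms by blast
qed

text \<open>Of the six orders of three distinct vertices, the three odd ones have the wrong
  orientation. Hence a face determines its oriented triangle up to rotation.\<close>

lemma surface_face:
  assumes "(x, y, z) \<in> T" "(a, b, c) \<in> T" "{a, b, c} = {x, y, z}"
  shows "(a, b, c) \<in> {(x, y, z), (y, z, x), (z, x, y)}"
proof -
  have "(x, z, y) \<notin> T" "(z, y, x) \<notin> T" "(y, x, z) \<notin> T" 
    using assms(1) surface_no_opposite surface_rot by blast+
  moreover have "a \<noteq> b" "b \<noteq> c" "c \<noteq> a" using surface_neq assms(2) by blast+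
  moreover have "a \<in> {x, y, z}" "b \<in> {x, y, z}" "c \<in> {x, y, z}" using assms(3) by blast+
  ultimately have "(a, b, c) \<in> {(x, y, z), (y, z, x), (z, x, y), (x, z, y), (z, y, x), (y, x, z)}"
    by (elim insertE emptyE) simp_all
  moreover note \<open>(x, z, y) \<notin> T\<close> \<open>(z, y, x) \<notin> T\<close> \<open>(y, x, z) \<notin> T\<close>
  ultimately show ?thesis using assms(2) by auto
qed

lemma surface_edge: "e \<in> edges T \<longleftrightarrow> (\<exists>x y z. (x, y, z) \<in> T \<and> e = {x, y})"
proof
  assume "e \<in> edges T"
  then obtain x y z where "(x, y, z) \<in> T" "e \<in> {{x, y}, {y, z}, {z, x}}"
    unfolding edges_def by auto
  then show "\<exists>x y z. (x, y, z) \<in> T \<and> e = {x, y}" using surface_rot by blast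
next
  assume "\<exists>x y z. (x, y, z) \<in> T \<and> e = {x, y}"
  then show "e \<in> edges T" unfolding edges_def by blast
qed

lemma surface_edge_card: "e \<in> edges T \<Longrightarrow> card e = 2"
  using surface_edge surface_neq by auto

lemma surface_edge_neq: "{x, y} \<in> edges T \<Longrightarrow> x \<noteq> y"
  using surface_edge_card by fastforce

lemma surface_vert: "x \<in> verts T \<longleftrightarrow> (\<exists>y z. (x, y, z) \<in> T)"
proof
  assume "x \<in> verts T"
  then obtain a b c where "(a, b, c) \<in> T" "x \<in> {a, b, c}"
    unfolding verts_def by auto
  then show "\<exists>y z. (x, y, z) \<in> T" using surface_rot by blast
next
  assume "\<exists>y z. (x, y, z) \<in> T"
  then show "x \<in> verts T" unfolding verts_def by blast
qed

lemma surface_edge_cases: 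
  assumes "{x, y} \<in> edges T" 
  shows "\<exists>z. (x, y, z) \<in> T"
proof -
  obtain a b c where "(a, b, c) \<in> T" "{x, y} = {a, b}" using assms surface_edge by blast
  then show ?thesis using surface_adjacent[of a b c] by (auto simp: doubleton_eq_iff)
qed

end

section \<open>Barycentric subdivision of a surface\<close>

definition sd_edge :: "nat \<Rightarrow> nat \<Rightarrow> nat" where
  "sd_edge x y = set_encode {x, y}"

definition sd_face :: "nat \<Rightarrow> nat \<Rightarrow> nat \<Rightarrow> nat" where
  "sd_face x y z = set_encode {x, y, z}"

lemma sd_code_eq:
  "sd_vertex x = sd_vertex y \<longleftrightarrow> x = y"
  "sd_edge x y = sd_edge a b \<longleftrightarrow> {x, y} = {a, b}"
  "sd_face x y z = sd_face a b c \<longleftrightarrow> {x, y, z} = {a, b, c}"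
  "sd_vertex x = sd_edge a b \<longleftrightarrow> a = x \<and> b = x"
  "sd_edge a b = sd_vertex x \<longleftrightarrow> a = x \<and> b = x"
  "sd_vertex x = sd_face a b c \<longleftrightarrow> a = x \<and> b = x \<and> c = x"
  "sd_face a b c = sd_vertex x \<longleftrightarrow> a = x \<and> b = x \<and> c = x"
  "sd_edge x y = sd_face a b c \<longleftrightarrow> {x, y} = {a, b, c}"
  "sd_face a b c = sd_edge x y \<longleftrightarrow> {a, b, c} = {x, y}"
  by (auto simp: sd_vertex_def sd_edge_def sd_face_def set_encode_eq)

lemma sd_edge_commute: "sd_edge x y = sd_edge y x"
  by (simp add: sd_edge_def insert_commute)

lemma sd_face_rot: "sd_face x y z = sd_face y z x"
  by (simp add: sd_face_def insert_commute)

lemma sd_vertex_neq_sd_edge: "a \<noteq> b \<Longrightarrow> sd_vertex x \<noteq> sd_edge a b"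
  by (auto simp: sd_code_eq)

lemma sd_vertex_neq_sd_face: "a \<noteq> b \<Longrightarrow> sd_vertex x \<noteq> sd_face a b c"
  by (auto simp: sd_code_eq)

lemma sd_edge_neq_sd_face: "a \<noteq> b \<Longrightarrow> b \<noteq> c \<Longrightarrow> c \<noteq> a \<Longrightarrow> sd_edge x y \<noteq> sd_face a b c"
proof -
  assume "a \<noteq> b" "b \<noteq> c" "c \<noteq> a"
  then have "card {a, b, c} = 3" by auto
  moreover have "card {x, y} \<le> 2" by (simp add: card_insert_if)
  ultimately show "sd_edge x y \<noteq> sd_face a b c" by (auto simp: sd_code_eq)
qed

text \<open>One triple (x, y, z) accounts for the two small triangles along its edge xy, each in
  three rotations; the remaining four small triangles of the face come from the rotations of (x, y,
  z) when these lie in \<open>T\<close>.\<close>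

lemma sd_mem: "(a, b, c) \<in> sd T \<longleftrightarrow> (\<exists>x y z. (x, y, z) \<in> T \<and> (a, b, c) \<in>
    {(sd_vertex x, sd_edge x y, sd_face x y z), (sd_edge x y, sd_face x y z, sd_vertex x), (sd_face x y z, sd_vertex x, sd_edge x y),
     (sd_edge x y, sd_vertex y, sd_face x y z), (sd_vertex y, sd_face x y z, sd_edge x y), (sd_face x y z, sd_edge x y, sd_vertex y)})"
  unfolding sd_def rots_def sd_vertex_def sd_edge_def sd_face_def
  by (simp only: UN_iff Bex_def split_paired_Ex case_prod_conv Un_iff insert_iff empty_iff disj_assoc simp_thms)

lemma sd_mono: "A \<subseteq> B \<Longrightarrow> sd A \<subseteq> sd B"
  unfolding sd_def by blast

text \<open>Common form of two constructions: with \<open>sd_vertex\<close> and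
  \<open>sd_edge\<close> it subdivides a path, with \<open>sd_edge v\<close> and
  \<open>sd_face v\<close> it turns the link of v into the link of its copy in the subdivision. The
  argument \<open>b\<close> is the vertex after the last entry.\<close>

fun interleave :: "('a \<Rightarrow> 'b) \<Rightarrow> ('a \<Rightarrow> 'a \<Rightarrow> 'b) \<Rightarrow> 'a list \<Rightarrow> 'a \<Rightarrow> 'b list" where
  "interleave f g [] b = []"
| "interleave f g (x # xs) b = f x # g x (hd (xs @ [b])) # interleave f g xs b"

lemma interleave_append:
  "interleave f g (xs @ ys) b = interleave f g xs (hd (ys @ [b])) @ interleave f g ys b"
  by (induction xs) (auto simp: hd_append)

lemma interleave_conv:
  "interleave f g xs b = concat (map (\<lambda>(x, y). [f x, g x y]) (zip xs (tl xs @ [b])))"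
proof (induction xs)
  case (Cons x xs) then show ?case by (cases xs) auto
qed simp

lemma hd_interleave: "hd (interleave f g xs b @ [f b]) = f (hd (xs @ [b]))"
  by (cases xs) auto

lemma zip_interleave:
  "zip (interleave f g xs b) (tl (interleave f g xs b) @ [f b]) =
   concat (map (\<lambda>(x, y). [(f x, g x y), (g x y, f y)]) (zip xs (tl xs @ [b])))"
proof (induction xs)
  case (Cons x xs) then show ?case by (cases xs) auto
qed simp

lemma cyc_pairs_zip: "c \<noteq> [] \<Longrightarrow> cyc_pairs c = zip c (tl c @ [hd c])"
  by (simp add: cyc_pairs_def rotate1_hd_tl)

lemma interleave_cyc:
  "interleave f g c (hd c) = concat (map (\<lambda>(x, y). [f x, g x y]) (cyc_pairs c))"
  by (cases "c = []") (auto simp: cyc_pairs_zip interleave_conv)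

lemma cyc_pairs_interleave:
  "cyc_pairs (interleave f g c (hd c)) =
    concat (map (\<lambda>(x, y). [(f x, g x y), (g x y, f y)]) (cyc_pairs c))"
proof (cases c)
  case (Cons x xs)
  then show ?thesis
    using zip_interleave[of f g c "hd c"] by (simp add: cyc_pairs_zip)
qed simp

lemma sd_path_interleave: "sd_path c = interleave sd_vertex sd_edge c (hd c)"
  unfolding interleave_cyc sd_path_def sd_vertex_def sd_edge_def by simp

lemma mset_interleave_cyc:
  "mset (interleave f g c (hd c)) = image_mset f (mset c) + image_mset (\<lambda>(x, y). g x y) (mset (cyc_pairs c))"
proof -
  have "mset (concat (map (\<lambda>(x, y). [f x, g x y]) ps)) =
      image_mset f (mset (map fst ps)) + image_mset (\<lambda>(x, y). g x y) (mset ps)" for ps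
    by (induction ps) auto
  moreover have "map fst (cyc_pairs c) = c" by (simp add: cyc_pairs_def)
  ultimately show ?thesis unfolding interleave_cyc by metis
qed

text \<open>Up to order the list consists of the images of the entries and of the consecutive pairs,
  so distinctness reduces to injectivity of both maps and disjointness of their images.\<close>

lemma distinct_interleave_cyc:
  assumes "distinct c" "inj_on f (set c)" "inj_on (\<lambda>(x, y). g x y) (set (cyc_pairs c))"
    "f ` set c \<inter> (\<lambda>(x, y). g x y) ` set (cyc_pairs c) = {}"
  shows "distinct (interleave f g c (hd c))"
proof -
  have "distinct (cyc_pairs c)" using assms(1) by (simp add: cyc_pairs_def distinct_zipI1)
  then have "distinct (map f c @ map (\<lambda>(x, y). g x y) (cyc_pairs c))"
    using assms by (simp add: distinct_map)
  moreover have "mset (interleave f g c (hd c)) = mset (map f c @ map (\<lambda>(x, y). g x y) (cyc_pairs c))"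
    by (simp add: mset_interleave_cyc)
  ultimately show ?thesis using mset_eq_imp_distinct_iff by metis
qed

lemma set_cyc_pairs_interleave:
  "set (cyc_pairs (interleave f g c (hd c))) =
    (\<Union>(x, y)\<in>set (cyc_pairs c). {(f x, g x y), (g x y, f y)})"
  by (auto simp: cyc_pairs_interleave)

lemma length_interleave [simp]: "length (interleave f g xs b) = 2 * length xs"
  by (induction xs) auto

section \<open>Links of the barycentres of vertices, edges and faces\<close>

context
  fixes T :: triangles
  assumes S: "closed_connected_surface T"
begin

lemma sd_codes_neq:
  assumes "(x, y, z) \<in> T"
  shows "sd_vertex u \<noteq> sd_edge x y" "sd_edge x y \<noteq> sd_vertex u" "sd_vertex u \<noteq> sd_face x y z" "sd_face x y z \<noteq> sd_vertex u"
    "sd_edge u v \<noteq> sd_face x y z" "sd_face x y z \<noteq> sd_edge u v"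
  using sd_vertex_neq_sd_edge sd_vertex_neq_sd_face sd_edge_neq_sd_face surface_neq[OF S assms] by metis+

text \<open>Each triangle v y z is halved at v by the segment to its barycentre. The half along vy
  comes from the triple starting with v, the other half from the rotated triple z v y.\<close>

lemma sd_at_vertex:
  "(sd_vertex v, b, c) \<in> sd T \<longleftrightarrow>
    (\<exists>y z. (v, y, z) \<in> T \<and> (b, c) \<in> {(sd_edge v y, sd_face v y z), (sd_face v y z, sd_edge v z)})"  (is "?L = ?R")
proof
  assume ?L
  then obtain x y z where T: "(x, y, z) \<in> T" and *: "(sd_vertex v, b, c) \<in> 
    {(sd_vertex x, sd_edge x y, sd_face x y z), (sd_edge x y, sd_face x y z, sd_vertex x), (sd_face x y z, sd_vertex x, sd_edge x y),
     (sd_edge x y, sd_vertex y, sd_face x y z), (sd_vertex y, sd_face x y z, sd_edge x y), (sd_face x y z, sd_edge x y, sd_vertex y)}"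
    unfolding sd_mem by blast
  then have "(v = x \<and> b = sd_edge x y \<and> c = sd_face x y z) \<or> (v = y \<and> b = sd_face x y z \<and> c = sd_edge x y)"
    using sd_codes_neq[OF T] by (auto simp: sd_code_eq(1))
  then consider "v = x" "b = sd_edge x y" "c = sd_face x y z" | "v = y" "b = sd_face y z x" "c = sd_edge y x"
    using sd_edge_commute[of x y] sd_face_rot[of x y z] by auto
  then show ?R
  proof cases
    case 1 then show ?thesis using T by blast
  next
    case 2 then show ?thesis using surface_rot[OF S T] by blast
  qed
next
  assume ?R
  then obtain y z where T: "(v, y, z) \<in> T" "(b, c) \<in> {(sd_edge v y, sd_face v y z), (sd_face v y z, sd_edge v z)}" by blast
  have 1: "(z, v, y) \<in> T" using T surface_rot[OF S] by blast
  have 2: "sd_edge z v = sd_edge v z" "sd_face z v y = sd_face v y z" using sd_edge_commute sd_face_rot by metis+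
  from T(2) consider "b = sd_edge v y" "c = sd_face v y z" | "b = sd_face v y z" "c = sd_edge v z" by auto
  then show ?L
  proof cases
    case 1 then show ?thesis unfolding sd_mem using T(1) by blast
  next
    case case_b: 2
    have "(sd_vertex v, sd_face z v y, sd_edge z v) \<in> sd T" unfolding sd_mem using 1 by blast
    with case_b show ?thesis using 2 by simp
  qed
qed

lemma sd_link_vertex:
  assumes "link_cycle T v xs"
  shows "link_cycle (sd T) (sd_vertex v) (interleave (sd_edge v) (sd_face v) xs (hd xs))"
proof -
  have xs: "distinct xs" "3 \<le> length xs" "\<And>y z. (v, y, z) \<in> T \<longleftrightarrow> (y, z) \<in> set (cyc_pairs xs)"
    using assms link_cycle_iff unfolding link_cycle_def by blast+
  have nv: "v \<notin> set xs" using cyc_pairs_succ xs(3) surface_neq[OF S] by metis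
  have "distinct (interleave (sd_edge v) (sd_face v) xs (hd xs))"
  proof (rule distinct_interleave_cyc)
    show "inj_on (sd_edge v) (set xs)" using nv by (auto intro!: inj_onI simp: sd_code_eq doubleton_eq_iff)
    show "inj_on (\<lambda>(x, y). sd_face v x y) (set (cyc_pairs xs))"
    proof (intro inj_onI, clarsimp)
      fix a b a' b' assume *: "(a, b) \<in> set (cyc_pairs xs)" "(a', b') \<in> set (cyc_pairs xs)" 
        "sd_face v a b = sd_face v a' b'"
      then have "(v, a, b) \<in> T" "(v, a', b') \<in> T" using xs by auto
      moreover have "{v, a, b} = {v, a', b'}" using *(3) by (simp add: sd_code_eq)
      \<comment> \<open>Triangles with the same vertex set agree up to rotation, and only the
        trivial rotation keeps v in front.\<close>
      ultimately have "(v, a, b) \<in> {(v, a', b'), (a', b', v), (b', v, a')}" "v \<noteq> a'" "v \<noteq> b'"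
        using surface_face[OF S \<open>(v, a', b') \<in> T\<close> \<open>(v, a, b) \<in> T\<close>] surface_neq[OF S \<open>(v, a', b') \<in> T\<close>] by auto
      then show "a = a' \<and> b = b'" by auto
    qed
    show "sd_edge v ` set xs \<inter> (\<lambda>(x, y). sd_face v x y) ` set (cyc_pairs xs) = {}"
      using xs(3) sd_codes_neq by fastforce
  qed (rule xs)
  moreover have "{(y, z). (sd_vertex v, y, z) \<in> sd T} =
      set (cyc_pairs (interleave (sd_edge v) (sd_face v) xs (hd xs)))"
    unfolding sd_at_vertex set_cyc_pairs_interleave xs(3) by auto
  ultimately show ?thesis using xs(2) unfolding link_cycle_def by simp
qed

text \<open>The midpoint of an edge is surrounded by the two ends of the edge and the barycentres of
  the two faces on it; \<open>wz\<close> keeps these barycentres apart.\<close>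

lemma sd_link_edge:
  assumes T: "(x, y, z) \<in> T" "(y, x, w) \<in> T"
  shows "link_cycle (sd T) (sd_edge x y) [sd_vertex y, sd_face x y z, sd_vertex x, sd_face y x w]"
proof -
  have wz: "w \<noteq> z" using surface_adjacent[OF S T(1)] surface_unique[OF S T(2)] by blast
  note neq = surface_neq[OF S T(1)] surface_neq[OF S T(2)]
  have "{(b, c). (sd_edge x y, b, c) \<in> sd T} =
     {(sd_vertex y, sd_face x y z), (sd_face x y z, sd_vertex x), (sd_vertex x, sd_face y x w), (sd_face y x w, sd_vertex y)}" (is "?L = ?R")
  proof
    have "(sd_edge x y, sd_vertex y, sd_face x y z) \<in> sd T" "(sd_edge x y, sd_face x y z, sd_vertex x) \<in> sd T"
      "(sd_edge y x, sd_vertex x, sd_face y x w) \<in> sd T" "(sd_edge y x, sd_face y x w, sd_vertex y) \<in> sd T"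
      unfolding sd_mem using T by blast+
    then show "?R \<subseteq> ?L" using sd_edge_commute[of x y] by auto
    show "?L \<subseteq> ?R"
    proof
      fix bc assume "bc \<in> ?L"
      then obtain b c where bc': "bc = (b, c)" and "(sd_edge x y, b, c) \<in> sd T" by blast
      then obtain x' y' z' where T': "(x', y', z') \<in> T" and *: "(sd_edge x y, b, c) \<in> 
    {(sd_vertex x', sd_edge x' y', sd_face x' y' z'), (sd_edge x' y', sd_face x' y' z', sd_vertex x'), (sd_face x' y' z', sd_vertex x', sd_edge x' y'),
     (sd_edge x' y', sd_vertex y', sd_face x' y' z'), (sd_vertex y', sd_face x' y' z', sd_edge x' y'), (sd_face x' y' z', sd_edge x' y', sd_vertex y')}"
        unfolding sd_mem by blast
      note neq' = surface_neq[OF S T']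
      have nF: "sd_edge x y \<noteq> sd_face x' y' z'" using sd_codes_neq[OF T'] by blast
      have nV: "sd_edge x y \<noteq> sd_vertex u" for u using sd_codes_neq[OF T(1)] by blast
      have e: "sd_edge x y = sd_edge x' y'" and bc: "(b, c) \<in> {(sd_face x' y' z', sd_vertex x'), (sd_vertex y', sd_face x' y' z')}"
        using * nF nV by auto
      from e consider "x' = x" "y' = y" | "x' = y" "y' = x" by (auto simp: sd_code_eq doubleton_eq_iff)
      then have "(b, c) \<in> ?R"
      proof cases
        case 1
        then have "z' = z" using T T' surface_unique[OF S] by blast
        then show ?thesis using bc 1 by auto
      next
        case 2
        then have "z' = w" using T T' surface_unique[OF S] by blast
        then show ?thesis using bc 2 by auto
      qed
      then show "bc \<in> ?R" unfolding bc' .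
    qed
  qed
  moreover have "set (cyc_pairs [sd_vertex y, sd_face x y z, sd_vertex x, sd_face y x w]) = ?R"
    by (auto simp: cyc_pairs_def)
  moreover have "distinct [sd_vertex y, sd_face x y z, sd_vertex x, sd_face y x w]"
    using neq wz by (auto simp: sd_code_eq)
  ultimately show ?thesis unfolding link_cycle_def by simp
qed

text \<open>The link of the barycentre of a face is the subdivided boundary of the face, a hexagon;
  all rotations of the triangle share the same code.\<close>

lemma sd_link_face:
  assumes T: "(x, y, z) \<in> T"
  shows "link_cycle (sd T) (sd_face x y z) [sd_vertex x, sd_edge x y, sd_vertex y, sd_edge y z, sd_vertex z, sd_edge z x]"
proof -
  note neq = surface_neq[OF S T]
  have R: "(y, z, x) \<in> T" "(z, x, y) \<in> T" using T surface_rot[OF S] by blast+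
  have eF: "sd_face y z x = sd_face x y z" "sd_face z x y = sd_face x y z" using sd_face_rot by metis+
  have "{(b, c). (sd_face x y z, b, c) \<in> sd T} =
     {(sd_vertex x, sd_edge x y), (sd_edge x y, sd_vertex y), (sd_vertex y, sd_edge y z), (sd_edge y z, sd_vertex z),
      (sd_vertex z, sd_edge z x), (sd_edge z x, sd_vertex x)}" (is "?L = ?R")
  proof
    have "(sd_face a b c, sd_vertex a, sd_edge a b) \<in> sd T" "(sd_face a b c, sd_edge a b, sd_vertex b) \<in> sd T" 
      if "(a, b, c) \<in> T" for a b c unfolding sd_mem using that by blast+
    from this[OF T] this[OF R(1)] this[OF R(2)] show "?R \<subseteq> ?L" using eF by auto
    show "?L \<subseteq> ?R"
    proof
      fix bc assume "bc \<in> ?L"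
      then obtain b c where bc': "bc = (b, c)" and "(sd_face x y z, b, c) \<in> sd T" by blast
      then obtain x' y' z' where T': "(x', y', z') \<in> T" and *: "(sd_face x y z, b, c) \<in> 
    {(sd_vertex x', sd_edge x' y', sd_face x' y' z'), (sd_edge x' y', sd_face x' y' z', sd_vertex x'), (sd_face x' y' z', sd_vertex x', sd_edge x' y'),
     (sd_edge x' y', sd_vertex y', sd_face x' y' z'), (sd_vertex y', sd_face x' y' z', sd_edge x' y'), (sd_face x' y' z', sd_edge x' y', sd_vertex y')}"
        unfolding sd_mem by blast
      have nE: "sd_face x y z \<noteq> sd_edge a b" for a b using sd_codes_neq[OF T] by blast
      have nV: "sd_face x y z \<noteq> sd_vertex u" for u using sd_codes_neq[OF T] by blast
      have e: "sd_face x' y' z' = sd_face x y z" and bc: "(b, c) \<in> {(sd_vertex x', sd_edge x' y'), (sd_edge x' y', sd_vertex y')}"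
        using * nE nV by auto
      then have "(x', y', z') \<in> {(x, y, z), (y, z, x), (z, x, y)}" 
        using surface_face[OF S T T'] by (simp add: sd_code_eq)
      then show "bc \<in> ?R" unfolding bc' using bc by auto
    qed
  qed
  moreover have "set (cyc_pairs [sd_vertex x, sd_edge x y, sd_vertex y, sd_edge y z, sd_vertex z, sd_edge z x]) = ?R"
    by (auto simp: cyc_pairs_def)
  moreover have "distinct [sd_vertex x, sd_edge x y, sd_vertex y, sd_edge y z, sd_vertex z, sd_edge z x]"
    using neq by (auto simp: sd_code_eq doubleton_eq_iff)
  ultimately show ?thesis unfolding link_cycle_def by simp
qed

lemma verts_sd: "a \<in> verts (sd T) \<Longrightarrow>
   (\<exists>x y z. (x, y, z) \<in> T \<and> a \<in> {sd_vertex x, sd_edge x y, sd_face x y z})"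
proof -
  assume "a \<in> verts (sd T)"
  then obtain p q r where "(p, q, r) \<in> sd T" "a \<in> {p, q, r}" unfolding verts_def by auto
  moreover from this obtain x y z where T: "(x, y, z) \<in> T" and *: "(p, q, r) \<in> 
    {(sd_vertex x, sd_edge x y, sd_face x y z), (sd_edge x y, sd_face x y z, sd_vertex x), (sd_face x y z, sd_vertex x, sd_edge x y),
     (sd_edge x y, sd_vertex y, sd_face x y z), (sd_vertex y, sd_face x y z, sd_edge x y), (sd_face x y z, sd_edge x y, sd_vertex y)}"
    unfolding sd_mem by blast
  ultimately have "a \<in> {sd_vertex x, sd_edge x y, sd_face x y z} \<or> a = sd_vertex y" by (elim insertE) simp_all
  then show "\<exists>x y z. (x, y, z) \<in> T \<and> a \<in> {sd_vertex x, sd_edge x y, sd_face x y z}"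
    using T surface_rot[OF S T] by blast
qed

lemma finite_sd: "finite (sd T)"
proof -
  have "finite T" using S unfolding closed_connected_surface_def by blast
  moreover have "finite (rots p)" for p unfolding rots_def by (cases p) auto
  ultimately show ?thesis unfolding sd_def by (auto split: prod.splits)
qed

lemma sd_edge_vertex:
  assumes "(x, y, z) \<in> T"
  shows "{sd_vertex x, sd_edge x y} \<in> edges (sd T)" "{sd_edge x y, sd_vertex y} \<in> edges (sd T)"
    "{sd_face x y z, sd_vertex x} \<in> edges (sd T)" "{sd_edge x y, sd_face x y z} \<in> edges (sd T)"
proof -
  have "(sd_vertex x, sd_edge x y, sd_face x y z) \<in> sd T" "(sd_edge x y, sd_vertex y, sd_face x y z) \<in> sd T" 
    unfolding sd_mem using assms by auto
  then show "{sd_vertex x, sd_edge x y} \<in> edges (sd T)" "{sd_edge x y, sd_vertex y} \<in> edges (sd T)"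
    "{sd_face x y z, sd_vertex x} \<in> edges (sd T)" "{sd_edge x y, sd_face x y z} \<in> edges (sd T)" unfolding edges_def by blast+
qed

text \<open>The links have been computed for all three kinds of vertices. For connectedness, every
  barycentre is adjacent to an old vertex, and adjacent old vertices are joined through the midpoint
  of their edge.\<close>

lemma closed_connected_surface_sd: "closed_connected_surface (sd T)"
proof -
  have ne: "T \<noteq> {}" using S unfolding closed_connected_surface_def by blast
  have link: "\<exists>xs. link_cycle (sd T) a xs" if av: "a \<in> verts (sd T)" for a
  proof -
    obtain x y z where T: "(x, y, z) \<in> T" and a: "a \<in> {sd_vertex x, sd_edge x y, sd_face x y z}" 
      using verts_sd[OF av] by blast
    obtain w where "(y, x, w) \<in> T" using surface_adjacent[OF S T] by blast
    from sd_link_edge[OF T this] sd_link_face[OF T]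
    have "\<exists>xs. link_cycle (sd T) (sd_edge x y) xs" "\<exists>xs. link_cycle (sd T) (sd_face x y z) xs" by blast+
    moreover have "\<exists>xs. link_cycle (sd T) (sd_vertex x) xs"
      using surface_link[OF S T] sd_link_vertex by blast
    ultimately show ?thesis using a by auto
  qed
  have rot: "(b, c, a) \<in> sd T" if "(a, b, c) \<in> sd T" for a b c
  proof -
    have "(b, c, a) \<in> rots p" if "(a, b, c) \<in> rots p" for p
      using that unfolding rots_def by (auto split: prod.splits)
    then show ?thesis using that unfolding sd_def by fast
  qed
  let ?R = "{(a, b). {a, b} \<in> edges (sd T)}"
  have sym: "sym (?R\<^sup>*)" by (rule sym_rtrancl) (auto simp: sym_def insert_commute)
  have step: "(a, b) \<in> ?R\<^sup>*" if "{a, b} \<in> edges (sd T)" for a b using that by auto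
  have vv: "(sd_vertex x, sd_vertex y) \<in> ?R\<^sup>*" if e: "{x, y} \<in> edges T" for x y
  proof -
    obtain z where "(x, y, z) \<in> T" using surface_edge_cases[OF S e] by blast
    from sd_edge_vertex(1,2)[OF this] show ?thesis using rtrancl_trans[OF step step] by blast
  qed
  have vv': "(sd_vertex x, sd_vertex y) \<in> ?R\<^sup>*" if "x \<in> verts T" "y \<in> verts T" for x y
  proof -
    have "(x, y) \<in> {(a, b). {a, b} \<in> edges T}\<^sup>*"
      using S that unfolding closed_connected_surface_def by blast
    then show ?thesis
      by (induction rule: rtrancl_induct) (auto intro: rtrancl_trans vv)
  qed
  have near: "\<exists>x\<in>verts T. (a, sd_vertex x) \<in> ?R\<^sup>*" if av: "a \<in> verts (sd T)" for a
  proof -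
    obtain x y z where T: "(x, y, z) \<in> T" and a: "a \<in> {sd_vertex x, sd_edge x y, sd_face x y z}" 
      using verts_sd[OF av] by blast
    have "(sd_edge x y, sd_vertex x) \<in> ?R\<^sup>*" "(sd_face x y z, sd_vertex x) \<in> ?R\<^sup>*"
      using sd_edge_vertex[OF T] step by (auto simp: insert_commute)
    moreover have "x \<in> verts T" using T surface_vert[OF S] by blast
    ultimately show ?thesis using a by blast
  qed
  have "(a, b) \<in> ?R\<^sup>*" if "a \<in> verts (sd T)" "b \<in> verts (sd T)" for a b
    using near[OF that(1)] near[OF that(2)] vv' sym by (meson rtrancl_trans symD)
  moreover have "sd T \<noteq> {}" using ne sd_edge_vertex(1) unfolding edges_def by fast
  ultimately show ?thesis unfolding closed_connected_surface_def
    using finite_sd rot link by blast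
qed

end

lemma closed_connected_surface_sd_pow:
  "closed_connected_surface T \<Longrightarrow> closed_connected_surface ((sd ^^ k) T)"
  by (induction k) (auto intro: closed_connected_surface_sd)

section \<open>Euler characteristic of the subdivision\<close>

context
  fixes T :: triangles
  assumes S: "closed_connected_surface T"
begin

lemma finite_surface: "finite T" "finite (verts T)" "finite (edges T)" "finite (faces T)"
proof -
  show T: "finite T" using S unfolding closed_connected_surface_def by blast
  show "finite (verts T)" "finite (edges T)" "finite (faces T)"
    unfolding verts_def edges_def faces_def using T by (auto split: prod.splits)
qed

lemma face_iff: "f \<in> faces T \<longleftrightarrow> (\<exists>x y z. (x, y, z) \<in> T \<and> f = {x, y, z})"
  unfolding faces_def by (auto simp: image_iff Bex_def)

lemma simplices_of_triangle:
  assumes "(x, y, z) \<in> T"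
  shows "x \<in> verts T" "{x, y} \<in> edges T" "{x, y, z} \<in> faces T"
  using assms by (auto simp: verts_def edges_def faces_def intro!: bexI[of _ "(x, y, z)"] image_eqI[of _ _ "(x, y, z)"])

lemma face_card: "f \<in> faces T \<Longrightarrow> card f = 3"
  using surface_neq[OF S] unfolding face_iff by fastforce

lemma simplex_card: "s \<in> edges T \<union> faces T \<Longrightarrow> finite s \<and> 2 \<le> card s"
  using face_card surface_edge_card[OF S] by (metis UnE card.infinite le_refl nat_le_linear not_numeral_le_zero numeral_le_iff semiring_norm(69) semiring_norm(72) zero_neq_numeral numeral_2_eq_2 numeral_3_eq_3 le_SucI)

lemma face_vert:
  assumes "f \<in> faces T" "x \<in> f"
  shows "\<exists>y z. (x, y, z) \<in> T \<and> f = {x, y, z}"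
proof -
  obtain a b c where T: "(a, b, c) \<in> T" and f: "f = {a, b, c}" using assms(1) face_iff by blast
  have R: "(b, c, a) \<in> T" "(c, a, b) \<in> T" using T surface_rot[OF S] by blast+
  have "f = {b, c, a}" "f = {c, a, b}" using f by (simp_all add: insert_commute)
  moreover have "x = a \<or> x = b \<or> x = c" using assms(2) f by blast
  ultimately show ?thesis using T R f by metis
qed

lemma face_distinct_verts:
  assumes "f \<in> faces T" "x \<in> f" "y \<in> f" "x \<noteq> y"
  obtains z where "(x, y, z) \<in> T \<and> f = {x, y, z} \<or> (y, x, z) \<in> T \<and> f = {x, y, z}"
proof -
  obtain a b c where T: "(a, b, c) \<in> T" and f: "f = {a, b, c}" using assms(1) face_iff by blast
  have R: "(b, c, a) \<in> T" "(c, a, b) \<in> T" using T surface_rot[OF S] by blast+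
  have "x \<in> {a, b, c}" "y \<in> {a, b, c}" using assms f by auto
  then have "\<exists>z. (x, y, z) \<in> {(a, b, c), (b, c, a), (c, a, b)} \<or> (y, x, z) \<in> {(a, b, c), (b, c, a), (c, a, b)}"
    using assms(4) by (elim insertE emptyE; simp; blast)
  then obtain z where z: "(x, y, z) \<in> {(a, b, c), (b, c, a), (c, a, b)} \<or> (y, x, z) \<in> {(a, b, c), (b, c, a), (c, a, b)}" by blast
  moreover from z have "f = {x, y, z}" unfolding f by (elim disjE insertE emptyE) (simp_all add: insert_commute)
  ultimately have "\<exists>z. (x, y, z) \<in> T \<and> f = {x, y, z} \<or> (y, x, z) \<in> T \<and> f = {x, y, z}"
    using T R by blast
  then show thesis using that by blast
qed

lemma verts_sd_eq: "verts (sd T) = sd_vertex ` verts T \<union> set_encode ` edges T \<union> set_encode ` faces T"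
proof
  show "verts (sd T) \<subseteq> sd_vertex ` verts T \<union> set_encode ` edges T \<union> set_encode ` faces T"
  proof
    fix a assume "a \<in> verts (sd T)"
    then obtain x y z where T: "(x, y, z) \<in> T" and a: "a \<in> {sd_vertex x, sd_edge x y, sd_face x y z}"
      using verts_sd[OF S] by blast
    then have "x \<in> verts T" "{x, y} \<in> edges T" "{x, y, z} \<in> faces T"
      using simplices_of_triangle by blast+
    then show "a \<in> sd_vertex ` verts T \<union> set_encode ` edges T \<union> set_encode ` faces T"
      using a unfolding sd_edge_def sd_face_def by auto
  qed
  have 1: "sd_vertex x \<in> verts (sd T)" "sd_edge x y \<in> verts (sd T)" "sd_face x y z \<in> verts (sd T)" if "(x, y, z) \<in> T" for x y z
  proof -
    have "(sd_vertex x, sd_edge x y, sd_face x y z) \<in> sd T" unfolding sd_mem using that by blast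
    then show "sd_vertex x \<in> verts (sd T)" "sd_edge x y \<in> verts (sd T)" "sd_face x y z \<in> verts (sd T)"
      unfolding verts_def by blast+
  qed
  show "sd_vertex ` verts T \<union> set_encode ` edges T \<union> set_encode ` faces T \<subseteq> verts (sd T)"
    using 1 surface_vert[OF S] surface_edge[OF S] face_iff unfolding sd_edge_def sd_face_def by auto
qed

lemma card_verts_sd: "card (verts (sd T)) = card (verts T) + card (edges T) + card (faces T)"
proof -
  have inj: "inj_on set_encode (edges T \<union> faces T)"
    by (rule inj_on_subset[OF inj_on_set_encode]) (use simplex_card in blast)
  have disj: "edges T \<inter> faces T = {}" using face_card surface_edge_card[OF S] by fastforce
  have "sd_vertex x \<noteq> set_encode s" if "s \<in> edges T \<union> faces T" for x s
  proof -
    have "finite s" "s \<noteq> {x}" using simplex_card[OF that] by auto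
    then show ?thesis by (simp add: sd_vertex_def set_encode_eq)
  qed
  then have "sd_vertex ` verts T \<inter> set_encode ` (edges T \<union> faces T) = {}" by blast
  moreover have "inj sd_vertex" by (rule injI) (simp add: sd_code_eq)
  ultimately have "card (verts (sd T)) = card (verts T) + card (edges T \<union> faces T)"
    unfolding verts_sd_eq Un_assoc image_Un[symmetric] using finite_surface inj
    by (subst card_Un_disjoint) (auto simp: card_image inj_on_subset)
  then show ?thesis using disj finite_surface by (simp add: card_Un_disjoint)
qed

text \<open>An edge of the subdivision is a chain of two simplices r < s. Indexing by the larger
  simplex s, which is an edge or a face, makes the edges countable as proper nonempty subsets of
  s.\<close>

lemma edges_sd_eq:
  "edges (sd T) = (\<Union>s\<in>edges T \<union> faces T. (\<lambda>r. set_encode ` {r, s}) ` (Pow s - {{}, s}))" (is "_ = ?R")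
proof
  show "edges (sd T) \<subseteq> ?R"
  proof
    fix e assume "e \<in> edges (sd T)"
    then obtain a b c where "(a, b, c) \<in> sd T" and e: "e = {a, b}"
      using surface_edge[OF closed_connected_surface_sd[OF S]] by blast
    then obtain x y z where T: "(x, y, z) \<in> T" and *: "(a, b, c) \<in>
      {(sd_vertex x, sd_edge x y, sd_face x y z), (sd_edge x y, sd_face x y z, sd_vertex x), (sd_face x y z, sd_vertex x, sd_edge x y),
       (sd_edge x y, sd_vertex y, sd_face x y z), (sd_vertex y, sd_face x y z, sd_edge x y), (sd_face x y z, sd_edge x y, sd_vertex y)}"
      unfolding sd_mem by blast
    note neq = surface_neq[OF S T]
    have ef: "{x, y} \<in> edges T" "{x, y, z} \<in> faces T" using T by (rule simplices_of_triangle)+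
    have "e \<in> {set_encode ` {{x}, {x, y}}, set_encode ` {{y}, {x, y}}}
       \<or> e \<in> {set_encode ` {{x}, {x, y, z}}, set_encode ` {{y}, {x, y, z}}, set_encode ` {{x, y}, {x, y, z}}}"
      using * unfolding e sd_vertex_def sd_edge_def sd_face_def
      by (elim insertE emptyE) (simp_all, simp_all add: insert_commute)
    moreover have "{x} \<in> Pow {x, y} - {{}, {x, y}}" "{y} \<in> Pow {x, y} - {{}, {x, y}}"
      "{x} \<in> Pow {x, y, z} - {{}, {x, y, z}}" "{y} \<in> Pow {x, y, z} - {{}, {x, y, z}}"
      "{x, y} \<in> Pow {x, y, z} - {{}, {x, y, z}}" using neq by auto
    moreover have "set_encode ` {r, s} \<in> ?R" if "s \<in> edges T \<union> faces T" "r \<in> Pow s - {{}, s}" for r s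
      using that by blast
    ultimately show "e \<in> ?R" using ef by (elim disjE insertE emptyE) simp_all
  qed
  show "?R \<subseteq> edges (sd T)"
  proof
    fix e assume "e \<in> ?R"
    then obtain s r where s: "s \<in> edges T \<union> faces T" and r: "r \<subseteq> s" "r \<noteq> {}" "r \<noteq> s" and e: "e = set_encode ` {r, s}"
      by blast
    show "e \<in> edges (sd T)"
    proof (cases "s \<in> edges T")
      case True
      then obtain x y z where T: "(x, y, z) \<in> T" "s = {x, y}" using surface_edge[OF S] by blast
      then have "r = {x} \<or> r = {y}" using r by blast
      then have "e = {sd_vertex x, sd_edge x y} \<or> e = {sd_edge x y, sd_vertex y}"
        using e T unfolding sd_vertex_def sd_edge_def by auto
      then show ?thesis using sd_edge_vertex[OF S T(1)] by blast
    next
      case False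
      then have "s \<in> faces T" using s by blast
      have c3: "card s = 3" using face_card \<open>s \<in> faces T\<close> by blast
      obtain x where x: "x \<in> r" using r by blast
      show ?thesis
      proof (cases "r = {x}")
        case True
        obtain y z where T: "(x, y, z) \<in> T" "s = {x, y, z}"
          using face_vert[OF \<open>s \<in> faces T\<close>] x r by blast
        then show ?thesis using e True sd_edge_vertex(3)[OF S T(1)]
          unfolding sd_vertex_def sd_face_def by (simp add: insert_commute)
      next
        case False
        then obtain y where y: "y \<in> r" "y \<noteq> x" using x by blast
        then obtain z where z: "(x, y, z) \<in> T \<and> s = {x, y, z} \<or> (y, x, z) \<in> T \<and> s = {x, y, z}"
          using face_distinct_verts \<open>s \<in> faces T\<close> r x by (metis subsetD)
        then have rr: "r = {x, y}" using x y r by blast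
        from z show ?thesis
        proof
          assume z: "(x, y, z) \<in> T \<and> s = {x, y, z}"
          then show ?thesis using e rr sd_edge_vertex(4)[OF S, of x y z]
            unfolding sd_edge_def sd_face_def by (simp add: insert_commute)
        next
          assume z: "(y, x, z) \<in> T \<and> s = {x, y, z}"
          then show ?thesis using e rr sd_edge_vertex(4)[OF S, of y x z]
            unfolding sd_edge_def sd_face_def by (simp add: insert_commute)
        qed
      qed
    qed
  qed
qed

lemma card_proper_subsets: "finite s \<Longrightarrow> s \<noteq> {} \<Longrightarrow> card (Pow s - {{}, s}) = 2 ^ card s - 2"
  by (subst card_Diff_subset) (auto simp: card_Pow)

text \<open>A simplex with k vertices has 2^k - 2 proper nonempty faces: 2 for an edge, 6 for a
  triangle.\<close>

lemma card_edges_sd: "card (edges (sd T)) = 2 * card (edges T) + 6 * card (faces T)"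
proof -
  let ?A = "\<lambda>s. (\<lambda>r. set_encode ` {r, s}) ` (Pow s - {{}, s})"
  have fin: "finite s" "s \<noteq> {}" if "s \<in> edges T \<union> faces T" for s using simplex_card[OF that] by auto
  have eq: "r = r' \<and> s = s'"
    if "s \<in> edges T \<union> faces T" "s' \<in> edges T \<union> faces T" "r \<in> Pow s - {{}, s}" "r' \<in> Pow s' - {{}, s'}"
      "set_encode ` {r, s} = set_encode ` {r', s'}" for r s r' s'
  proof -
    have "finite s" "finite s'" using fin that by blast+
    moreover from this have "finite r" "finite r'" using that by (auto intro: finite_subset)
    ultimately have "{r, s} = {r', s'}"
      using inj_on_image_eq_iff[OF inj_on_set_encode, of "{r, s}" "{r', s'}"] that by auto
    then show ?thesis using that(3,4) by (auto simp: doubleton_eq_iff)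
  qed
  have cA: "card (?A s) = 2 ^ card s - 2" if "s \<in> edges T \<union> faces T" for s
  proof -
    have "inj_on (\<lambda>r. set_encode ` {r, s}) (Pow s - {{}, s})"
      using eq[OF that that] by (intro inj_onI) blast
    then have "card (?A s) = card (Pow s - {{}, s})" by (rule card_image)
    then show ?thesis using card_proper_subsets fin[OF that] by metis
  qed
  have "card (edges (sd T)) = (\<Sum>s\<in>edges T \<union> faces T. card (?A s))"
    unfolding edges_sd_eq
  proof (rule card_UN_disjoint)
    show "\<forall>i\<in>edges T \<union> faces T. \<forall>j\<in>edges T \<union> faces T. i \<noteq> j \<longrightarrow> ?A i \<inter> ?A j = {}"
      using eq by (intro ballI impI) blast
  qed (use finite_surface fin in auto)
  also have "\<dots> = (\<Sum>s\<in>edges T \<union> faces T. 2 ^ card s - 2)" using cA by (rule sum.cong[OF refl])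
  also have "\<dots> = (\<Sum>s\<in>edges T. 2 ^ card s - 2) + (\<Sum>s\<in>faces T. 2 ^ card s - 2)"
    using face_card surface_edge_card[OF S] finite_surface by (intro sum.union_disjoint) fastforce+
  also have "(\<Sum>s\<in>edges T. 2 ^ card s - 2) = (\<Sum>s\<in>edges T. 2::nat)"
    using surface_edge_card[OF S] by (intro sum.cong) auto
  also have "(\<Sum>s\<in>faces T. 2 ^ card s - 2) = (\<Sum>s\<in>faces T. 6::nat)"
    using face_card by (intro sum.cong) auto
  finally show ?thesis by simp
qed

text \<open>A face of the subdivision is a full flag {x} < {x, y} < f, encoded by the ordered pair
  of distinct vertices x, y of f.\<close>

lemma faces_sd_eq:
  "faces (sd T) = (\<Union>f\<in>faces T. (\<lambda>(x, y). set_encode ` {{x}, {x, y}, f}) ` (f \<times> f - Id))" (is "_ = ?R")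
proof
  show "faces (sd T) \<subseteq> ?R"
  proof
    fix g assume "g \<in> faces (sd T)"
    then obtain a b c where "(a, b, c) \<in> sd T" and g: "g = {a, b, c}"
      unfolding faces_def by auto
    then obtain x y z where T: "(x, y, z) \<in> T" and *: "(a, b, c) \<in>
      {(sd_vertex x, sd_edge x y, sd_face x y z), (sd_edge x y, sd_face x y z, sd_vertex x), (sd_face x y z, sd_vertex x, sd_edge x y),
       (sd_edge x y, sd_vertex y, sd_face x y z), (sd_vertex y, sd_face x y z, sd_edge x y), (sd_face x y z, sd_edge x y, sd_vertex y)}"
      unfolding sd_mem by blast
    note neq = surface_neq[OF S T]
    have f: "{x, y, z} \<in> faces T" using T by (rule simplices_of_triangle)
    have "g = set_encode ` {{x}, {x, y}, {x, y, z}} \<or> g = set_encode ` {{y}, {y, x}, {x, y, z}}"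
      using * g unfolding sd_vertex_def sd_edge_def sd_face_def
      by (elim insertE emptyE) (simp_all add: insert_commute)
    moreover have "(x, y) \<in> {x, y, z} \<times> {x, y, z} - Id" "(y, x) \<in> {x, y, z} \<times> {x, y, z} - Id" using neq by auto
    ultimately show "g \<in> ?R" using f by blast
  qed
  show "?R \<subseteq> faces (sd T)"
  proof
    fix g assume "g \<in> ?R"
    then obtain f x y where f: "f \<in> faces T" "x \<in> f" "y \<in> f" "x \<noteq> y" and g: "g = set_encode ` {{x}, {x, y}, f}" by auto
    obtain z where "(x, y, z) \<in> T \<and> f = {x, y, z} \<or> (y, x, z) \<in> T \<and> f = {x, y, z}"
      using face_distinct_verts[OF f] by blast
    then consider "(x, y, z) \<in> T" "f = {x, y, z}" | "(y, x, z) \<in> T" "f = {x, y, z}" by blast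
    then show "g \<in> faces (sd T)"
    proof cases
      case 1
      then have "(sd_vertex x, sd_edge x y, sd_face x y z) \<in> sd T" unfolding sd_mem by blast
      then have "{sd_vertex x, sd_edge x y, sd_face x y z} \<in> faces (sd T)" unfolding faces_def by force
      then show ?thesis using 1 g by (simp add: sd_vertex_def sd_edge_def sd_face_def)
    next
      case 2
      then have "(sd_edge y x, sd_vertex x, sd_face y x z) \<in> sd T" unfolding sd_mem by blast
      then have "{sd_edge y x, sd_vertex x, sd_face y x z} \<in> faces (sd T)" unfolding faces_def by force
      then show ?thesis using 2 g by (simp add: sd_vertex_def sd_edge_def sd_face_def insert_commute)
    qed
  qed
qed

text \<open>Each face f carries 9 - 3 = 6 flags: the pairs of its vertices without the
  diagonal.\<close>

lemma card_faces_sd: "card (faces (sd T)) = 6 * card (faces T)"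
proof -
  let ?B = "\<lambda>f. (\<lambda>(x, y). set_encode ` {{x}, {x, y}, f}) ` (f \<times> f - Id)"
  have fin: "finite f" if "f \<in> faces T" for f using face_card[OF that] card.infinite by force
  have eq: "x = x' \<and> y = y' \<and> f = f'"
    if "f \<in> faces T" "f' \<in> faces T" "x \<noteq> y" "x' \<noteq> y'" 
      "set_encode ` {{x}, {x, y}, f} = set_encode ` {{x'}, {x', y'}, f'}" for f f' x x' y y'
  proof -
    have "{{x}, {x, y}, f} = {{x'}, {x', y'}, f'}"
      using inj_on_image_eq_iff[OF inj_on_set_encode, of "{{x}, {x, y}, f}" "{{x'}, {x', y'}, f'}"] that fin by auto
    moreover have "card {x} = 1" "card {x'} = 1" "card {x, y} = 2" "card {x', y'} = 2" "card f = 3" "card f' = 3"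
      using that face_card by auto
    \<comment> \<open>The members of a flag are told apart by their cardinalities 1, 2, 3, so equal
      sets of members give equal flags.\<close>
    moreover have "A = A' \<and> B = B' \<and> C = C'"
      if "{A, B, C} = {A', B', C'}" "card A = 1" "card A' = 1" "card B = 2" "card B' = 2" "card C = 3" "card C' = 3"
      for A A' B B' C C' :: "nat set"
    proof -
      have "A \<in> {A', B', C'}" "B \<in> {A', B', C'}" "C \<in> {A', B', C'}" using that(1) by blast+
      then show ?thesis using that(2-) by (elim insertE emptyE) simp_all
    qed
    ultimately have "{x} = {x'}" "{x, y} = {x', y'}" "f = f'" by metis+
    then show ?thesis using that(3) by (auto simp: doubleton_eq_iff)
  qed
  have cB: "card (?B f) = 6" if "f \<in> faces T" for f
  proof -
    have "inj_on (\<lambda>(x, y). set_encode ` {{x}, {x, y}, f}) (f \<times> f - Id)"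
      using eq[OF that that] by (intro inj_onI) auto
    then have *: "card (?B f) = card (f \<times> f - Id)" by (rule card_image)
    have "f \<times> f - Id = f \<times> f - (\<lambda>x. (x, x)) ` f" by auto
    also have "card \<dots> = card (f \<times> f) - card ((\<lambda>x. (x, x)) ` f)"
      using fin[OF that] by (intro card_Diff_subset) auto
    also have "card ((\<lambda>x. (x, x)) ` f) = 3" using face_card[OF that] by (subst card_image) (auto intro: inj_onI)
    also have "card (f \<times> f) = 9" using face_card[OF that] by (simp add: card_cartesian_product)
    finally show ?thesis unfolding * by simp
  qed
  have "card (faces (sd T)) = (\<Sum>f\<in>faces T. card (?B f))"
    unfolding faces_sd_eq
  proof (rule card_UN_disjoint)
    show "\<forall>i\<in>faces T. \<forall>j\<in>faces T. i \<noteq> j \<longrightarrow> ?B i \<inter> ?B j = {}"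
    proof (intro ballI impI equals0I)
      fix i j g assume "i \<in> faces T" "j \<in> faces T" "i \<noteq> j" "g \<in> ?B i \<inter> ?B j"
      then obtain x y x' y' where "x \<noteq> y" "x' \<noteq> y'" "set_encode ` {{x}, {x, y}, i} = set_encode ` {{x'}, {x', y'}, j}"
        by auto
      then show False using eq \<open>i \<in> faces T\<close> \<open>j \<in> faces T\<close> \<open>i \<noteq> j\<close> by blast
    qed
  qed (use finite_surface fin in auto)
  then show ?thesis using cB by simp
qed

text \<open>The alternating sum is (V + E + F) - (2 E + 6 F) + 6 F = V - E + F.\<close>

lemma euler_char_sd: "euler_char (sd T) = euler_char T"
  unfolding euler_char_def card_verts_sd card_edges_sd card_faces_sd by simp

end

lemma genus_sd_pow: "closed_connected_surface T \<Longrightarrow> genus ((sd ^^ k) T) = genus T"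
  by (induction k) (simp_all add: genus_def euler_char_sd closed_connected_surface_sd_pow)

section \<open>Cyclic order in links\<close>

lemma subseq4_decomp:
  assumes "subseq [a, b, c, d] xs"
  shows "\<exists>p0 p1 p2 p3 p4. xs = p0 @ a # p1 @ b # p2 @ c # p3 @ d # p4"
proof -
  obtain p0 r1 where 1: "xs = p0 @ a # r1" "subseq [b, c, d] r1" using list_emb_ConsD[OF assms] by auto
  obtain p1 r2 where 2: "r1 = p1 @ b # r2" "subseq [c, d] r2" using list_emb_ConsD[OF 1(2)] by auto
  obtain p2 r3 where 3: "r2 = p2 @ c # r3" "subseq [d] r3" using list_emb_ConsD[OF 2(2)] by auto
  obtain p3 r4 where 4: "r3 = p3 @ d # r4" using list_emb_ConsD[OF 3(2)] by auto
  show ?thesis using 1 2 3 4 by blast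
qed

text \<open>Rotations of a link cycle are link cycles, so the entries before \<open>a\<close> may be
  moved to the end, where they join \<open>p4\<close>.\<close>

lemma ccw_decomp:
  assumes "ccw T v [a, b, c, d]"
  obtains p1 p2 p3 p4 where "link_cycle T v (a # p1 @ b # p2 @ c # p3 @ d # p4)"
proof -
  obtain xs where xs: "link_cycle T v xs" "subseq [a, b, c, d] xs" using assms unfolding ccw_def by blast
  obtain p0 p1 p2 p3 p4 where "xs = p0 @ a # p1 @ b # p2 @ c # p3 @ d # p4" 
    using subseq4_decomp[OF xs(2)] by blast
  then have "a # p1 @ b # p2 @ c # p3 @ d # p4 @ p0 \<in> cyc_class xs"
    using cyc_class_append[of "a # p1 @ b # p2 @ c # p3 @ d # p4" p0] by simp
  then show thesis using link_cycle_cyc_class[OF xs(1)] that by fastforce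
qed

lemma ccw_rotate1: "ccw T v [a, b, c, d] \<Longrightarrow> ccw T v [b, c, d, a]"
proof -
  assume "ccw T v [a, b, c, d]"
  then obtain p1 p2 p3 p4 where l: "link_cycle T v (a # p1 @ b # p2 @ c # p3 @ d # p4)" by (rule ccw_decomp)
  have "b # p2 @ c # p3 @ d # p4 @ a # p1 \<in> cyc_class (a # p1 @ b # p2 @ c # p3 @ d # p4)"
    using cyc_class_append[of "b # p2 @ c # p3 @ d # p4" "a # p1"] by simp
  then have "link_cycle T v (b # p2 @ c # p3 @ d # p4 @ a # p1)" using l link_cycle_cyc_class by blast
  moreover have "subseq [b, c, d, a] (b # p2 @ c # p3 @ d # p4 @ a # p1)"
    by (intro subseq_Cons2 list_emb_append2) (auto simp: subseq_singleton_left)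
  ultimately show ?thesis unfolding ccw_def by blast
qed

lemma ccw_distinct: "ccw T v [a, b, c, d] \<Longrightarrow> distinct [a, b, c, d]"
  unfolding ccw_def link_cycle_def using subseq4_decomp[of a b c d] by fastforce

text \<open>Rotated to start at \<open>a\<close>, both link cycles coincide by uniqueness, yet one
  meets \<open>b\<close> before \<open>d\<close> and the other \<open>d\<close> before
  \<open>b\<close>.\<close>

lemma ccw_asym:
  assumes "ccw T v [a, b, c, d]" "ccw T v [d, c, b, a]"
  shows False
proof -
  obtain p1 p2 p3 p4 where p: "link_cycle T v (a # p1 @ b # p2 @ c # p3 @ d # p4)" 
    using ccw_decomp[OF assms(1)] by blast
  have "ccw T v [a, d, c, b]" using assms(2) ccw_rotate1 by blast
  then obtain q1 q2 q3 q4 where q: "link_cycle T v (a # q1 @ d # q2 @ c # q3 @ b # q4)" 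
    by (rule ccw_decomp)
  have "p1 @ b # p2 @ c # p3 @ d # p4 = q1 @ d # q2 @ c # q3 @ b # q4"
    using cyc_class_Cons_distinct[OF link_cycle_unique[OF q p]] q unfolding link_cycle_def by blast
  moreover have "distinct (p1 @ b # p2 @ c # p3 @ d # p4)" using p unfolding link_cycle_def by simp
  ultimately show False by (auto simp: append_eq_append_conv2 append_eq_Cons_conv Cons_eq_append_conv)
qed

lemma crossed_mid: "crossed_left_to_right T s t \<Longrightarrow> fst (snd t) = fst (snd s)"
  by (cases s; cases t) simp

text \<open>Exchanging the two strands reverses the four directions in \<open>ccw\<close>.\<close>

lemma crossed_asym: "crossed_left_to_right T s t \<Longrightarrow> \<not> crossed_left_to_right T t s"
  using ccw_asym by (cases s; cases t) auto

lemma crossed_irrefl: "\<not> crossed_left_to_right T s s"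
  using crossed_asym by blast

lemma travels_positively_pair:
  assumes "{r \<in> strands_of \<gamma>. fst (snd r) = fst (snd s)} = {s, t}" "crossed_left_to_right T s t"
  shows "travels_positively T \<gamma> s" "\<not> travels_positively T \<gamma> t"
proof -
  show "travels_positively T \<gamma> s" unfolding travels_positively_def using assms by blast
  show "\<not> travels_positively T \<gamma> t"
  proof
    assume "travels_positively T \<gamma> t"
    then obtain r where "r \<in> strands_of \<gamma>" "crossed_left_to_right T t r" unfolding travels_positively_def by blast
    moreover from this have "r \<in> {s, t}" using assms crossed_mid by (metis (mono_tags, lifting) mem_Collect_eq)
    ultimately show False using assms(2) crossed_asym crossed_irrefl by blast
  qed
qed

text \<open>A strand can only be crossed by strands through the same middle vertex. Hence signs
  persist wherever the strands through a crossing are left alone.\<close>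

lemma travels_positively_cong:
  assumes "{r \<in> strands_of \<gamma>. fst (snd r) = fst (snd s)} = {r \<in> strands_of \<gamma>'. fst (snd r) = fst (snd s)}"
  shows "travels_positively T \<gamma> s = travels_positively T \<gamma>' s"
  unfolding travels_positively_def using assms crossed_mid by (metis (mono_tags, lifting) mem_Collect_eq)

section \<open>Strands, visits and edges\<close>

lemma strands_of_cyc_strands: "strands_of \<gamma> = (\<Union>c\<in>set_mset \<gamma>. set (cyc_strands c))"
  unfolding strands_of_def using set_cyc_strands[OF cyc_class_self] by auto

lemma visits_simps [simp]: "visits {#} = {#}" "visits (add_mset c \<gamma>) = mset c + visits \<gamma>"
  by (simp_all add: visits_def)

lemma edge_visits_simps [simp]:
  "edge_visits {#} = {#}"
  "edge_visits (add_mset c \<gamma>) = mset (map (\<lambda>(x, y). {x, y}) (cyc_pairs c)) + edge_visits \<gamma>"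
  by (simp_all add: edge_visits_def)

lemma set_visits: "set_mset (visits \<gamma>) = (\<Union>c\<in>set_mset \<gamma>. set c)"
  by (induction \<gamma>) auto

lemma set_edge_visits: "set_mset (edge_visits \<gamma>) = (\<Union>c\<in>set_mset \<gamma>. (\<lambda>(x, y). {x, y}) ` set (cyc_pairs c))"
  by (induction \<gamma>) auto

lemma strands_of_edges:
  assumes "(u, x, w) \<in> strands_of \<gamma>"
  shows "{u, x} \<in># edge_visits \<gamma>" "{x, w} \<in># edge_visits \<gamma>" "x \<in># visits \<gamma>"
proof -
  obtain c where c: "c \<in># \<gamma>" "(u, x, w) \<in> set (strands c)" using assms unfolding strands_of_def by blast
  then obtain i where i: "i < length c" "strands c ! i = (u, x, w)" by (auto simp: in_set_conv_nth)
  let ?j = "Suc i mod length c"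
  have j: "?j < length c" using i(1) by (metis less_nat_zero_code mod_less_divisor not_gr_zero)
  have "u = c ! i" "x = c ! ?j" "w = c ! (Suc ?j mod length c)"
    using i by (auto simp: nth_strands mod_Suc_eq)
  then have "(u, x) \<in> set (cyc_pairs c)" "(x, w) \<in> set (cyc_pairs c)" "x \<in> set c"
    unfolding cyc_pairs_mem using i(1) j by auto
  then show "{u, x} \<in># edge_visits \<gamma>" "{x, w} \<in># edge_visits \<gamma>" "x \<in># visits \<gamma>"
    unfolding set_edge_visits set_visits using c(1) by force+
qed

text \<open>\<open>gauss_word\<close> for an arbitrary list of strands, so that the word of a curve
  can be computed arc by arc.\<close>

definition gauss_letters :: "triangles \<Rightarrow> curve \<Rightarrow> (nat \<Rightarrow> nat) \<Rightarrow> (nat \<times> nat \<times> nat) list \<Rightarrow> word" where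
  "gauss_letters T \<gamma> lab ss = map (\<lambda>s. (lab (fst (snd s)), travels_positively T \<gamma> s))
     (filter (\<lambda>s. fst (snd s) \<in> crossings \<gamma>) ss)"

lemma gauss_letters_append [simp]:
  "gauss_letters T \<gamma> lab (ss @ ts) = gauss_letters T \<gamma> lab ss @ gauss_letters T \<gamma> lab ts"
  by (simp add: gauss_letters_def)

lemma gauss_letters_Cons [simp]:
  "gauss_letters T \<gamma> lab (s # ts) = (if fst (snd s) \<in> crossings \<gamma>
     then [(lab (fst (snd s)), travels_positively T \<gamma> s)] else []) @ gauss_letters T \<gamma> lab ts"
  by (simp add: gauss_letters_def)

lemma gauss_letters_Nil [simp]: "gauss_letters T \<gamma> lab [] = []"
  by (simp add: gauss_letters_def)

text \<open>A component may be read from any of its vertices and with any rotation of its strands;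
  the word changes only cyclically.\<close>

lemma gauss_word_cyc_class:
  assumes "d \<in> cyc_class c"
  shows "cyc_class (gauss_word T \<gamma> lab c) = cyc_class (gauss_letters T \<gamma> lab (cyc_strands d))"
  unfolding gauss_letters_def gauss_word_def cyc_class_eq_iff
  by (intro cyc_class_map cyc_class_filter cyc_class_sym[OF cyc_strands_cyc_class[OF assms]])

lemma gauss_letters_cong:
  assumes "\<And>s. s \<in> set ss \<Longrightarrow> fst (snd s) \<in> crossings \<gamma> \<longleftrightarrow> fst (snd s) \<in> crossings \<gamma>'"
    "\<And>s. s \<in> set ss \<Longrightarrow> fst (snd s) \<in> crossings \<gamma> \<Longrightarrow> lab (fst (snd s)) = lab' (fst (snd s))"
    "\<And>s. s \<in> set ss \<Longrightarrow> fst (snd s) \<in> crossings \<gamma> \<Longrightarrow>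
      travels_positively T \<gamma> s = travels_positively T' \<gamma>' s"
  shows "gauss_letters T \<gamma> lab ss = gauss_letters T' \<gamma>' lab' ss"
  using assms by (induction ss) auto

section \<open>Subdivision of curves\<close>

text \<open>A strand (u, x, w) leaves two strands after subdivision: one through x between
  midpoints, one through the midpoint of xw.\<close>

lemma path_strands_interleave:
  "path_strands (g a (hd (xs @ [b]))) (interleave f g xs b) (f b) =
    concat (map (\<lambda>(u, x, w). [(g u x, f x, g x w), (f x, g x w, f w)]) (path_strands a xs b))"
proof (induction xs arbitrary: a)
  case (Cons x xs)
  have "hd (interleave f g xs b @ [f b]) = f (hd (xs @ [b]))" by (rule hd_interleave)
  with Cons[of x] show ?case by simp
qed simp

lemma last_interleave: "xs \<noteq> [] \<Longrightarrow> last (interleave f g xs b) = g (last xs) b"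
proof (induction xs)
  case (Cons x xs)
  then show ?case by (cases xs) auto
qed simp

lemma cyc_strands_sd_path:
  assumes "c \<noteq> []"
  shows "cyc_strands (sd_path c) =
    concat (map (\<lambda>(u, x, w). [(sd_edge u x, sd_vertex x, sd_edge x w), (sd_vertex x, sd_edge x w, sd_vertex w)]) (cyc_strands c))"
proof -
  have "hd (sd_path c) = sd_vertex (hd c)" using assms by (cases c) (auto simp: sd_path_interleave)
  moreover have "last (sd_path c) = sd_edge (last c) (hd (c @ [hd c]))"
    using assms by (simp add: sd_path_interleave last_interleave)
  ultimately show ?thesis unfolding cyc_strands_def
    using path_strands_interleave[of sd_edge "last c" c "hd c" sd_vertex] by (simp add: sd_path_interleave)
qed

lemma sd_path_Nil_iff [simp]: "sd_path c = [] \<longleftrightarrow> c = []"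
  by (cases c) (auto simp: sd_path_interleave)

lemma sd_path_cyc_class: "d \<in> cyc_class c \<Longrightarrow> sd_path d \<in> cyc_class (sd_path c)"
proof -
  have "concat (map h (rotate1 xs)) \<in> cyc_class (concat (map h xs))" for h :: "nat \<times> nat \<Rightarrow> nat list" and xs
    by (cases xs) (auto simp: cyc_class_self cyc_class_append)
  then have *: "concat (map h (rotate k xs)) \<in> cyc_class (concat (map h xs))" for h :: "nat \<times> nat \<Rightarrow> nat list" and xs k
    by (induction k) (auto simp: cyc_class_self intro: cyc_class_trans)
  assume "d \<in> cyc_class c"
  then obtain k where "cyc_pairs d = rotate k (cyc_pairs c)"
    using cyc_pairs_cyc_class[of d c] unfolding cyc_class_def by blast
  then show "sd_path d \<in> cyc_class (sd_path c)" unfolding sd_path_def by (simp only: *)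
qed

lemma visits_sd: "visits (image_mset sd_path \<gamma>) = image_mset sd_vertex (visits \<gamma>) + image_mset set_encode (edge_visits \<gamma>)"
proof (induction \<gamma>)
  case (add c \<gamma>)
  have "mset (sd_path c) = image_mset sd_vertex (mset c) + image_mset set_encode (image_mset (\<lambda>(x, y). {x, y}) (mset (cyc_pairs c)))"
    unfolding sd_path_interleave mset_interleave_cyc by (simp add: sd_edge_def case_prod_unfold image_mset.compositionality comp_def)
  with add show ?case by simp
qed simp

text \<open>At most one index contributes \<open>y\<close>, this index occurs once, and its
  contribution is at most one.\<close>

lemma count_sum_mset_le_1:
  assumes "\<And>e. count M e \<le> 1" "\<And>e. e \<in># M \<Longrightarrow> count (g e) y \<le> 1"
    "\<And>e e'. e \<in># M \<Longrightarrow> e' \<in># M \<Longrightarrow> y \<in># g e \<Longrightarrow> y \<in># g e' \<Longrightarrow> e = e'"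
  shows "count (\<Sum>e\<in>#M. g e) y \<le> 1"
  using assms
proof (induction M)
  case (add e M)
  have nM: "e \<notin># M" using add.prems(1)[of e] by (simp add: not_in_iff)
  have IH: "count (\<Sum>e\<in>#M. g e) y \<le> 1"
  proof (rule add.IH)
    show "count M e' \<le> 1" for e' using add.prems(1)[of e'] by (simp split: if_splits)
  qed (use add.prems in auto)
  show ?case
  proof (cases "y \<in># g e")
    case True
    have "y \<notin># g e'" if "e' \<in># M" for e'
      using add.prems(3)[of e e'] True that nM by auto
    then have "count (\<Sum>e\<in>#M. g e) y = 0" by (auto simp: count_eq_zero_iff)
    then show ?thesis using add.prems(2)[of e] by simp
  next
    case False
    then have "count (g e) y = 0" by (simp add: count_eq_zero_iff)
    then show ?thesis using IH by simp
  qed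
qed simp

text \<open>Every visited edge is replaced by its two halves. Different ends are required for the
  halves to be two members of the set under \<open>mset_set\<close>.\<close>

lemma edge_visits_sd:
  assumes "\<And>x y. {x, y} \<in># edge_visits \<gamma> \<Longrightarrow> x \<noteq> y"
  shows "edge_visits (image_mset sd_path \<gamma>) =
    (\<Sum>e\<in>#edge_visits \<gamma>. mset_set ((\<lambda>x. {sd_vertex x, set_encode e}) ` e))"
  using assms
proof (induction \<gamma>)
  case (add c \<gamma>)
  let ?g = "\<lambda>e. mset_set ((\<lambda>x. {sd_vertex x, set_encode e}) ` e)"
  have "mset (map (\<lambda>(x, y). {x, y}) (concat (map (\<lambda>(x, y). [(sd_vertex x, sd_edge x y), (sd_edge x y, sd_vertex y)]) ps))) =
     (\<Sum>e\<in>#mset (map (\<lambda>(x, y). {x, y}) ps). ?g e)" if "\<forall>(x, y)\<in>set ps. x \<noteq> y" for ps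
    using that
  proof (induction ps)
    case (Cons p ps)
    obtain x y where p: "p = (x, y)" by (cases p)
    then have "x \<noteq> y" using Cons.prems by auto
    then have "{sd_vertex x, sd_edge x y} \<noteq> {sd_vertex y, sd_edge x y}"
      by (auto simp: doubleton_eq_iff sd_code_eq)
    then have "?g {x, y} = {# {sd_vertex x, sd_edge x y}, {sd_edge x y, sd_vertex y} #}"
      by (simp add: sd_edge_def insert_commute)
    then show ?case using Cons p by simp
  qed simp
  moreover have "\<forall>(x, y)\<in>set (cyc_pairs c). x \<noteq> y" using add.prems by fastforce
  ultimately have "mset (map (\<lambda>(x, y). {x, y}) (cyc_pairs (sd_path c))) =
     (\<Sum>e\<in>#mset (map (\<lambda>(x, y). {x, y}) (cyc_pairs c)). ?g e)"
    unfolding sd_path_interleave cyc_pairs_interleave by blast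
  then show ?case using add by (simp del: mset_map)
qed simp

section \<open>The subdivision of a PL-normal curve\<close>

locale normal_curve =
  fixes T :: triangles and \<gamma> :: curve
  assumes surface: "closed_connected_surface T" and normal: "pl_normal T \<gamma>"
begin

lemma edge_in: "e \<in># edge_visits \<gamma> \<Longrightarrow> e \<in> edges T"
  using normal unfolding pl_normal_def by blast

lemma edge_neq: "{x, y} \<in># edge_visits \<gamma> \<Longrightarrow> x \<noteq> y"
  using edge_in surface_edge_neq[OF surface] by blast

lemma edge_card: "e \<in># edge_visits \<gamma> \<Longrightarrow> finite e \<and> card e = 2"
  using edge_in surface_edge_card[OF surface] by (metis card.infinite zero_neq_numeral)

lemma edge_count: "count (edge_visits \<gamma>) e \<le> 1"
  using normal unfolding pl_normal_def by blast

lemma visit_count: "count (visits \<gamma>) x \<le> 2"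
  using normal unfolding pl_normal_def by blast

lemma nonempty: "c \<in># \<gamma> \<Longrightarrow> c \<noteq> []"
  using normal unfolding pl_normal_def by blast

lemma strands_cross:
  "x \<in> crossings \<gamma> \<Longrightarrow> s \<in> strands_of \<gamma> \<Longrightarrow> t \<in> strands_of \<gamma> \<Longrightarrow> fst (snd s) = x \<Longrightarrow> fst (snd t) = x \<Longrightarrow> s \<noteq> t
   \<Longrightarrow> crossed_left_to_right T s t \<or> crossed_left_to_right T t s"
  using normal unfolding pl_normal_def by blast

abbreviation "T' \<equiv> sd T"
abbreviation "\<gamma>' \<equiv> image_mset sd_path \<gamma>"

lemma encode_neq_vertex: "e \<in># edge_visits \<gamma> \<Longrightarrow> set_encode e \<noteq> sd_vertex x"
  using edge_card[of e] by (auto simp: sd_vertex_def set_encode_eq)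

lemma encode_inj: "e \<in># edge_visits \<gamma> \<Longrightarrow> e' \<in># edge_visits \<gamma> \<Longrightarrow> set_encode e = set_encode e' \<Longrightarrow> e = e'"
  using edge_card by (simp add: set_encode_eq)

lemma count_encode: "count (image_mset set_encode (edge_visits \<gamma>)) z \<le> 1"
proof -
  have "image_mset set_encode M = (\<Sum>e\<in>#M. {#set_encode e#})" for M by (induction M) auto
  moreover have "count (\<Sum>e\<in>#edge_visits \<gamma>. {#set_encode e#}) z \<le> 1"
    by (rule count_sum_mset_le_1) (use edge_count encode_inj in \<open>auto split: if_splits\<close>)
  ultimately show ?thesis by metis
qed

lemma count_visits_sd_vertex: "count (visits \<gamma>') (sd_vertex x) = count (visits \<gamma>) x"
proof -
  have "inj sd_vertex" by (rule injI) (simp add: sd_code_eq)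
  moreover have "sd_vertex x \<notin># image_mset set_encode (edge_visits \<gamma>)" using encode_neq_vertex by (auto simp: eq_commute)
  then have "count (image_mset set_encode (edge_visits \<gamma>)) (sd_vertex x) = 0" by (simp only: not_in_iff)
  moreover have "inj f \<Longrightarrow> count (image_mset f M) (f y) = count M y" for f :: "nat \<Rightarrow> nat" and M y
    by (induction M) (auto simp: inj_eq)
  ultimately show ?thesis by (simp add: visits_sd)
qed

lemma count_visits_sd_other: "z \<notin> range sd_vertex \<Longrightarrow> count (visits \<gamma>') z \<le> 1"
proof -
  assume "z \<notin> range sd_vertex"
  then have "z \<notin># image_mset sd_vertex (visits \<gamma>)" by auto
  then have "count (image_mset sd_vertex (visits \<gamma>)) z = 0" by (simp only: not_in_iff)
  then show ?thesis using count_encode[of z] by (simp add: visits_sd)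
qed

text \<open>A trail uses each edge at most once, so it passes each midpoint at most once and no new
  crossing arises.\<close>

lemma crossings_sd: "crossings \<gamma>' = sd_vertex ` crossings \<gamma>"
proof
  show "crossings \<gamma>' \<subseteq> sd_vertex ` crossings \<gamma>"
  proof
    fix z assume z: "z \<in> crossings \<gamma>'"
    then have "z \<in> range sd_vertex" using count_visits_sd_other[of z] unfolding crossings_def by fastforce
    then show "z \<in> sd_vertex ` crossings \<gamma>" using z count_visits_sd_vertex unfolding crossings_def by auto
  qed
  show "sd_vertex ` crossings \<gamma> \<subseteq> crossings \<gamma>'"
    using count_visits_sd_vertex unfolding crossings_def by auto
qed

lemma strands_of_sd:
  "strands_of \<gamma>' = (\<Union>(u, x, w)\<in>strands_of \<gamma>.
     {(sd_edge u x, sd_vertex x, sd_edge x w), (sd_vertex x, sd_edge x w, sd_vertex w)})"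
  unfolding strands_of_cyc_strands using nonempty by (auto simp: cyc_strands_sd_path) blast+

lemma strand_sd_vertex:
  assumes "s \<in> strands_of \<gamma>'" "fst (snd s) = sd_vertex x"
  obtains u w where "(u, x, w) \<in> strands_of \<gamma>" "s = (sd_edge u x, sd_vertex x, sd_edge x w)"
proof -
  obtain u y w where u: "(u, y, w) \<in> strands_of \<gamma>"
     "s \<in> {(sd_edge u y, sd_vertex y, sd_edge y w), (sd_vertex y, sd_edge y w, sd_vertex w)}"
    using assms(1) unfolding strands_of_sd by blast
  have "sd_edge y w \<noteq> sd_vertex x" using sd_vertex_neq_sd_edge edge_neq strands_of_edges(2)[OF u(1)] by metis
  then have "s = (sd_edge u y, sd_vertex y, sd_edge y w)" "y = x" using assms(2) u(2) by (auto simp: sd_code_eq(1))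
  then show thesis using that u(1) by blast
qed

lemma ccw_sd:
  assumes "ccw T v as" 
  shows "ccw T' (sd_vertex v) (map (sd_edge v) as)"
proof -
  obtain xs where xs: "link_cycle T v xs" "subseq as xs" using assms unfolding ccw_def by blast
  have "subseq (map f ys) (interleave f g ys b)" for f g and ys :: "nat list" and b
    by (induction ys) auto
  then have "subseq (map (sd_edge v) as) (interleave (sd_edge v) (sd_face v) xs (hd xs))"
    using subseq_map[OF xs(2)] subseq_order.order_trans by blast
  then show ?thesis using sd_link_vertex[OF surface xs(1)] unfolding ccw_def by blast
qed

lemma crossed_sd:
  assumes "crossed_left_to_right T (u, x, w) (u', x, w')"
  shows "crossed_left_to_right T' (sd_edge u x, sd_vertex x, sd_edge x w) (sd_edge u' x, sd_vertex x, sd_edge x w')"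
  using ccw_sd[of x "[w, u', u, w']"] assms sd_edge_commute[of u x] sd_edge_commute[of u' x] by simp

text \<open>Only preservation of \<open>crossed_left_to_right\<close> is proved directly. For the
  converse, transversality leaves two possibilities before subdivision, and the wrong one would
  persist and contradict asymmetry.\<close>

lemma travels_positively_sd:
  assumes "x \<in> crossings \<gamma>" "(u, x, w) \<in> strands_of \<gamma>"
  shows "travels_positively T' \<gamma>' (sd_edge u x, sd_vertex x, sd_edge x w) = travels_positively T \<gamma> (u, x, w)"
proof
  assume "travels_positively T \<gamma> (u, x, w)"
  then obtain t where t: "t \<in> strands_of \<gamma>" "crossed_left_to_right T (u, x, w) t" unfolding travels_positively_def by blast
  then obtain u' w' where "t = (u', x, w')" using crossed_mid by (metis fst_conv prod.collapse snd_conv)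
  then show "travels_positively T' \<gamma>' (sd_edge u x, sd_vertex x, sd_edge x w)"
    using crossed_sd t unfolding travels_positively_def strands_of_sd by blast
next
  let ?s = "(sd_edge u x, sd_vertex x, sd_edge x w)"
  assume "travels_positively T' \<gamma>' ?s"
  then obtain t where t: "t \<in> strands_of \<gamma>'" "crossed_left_to_right T' ?s t" unfolding travels_positively_def by blast
  then have "fst (snd t) = sd_vertex x" using crossed_mid by fastforce
  then obtain u' w' where t': "(u', x, w') \<in> strands_of \<gamma>" "t = (sd_edge u' x, sd_vertex x, sd_edge x w')"
    using strand_sd_vertex[OF t(1)] by blast
  then have "(u', x, w') \<noteq> (u, x, w)" using t crossed_irrefl by blast
  then have "crossed_left_to_right T (u, x, w) (u', x, w') \<or> crossed_left_to_right T (u', x, w') (u, x, w)"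
    using strands_cross[OF assms(1) assms(2) t'(1)] by (metis fst_conv snd_conv)
  moreover have "\<not> crossed_left_to_right T (u', x, w') (u, x, w)"
    using crossed_sd crossed_asym t(2) t'(2) by blast
  ultimately show "travels_positively T \<gamma> (u, x, w)" using t'(1) unfolding travels_positively_def by blast
qed

lemma edge_visits_sd_mem:
  assumes "e' \<in># edge_visits \<gamma>'"
  obtains x y where "{x, y} \<in># edge_visits \<gamma>" "e' = {sd_vertex x, sd_edge x y}"
proof -
  obtain e where e: "e \<in># edge_visits \<gamma>" "e' \<in># mset_set ((\<lambda>x. {sd_vertex x, set_encode e}) ` e)"
    using assms edge_visits_sd[OF edge_neq] by auto
  then obtain x where x: "x \<in> e" "e' = {sd_vertex x, set_encode e}" using edge_card[OF e(1)] by auto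
  then obtain y where "e = {x, y}" using edge_card[OF e(1)] by (metis card_2_iff insert_commute insertE singletonD)
  then show thesis using that x e(1) unfolding sd_edge_def by blast
qed

lemma pl_normal_sd: "pl_normal T' \<gamma>'"
  unfolding pl_normal_def
proof (intro conjI ballI allI impI)
  show "c \<noteq> []" if "c \<in># \<gamma>'" for c using that nonempty by auto
  show "set_mset (edge_visits \<gamma>') \<subseteq> edges T'"
  proof
    fix e' assume "e' \<in># edge_visits \<gamma>'"
    then obtain x y where e: "{x, y} \<in># edge_visits \<gamma>" "e' = {sd_vertex x, sd_edge x y}"
      by (rule edge_visits_sd_mem)
    then obtain z where "(x, y, z) \<in> T" using edge_in surface_edge_cases[OF surface] by blast
    then show "e' \<in> edges T'" using sd_edge_vertex(1)[OF surface] e by blast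
  qed
  have "count (\<Sum>e\<in>#edge_visits \<gamma>. mset_set ((\<lambda>x. {sd_vertex x, set_encode e}) ` e)) e' \<le> 1" for e'
  proof (rule count_sum_mset_le_1)
    show "count (edge_visits \<gamma>) e \<le> 1" for e by (rule edge_count)
    show "count (mset_set ((\<lambda>x. {sd_vertex x, set_encode e}) ` e)) e' \<le> 1" for e
      by (simp add: count_mset_set')
    fix e1 e2 assume e: "e1 \<in># edge_visits \<gamma>" "e2 \<in># edge_visits \<gamma>"
      "e' \<in># mset_set ((\<lambda>x. {sd_vertex x, set_encode e1}) ` e1)"
      "e' \<in># mset_set ((\<lambda>x. {sd_vertex x, set_encode e2}) ` e2)"
    then obtain x1 x2 where "e' = {sd_vertex x1, set_encode e1}" "e' = {sd_vertex x2, set_encode e2}"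
      using edge_card[OF e(1)] edge_card[OF e(2)] by auto
    \<comment> \<open>A half edge contains one old vertex and one midpoint; matching the midpoints
      identifies the edges.\<close>
    then have "set_encode e1 = set_encode e2"
      using encode_neq_vertex[OF e(1)] encode_neq_vertex[OF e(2)] by (metis doubleton_eq_iff)
    then show "e1 = e2" using e encode_inj by blast
  qed
  then show "count (edge_visits \<gamma>') e' \<le> 1" for e' using edge_visits_sd[OF edge_neq] by simp
  show "count (visits \<gamma>') z \<le> 2" for z
  proof (cases "z \<in> range sd_vertex")
    case True
    then show ?thesis using count_visits_sd_vertex visit_count by auto
  next
    case False
    then show ?thesis using count_visits_sd_other by fastforce
  qed
next
  fix z s t assume z: "z \<in> crossings \<gamma>'" and st: "s \<in> strands_of \<gamma>'" "t \<in> strands_of \<gamma>'"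
    "fst (snd s) = z" "fst (snd t) = z" "s \<noteq> t"
  obtain x where x: "x \<in> crossings \<gamma>" "z = sd_vertex x" using z crossings_sd by blast
  obtain u w where s: "(u, x, w) \<in> strands_of \<gamma>" "s = (sd_edge u x, sd_vertex x, sd_edge x w)" 
    using strand_sd_vertex st x by metis
  obtain u' w' where t: "(u', x, w') \<in> strands_of \<gamma>" "t = (sd_edge u' x, sd_vertex x, sd_edge x w')" 
    using strand_sd_vertex st x by metis
  have "(u, x, w) \<noteq> (u', x, w')" using st s t by blast
  then have "crossed_left_to_right T (u, x, w) (u', x, w') \<or> crossed_left_to_right T (u', x, w') (u, x, w)"
    using strands_cross[OF x(1) s(1) t(1)] by (metis fst_conv snd_conv)
  then show "crossed_left_to_right T' s t \<or> crossed_left_to_right T' t s"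
    using crossed_sd s(2) t(2) by blast
qed

lemma gauss_word_sd:
  assumes "c \<in># \<gamma>" "\<forall>x\<in>crossings \<gamma>. lab' (sd_vertex x) = lab x"
  shows "cyc_class (gauss_word T' \<gamma>' lab' (sd_path c)) = cyc_class (gauss_word T \<gamma> lab c)"
proof -
  have "gauss_letters T' \<gamma>' lab' (concat (map (\<lambda>(u, x, w).
      [(sd_edge u x, sd_vertex x, sd_edge x w), (sd_vertex x, sd_edge x w, sd_vertex w)]) ss)) = gauss_letters T \<gamma> lab ss"
    if "set ss \<subseteq> strands_of \<gamma>" for ss
    using that
  proof (induction ss)
    case (Cons s ss)
    obtain u x w where s: "s = (u, x, w)" by (cases s)
    then have st: "(u, x, w) \<in> strands_of \<gamma>" using Cons.prems by simp
    \<comment> \<open>The strand through a midpoint contributes no letter, since a midpoint is no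
      copy of an old vertex.\<close>
    then have "sd_edge x w \<noteq> sd_vertex y" for y using sd_vertex_neq_sd_edge edge_neq strands_of_edges(2) by metis
    then have "sd_edge x w \<notin> crossings \<gamma>'" unfolding crossings_sd by blast
    moreover have "sd_vertex x \<in> crossings \<gamma>' \<longleftrightarrow> x \<in> crossings \<gamma>"
      unfolding crossings_sd by (auto simp: sd_code_eq(1))
    ultimately show ?case using Cons s assms(2) travels_positively_sd st by simp
  qed simp
  moreover have "set (cyc_strands c) \<subseteq> strands_of \<gamma>" using assms(1) unfolding strands_of_cyc_strands by blast
  ultimately have "gauss_letters T' \<gamma>' lab' (cyc_strands (sd_path c)) = gauss_letters T \<gamma> lab (cyc_strands c)"
    using cyc_strands_sd_path[OF nonempty[OF assms(1)]] by simp
  then show ?thesis using gauss_word_cyc_class[OF cyc_class_self] by metis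
qed

end

lemma realizationD:
  assumes "realization T \<gamma> lab W"
  shows "normal_curve T \<gamma>" "inj_on lab (crossings \<gamma>)" "gauss_paragraph T \<gamma> lab = image_mset cyc_class W"
  using assms unfolding realization_def normal_curve_def by auto

lemma realization_sd:
  assumes "realization T \<gamma> lab W" "\<forall>x\<in>crossings \<gamma>. lab' (sd_vertex x) = lab x"
  shows "realization (sd T) (image_mset sd_path \<gamma>) lab' W"
proof -
  interpret normal_curve T \<gamma> using realizationD(1)[OF assms(1)] .
  have "inj_on lab' (crossings \<gamma>')"
    using realizationD(2)[OF assms(1)] assms(2) unfolding crossings_sd by (auto simp: inj_on_def)
  moreover have "gauss_paragraph T' \<gamma>' lab' = gauss_paragraph T \<gamma> lab"
    unfolding gauss_paragraph_def using gauss_word_sd[OF _ assms(2)]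
    by (auto simp: image_mset.compositionality comp_def intro!: image_mset_cong)
  ultimately show ?thesis unfolding realization_def
    using closed_connected_surface_sd[OF surface] pl_normal_sd realizationD(3)[OF assms(1)] by simp
qed

section \<open>Rerouting strands at a crossing\<close>

text \<open>No edge joins the two ends of the path directly when its interior is nonempty. If the
  interior consists of new vertices, edges of the path are thereby separated from old edges.\<close>

lemma path_edges_meets: "M \<noteq> [] \<Longrightarrow> e \<in> set (path_edges (a # M @ [b])) \<Longrightarrow> e \<inter> set M \<noteq> {}"
proof (induction M arbitrary: a)
  case (Cons x M)
  then show ?case by (cases M) auto
qed simp

text \<open>On a path without repetitions, \<open>c\<close> and the end \<open>v\<close> span an
  edge of the path only if they are consecutive.\<close>

lemma path_edges_last_edge:
  assumes "distinct (xs @ c # ys @ [v])" "{c, v} \<in> set (path_edges (xs @ c # ys @ [v]))"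
  shows "ys = []"
proof (rule ccontr)
  assume "ys \<noteq> []"
  then obtain y zs where ys: "ys = y # zs" by (cases ys) auto
  have "{c, v} \<in> set (path_edges (xs @ [c])) \<or> {c, v} \<in> set (path_edges (c # ys @ [v]))"
    using assms(2) path_edges_append[of xs c "ys @ [v]"] by auto
  then show False
  proof
    assume "{c, v} \<in> set (path_edges (xs @ [c]))"
    then have "v \<in> set (xs @ [c])" using path_edges_verts by blast
    then show False using assms(1) by auto
  next
    assume "{c, v} \<in> set (path_edges (c # ys @ [v]))"
    then have "{c, v} = {c, y} \<or> {c, v} \<in> set (path_edges (ys @ [v]))" using ys by auto
    moreover have "{c, v} \<noteq> {c, y}" using assms(1) ys by (auto simp: doubleton_eq_iff)
    ultimately have "c \<in> set (ys @ [v])" using path_edges_verts by blast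
    then show False using assms(1) by auto
  qed
qed

lemma edge_visits_cyc_class:
  assumes "x # xs \<in> cyc_class c"
  shows "mset (map (\<lambda>(x, y). {x, y}) (cyc_pairs c)) = mset (path_edges (x # xs @ [x]))"
  using cyc_class_mset[OF cyc_class_map[OF cyc_pairs_cyc_class[OF assms], of "\<lambda>(x, y). {x, y}"]]
  unfolding path_edges_edge_cyc by (rule sym)

lemma gauss_letters_empty:
  "(\<And>s. s \<in> set ss \<Longrightarrow> fst (snd s) \<notin> crossings \<gamma>) \<Longrightarrow> gauss_letters T \<gamma> lab ss = []"
  by (induction ss) auto

lemma mid_in_path_strands: "s \<in> set (path_strands a xs b) \<Longrightarrow> fst (snd s) \<in> set xs"
  by (metis path_strands_mid prod.collapse)

lemma visited_strand: "x \<in> set c \<Longrightarrow> \<exists>s\<in>set (cyc_strands c). fst (snd s) = x"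
proof -
  assume "x \<in> set c"
  then have "x \<in> set (map (fst \<circ> snd) (cyc_strands c))" by (simp only: cyc_strands_def map_mid_path_strands)
  then show ?thesis by auto
qed

lemma crossing_in_curve: "x \<in> crossings \<gamma> \<Longrightarrow> \<exists>c\<in>#\<gamma>. x \<in> set c"
proof -
  assume "x \<in> crossings \<gamma>"
  then have "x \<in># visits \<gamma>" unfolding crossings_def by (metis mem_Collect_eq not_in_iff zero_neq_numeral)
  then show ?thesis using set_visits by auto
qed

lemma realization_word:
  assumes "realization T \<gamma> lab W" "c \<in># \<gamma>"
  obtains w where "w \<in># W" "cyc_class (gauss_word T \<gamma> lab c) = cyc_class w"
proof -
  have "cyc_class (gauss_word T \<gamma> lab c) \<in># gauss_paragraph T \<gamma> lab"
    using assms(2) unfolding gauss_paragraph_def by auto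
  then show thesis using realizationD(3)[OF assms(1)] that by auto
qed

text \<open>Each crossing leaves a letter in the word of a component through it. Thus labels of
  crossings are indices of the paragraph, which shows n + 1 to be fresh for realizations of the
  shorter paragraph.\<close>

lemma realization_crossing_letter:
  assumes "realization T \<gamma> lab W" "x \<in> crossings \<gamma>"
  shows "\<exists>w\<in>#W. \<exists>b. (lab x, b) \<in> set w"
proof -
  obtain c where c: "c \<in># \<gamma>" "x \<in> set c" using crossing_in_curve[OF assms(2)] by blast
  then obtain s where s: "s \<in> set (cyc_strands c)" "fst (snd s) = x" using visited_strand by blast
  obtain w where w: "w \<in># W" "cyc_class (gauss_word T \<gamma> lab c) = cyc_class w"
    using realization_word[OF assms(1) c(1)] by blast
  then have "gauss_letters T \<gamma> lab (cyc_strands c) \<in> cyc_class w"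
    using gauss_word_cyc_class[OF cyc_class_self] cyc_class_eq_iff by metis
  then have "set (gauss_letters T \<gamma> lab (cyc_strands c)) = set w" by (rule cyc_class_set)
  moreover have "(lab x, travels_positively T \<gamma> s) \<in> set (gauss_letters T \<gamma> lab (cyc_strands c))"
    using s assms(2) unfolding gauss_letters_def by force
  ultimately show ?thesis using w(1) by blast
qed

lemma gauss_paragraph_letter:
  assumes "signed_gauss_paragraph n W" "w \<in># W" "a \<in> set w"
  shows "a \<in> {1..n} \<times> UNIV"
proof -
  have "a \<in># (\<Sum>w\<in>#W. mset w)" using assms(2,3) by auto
  moreover have "finite ({1..n} \<times> (UNIV :: bool set))" by simp
  ultimately show ?thesis using assms(1) unfolding signed_gauss_paragraph_def by (metis finite_set_mset_mset_set)
qed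

lemma gauss_paragraph_distinct:
  assumes "signed_gauss_paragraph n {#u, w#}"
  shows "distinct (u @ w)"
proof -
  have "mset (u @ w) = mset_set ({1..n} \<times> UNIV)" using assms unfolding signed_gauss_paragraph_def by simp
  then have "count (mset (u @ w)) a \<le> 1" for a by (simp add: count_mset_set')
  then show ?thesis by (metis distinct_count_atmost_1 mset_eq_setD count_mset_0_iff le_antisym less_one not_less)
qed

text \<open>Isolates what remains to be checked when a curve is altered locally: at each crossing
  transversality is either inherited, because the strands there are the old ones, or shown for an
  explicit pair of strands.\<close>

lemma pl_normal_reroute:
  assumes "normal_curve T \<gamma>" "\<And>c. c \<in># \<gamma>' \<Longrightarrow> c \<noteq> []"
    "set_mset (edge_visits \<gamma>') \<subseteq> edges T" "\<And>e. count (edge_visits \<gamma>') e \<le> 1" "\<And>x. count (visits \<gamma>') x \<le> 2"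
    "\<And>x. x \<in> crossings \<gamma>' \<Longrightarrow> x \<in> crossings \<gamma> \<and>
        {s \<in> strands_of \<gamma>'. fst (snd s) = x} = {s \<in> strands_of \<gamma>. fst (snd s) = x} \<or>
      (\<exists>s t. {s \<in> strands_of \<gamma>'. fst (snd s) = x} = {s, t} \<and> crossed_left_to_right T s t)"
  shows "pl_normal T \<gamma>'"
  unfolding pl_normal_def
proof (intro conjI ballI allI impI)
  fix x s t assume x: "x \<in> crossings \<gamma>'" and st: "s \<in> strands_of \<gamma>'" "t \<in> strands_of \<gamma>'"
    "fst (snd s) = x" "fst (snd t) = x" "s \<noteq> t"
  from assms(6)[OF x] show "crossed_left_to_right T s t \<or> crossed_left_to_right T t s"
  proof
    assume "x \<in> crossings \<gamma> \<and> {s \<in> strands_of \<gamma>'. fst (snd s) = x} = {s \<in> strands_of \<gamma>. fst (snd s) = x}"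
    then have "x \<in> crossings \<gamma>" "s \<in> strands_of \<gamma>" "t \<in> strands_of \<gamma>" using st by blast+
    then show ?thesis using normal_curve.strands_cross[OF assms(1)] st by blast
  next
    assume "\<exists>s t. {s \<in> strands_of \<gamma>'. fst (snd s) = x} = {s, t} \<and> crossed_left_to_right T s t"
    then obtain s' t' where "{s \<in> strands_of \<gamma>'. fst (snd s) = x} = {s', t'}" "crossed_left_to_right T s' t'" by blast
    moreover from st have "s \<in> {s \<in> strands_of \<gamma>'. fst (snd s) = x}" "t \<in> {s \<in> strands_of \<gamma>'. fst (snd s) = x}"
      by simp_all
    ultimately show ?thesis using st(5) by auto
  qed
qed (use assms in auto)

text \<open>The effect of a join on the Gauss paragraph, for abstract arcs on an arbitrary
  triangulation. It serves both the join given by \<open>is_join\<close> and the explicit one of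
  \<open>join_exists\<close>. Each rerouted strand enters \<open>v\<close> along the last edge of
  the other component, so the strand through \<open>v\<close> followed by \<open>A\<close>, or by
  \<open>B\<close>, is literally the old one.\<close>

lemma join_realization:
  fixes lam sig \<delta> :: "nat list" and w1 w2 :: word and v c a' a'' n :: nat
  defines "\<gamma> \<equiv> {#lam, sig#}"
  assumes gauss: "signed_gauss_paragraph n {#(1, True) # w1, (1, False) # w2#}"
    and real: "realization T \<gamma> lab {#(1, True) # w1, (1, False) # w2#}"
    and word_lam: "cyc_class (gauss_word T \<gamma> lab lam) = cyc_class ((1, True) # w1)"
    and word_sig: "cyc_class (gauss_word T \<gamma> lab sig) = cyc_class ((1, False) # w2)"
    and lab_v: "lab v = 1"
    and lam: "v # A @ a' # P \<in> cyc_class lam"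
    and sig: "v # B @ a'' # R \<in> cyc_class sig"
    and ordinary: "set (a' # P @ a'' # R) \<inter> crossings \<gamma> = {}"
    and path_lam: "successively (\<lambda>x y. {x, y} \<in> edges T) (a' # X1 @ c # X2 @ [v])"
    and path_sig: "successively (\<lambda>x y. {x, y} \<in> edges T) (a'' # Y1 @ c # Y2 @ [v])"
    and enter: "last (c # X2) = last (a'' # R)" "last (c # Y2) = last (a' # P)"
    and dist: "distinct (c # X1 @ X2 @ Y1 @ Y2)"
    and new: "set (c # X1 @ X2 @ Y1 @ Y2) \<inter> set (v # A @ a' # B @ [a'']) = {}"
    and cross: "crossed_left_to_right T (last (a' # X1), c, hd (X2 @ [v])) (last (a'' # Y1), c, hd (Y2 @ [v]))"
    and \<delta>: "\<delta> \<in> cyc_class (v # A @ a' # X1 @ c # X2 @ v # B @ a'' # Y1 @ c # Y2)"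
    and lab': "\<forall>x\<in>crossings \<gamma>. lab' x = lab x" "lab' c = n + 1"
  shows "realization T {#\<delta>#} lab' {#(1, True) # w1 @ (n + 1, True) # (1, False) # w2 @ [(n + 1, False)]#}"
proof -
  interpret N: normal_curve T \<gamma> using realizationD(1)[OF real] .
  \<comment> \<open>\<open>N\<close> collects the interior vertices of the rerouted arcs; none of
    them lies on the retained part of the curve, though old vertices of \<open>P\<close> and
    \<open>R\<close> may be among them.\<close>
  define N where "N = set (c # X1 @ X2 @ Y1 @ Y2)"
  define s1 where "s1 = (last (a' # X1), c, hd (X2 @ [v]))"
  define s2 where "s2 = (last (a'' # Y1), c, hd (Y2 @ [v]))"
  \<comment> \<open>The retained arcs with their entering vertices. By \<open>enter\<close> these
    are the same lists of strands in both curves.\<close>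
  define CA where "CA = path_strands (last (a' # P)) (v # A) a'"
  define CB where "CB = path_strands (last (a'' # R)) (v # B) a''"
  let ?d = "v # A @ a' # X1 @ c # X2 @ v # B @ a'' # Y1 @ c # Y2"
  let ?\<delta> = "{#\<delta>#}"

  have mset_\<gamma>: "visits \<gamma> = mset (v # A @ a' # P) + mset (v # B @ a'' # R)"
    unfolding \<gamma>_def using cyc_class_mset[OF lam] cyc_class_mset[OF sig] by simp
  have mset_\<delta>: "visits ?\<delta> = mset ?d" using cyc_class_mset[OF \<delta>] by simp
  have old: "x \<in> set (v # A) \<union> set (v # B)" if "x \<in> crossings \<gamma>" for x
  proof -
    have "x \<in># visits \<gamma>" using that unfolding crossings_def by (metis mem_Collect_eq not_in_iff zero_neq_numeral)
    then show ?thesis using ordinary that unfolding mset_\<gamma> by auto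
  qed
  have "2 \<le> count (visits \<gamma>) v" unfolding mset_\<gamma> by simp
  then have v: "v \<in> crossings \<gamma>"
    using N.visit_count[of v] unfolding crossings_def by simp
  have vN: "v \<notin> N" "a' \<notin> N" "a'' \<notin> N" using new unfolding N_def by auto
  have ord: "a' \<notin> crossings \<gamma>" "a'' \<notin> crossings \<gamma>" using ordinary by auto
  then have a: "a' \<noteq> v" "a'' \<noteq> v" using v by auto
  have aa: "a' \<noteq> a''"
  proof
    assume "a' = a''"
    then have "2 \<le> count (visits \<gamma>) a'" unfolding mset_\<gamma> by simp
    then have "a' \<in> crossings \<gamma>" using N.visit_count[of a'] unfolding crossings_def by simp
    then show False using ord by blast
  qed
  have cN: "x \<notin> N" if "x \<in> crossings \<gamma>" for x using old[OF that] new unfolding N_def by auto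

  \<comment> \<open>Outside \<open>N\<close> the only change is the loss of the visits made by
    \<open>P\<close> and \<open>R\<close>.\<close>
  have count_old: "count (visits ?\<delta>) x + count (mset (P @ R)) x = count (visits \<gamma>) x" if "x \<notin> N" for x
    using that unfolding mset_\<gamma> mset_\<delta> N_def by (simp add: count_mset_0_iff[THEN iffD2])
  \<comment> \<open>The rerouted arcs share only \<open>c\<close> inside \<open>N\<close>.\<close>
  have count_N: "count (visits ?\<delta>) x = (if x = c then 2 else 1)" if "x \<in> N" for x
  proof -
    have "x \<notin> set (v # A @ a' # B @ [a''])" using that new unfolding N_def by blast
    then have "count (visits ?\<delta>) x = count (mset (X1 @ X2 @ Y1 @ Y2)) x + (if x = c then 2 else 0)"
      unfolding mset_\<delta> by (auto simp: count_mset_0_iff[THEN iffD2])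
    also have "count (mset (X1 @ X2 @ Y1 @ Y2)) x = (if x = c then 0 else 1)"
      using dist that unfolding N_def by (subst distinct_count_atmost_1[THEN iffD1, rule_format]) auto
    finally show ?thesis by simp
  qed
  have crossings_\<delta>: "crossings ?\<delta> = insert c (crossings \<gamma>)"
  proof
    show "crossings ?\<delta> \<subseteq> insert c (crossings \<gamma>)"
    proof
      fix x assume x: "x \<in> crossings ?\<delta>"
      show "x \<in> insert c (crossings \<gamma>)"
      proof (cases "x \<in> N")
        case True then show ?thesis using count_N x unfolding crossings_def by (auto split: if_splits)
      next
        case False
        then show ?thesis using count_old[OF False] N.visit_count[of x] x unfolding crossings_def by auto
      qed
    qed
    have "x \<in> crossings ?\<delta>" if "x \<in> crossings \<gamma>" for x
    proof -
      have "x \<notin> set P" "x \<notin> set R" using ordinary that by auto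
      then have "count (mset P) x = 0" "count (mset R) x = 0" by (simp_all only: count_mset_0_iff not_False_eq_True)
      then have "count (visits ?\<delta>) x = count (visits \<gamma>) x"
        using count_old[OF cN[OF that]] unfolding mset_append count_union by linarith
      then show ?thesis using that unfolding crossings_def by simp
    qed
    moreover have "c \<in> crossings ?\<delta>" using count_N[of c] unfolding crossings_def N_def by simp
    ultimately show "insert c (crossings \<gamma>) \<subseteq> crossings ?\<delta>" by blast
  qed

  have str_lam: "cyc_strands (v # A @ a' # P) = CA @ path_strands (last (v # A)) (a' # P) v"
    unfolding cyc_strands_def CA_def using path_strands_append[of _ "v # A" "a' # P"] by simp
  have str_sig: "cyc_strands (v # B @ a'' # R) = CB @ path_strands (last (v # B)) (a'' # R) v"
    unfolding cyc_strands_def CB_def using path_strands_append[of _ "v # B" "a'' # R"] by simp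
  have str_\<delta>: "cyc_strands ?d = CA @ path_strands (last (v # A)) (a' # X1) c @ [s1] @ path_strands c X2 v @
      CB @ path_strands (last (v # B)) (a'' # Y1) c @ [s2] @ path_strands c Y2 v"
  proof -
    have "cyc_strands ?d = path_strands (last (a' # P)) ((v # A) @ (a' # X1) @ [c] @ X2 @ (v # B) @ (a'' # Y1) @ [c] @ Y2) v"
      unfolding cyc_strands_def using enter(2) by simp
    also have "\<dots> = CA @ path_strands (last (v # A)) (a' # X1) c @ [s1] @ path_strands c X2 v @
      CB @ path_strands (last (v # B)) (a'' # Y1) c @ [s2] @ path_strands c Y2 v"
      unfolding path_strands_append using enter(1) by (simp add: CA_def CB_def s1_def s2_def hd_append)
    finally show ?thesis .
  qed
  have strands_\<gamma>: "strands_of \<gamma> = set CA \<union> set (path_strands (last (v # A)) (a' # P) v) \<union> set CB \<union> set (path_strands (last (v # B)) (a'' # R) v)"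
  proof -
    have "strands_of \<gamma> = set (cyc_strands (v # A @ a' # P)) \<union> set (cyc_strands (v # B @ a'' # R))"
      unfolding strands_of_def \<gamma>_def set_cyc_strands[OF lam] set_cyc_strands[OF sig] by simp
    then show ?thesis unfolding str_lam str_sig by (simp only: set_append Un_assoc)
  qed
  have strands_\<delta>: "strands_of ?\<delta> = set CA \<union> set (path_strands (last (v # A)) (a' # X1) c) \<union> {s1} \<union> set (path_strands c X2 v)
      \<union> set CB \<union> set (path_strands (last (v # B)) (a'' # Y1) c) \<union> {s2} \<union> set (path_strands c Y2 v)"
  proof -
    have "strands_of ?\<delta> = set (cyc_strands ?d)"
      unfolding strands_of_def set_cyc_strands[OF cyc_class_sym[OF \<delta>]] by simp
    then show ?thesis unfolding str_\<delta> by (simp only: set_append Un_assoc list.set)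
  qed
  have mids: "fst (snd s1) = c" "fst (snd s2) = c" by (simp_all add: s1_def s2_def)
  have at_old: "{s \<in> strands_of ?\<delta>. fst (snd s) = x} = {s \<in> strands_of \<gamma>. fst (snd s) = x}"
    if "x \<in> crossings \<gamma>" for x
  proof -
    have "x \<notin> set (a' # P)" "x \<notin> set (a'' # R)" "x \<notin> set (a' # X1)" "x \<notin> set (a'' # Y1)" 
      "x \<notin> set X2" "x \<notin> set Y2" "x \<noteq> c"
      using that ordinary cN[OF that] unfolding N_def by auto
    then show ?thesis unfolding strands_\<gamma> strands_\<delta> using mids by (auto dest!: mid_in_path_strands simp del: path_strands.simps)
  qed
  have at_c: "{s \<in> strands_of ?\<delta>. fst (snd s) = c} = {s1, s2}"
  proof -
    have "c \<notin> set (v # A)" "c \<notin> set (v # B)" "c \<notin> set (a' # X1)" "c \<notin> set (a'' # Y1)" "c \<notin> set X2" "c \<notin> set Y2"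
      using new dist by auto
    then show ?thesis unfolding strands_\<delta> CA_def CB_def using mids by (auto dest!: mid_in_path_strands simp del: path_strands.simps)
  qed

  have ev_\<gamma>: "edge_visits \<gamma> = mset (path_edges (v # A @ [a'])) + mset (path_edges (a' # P @ [v]))
      + (mset (path_edges (v # B @ [a''])) + mset (path_edges (a'' # R @ [v])))"
    unfolding \<gamma>_def using edge_visits_cyc_class[OF lam] edge_visits_cyc_class[OF sig]
      path_edges_append[of "v # A" a' "P @ [v]"] path_edges_append[of "v # B" a'' "R @ [v]"] by simp
  let ?q1 = "a' # X1 @ c # X2 @ [v]" and ?q2 = "a'' # Y1 @ c # Y2 @ [v]"
  have ev_\<delta>: "edge_visits ?\<delta> = mset (path_edges (v # A @ [a'])) + mset (path_edges (v # B @ [a'']))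
      + mset (path_edges ?q1 @ path_edges ?q2)"
    using edge_visits_cyc_class[of v "A @ a' # X1 @ c # X2 @ v # B @ a'' # Y1 @ c # Y2" \<delta>]
      cyc_class_sym[OF \<delta>] path_edges_append[of "v # A" a' "X1 @ c # X2 @ v # B @ a'' # Y1 @ c # Y2 @ [v]"]
      path_edges_append[of "a' # X1 @ c # X2" v "B @ a'' # Y1 @ c # Y2 @ [v]"]
      path_edges_append[of "v # B" a'' "Y1 @ c # Y2 @ [v]"] by simp
  have dq: "distinct ?q1" "distinct ?q2" using dist vN a unfolding N_def by auto
  \<comment> \<open>A common edge could only be {c, v}. Then X2 and Y2 are empty, so
    \<open>enter\<close> puts \<open>c\<close> on both discarded pieces of the components;
    \<open>c\<close> would be visited twice by the old curve and be one of its crossings, which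
    \<open>cN\<close> excludes.\<close>
  have "set (path_edges ?q1) \<inter> set (path_edges ?q2) = {}"
  proof (rule equals0I)
    fix e assume e: "e \<in> set (path_edges ?q1) \<inter> set (path_edges ?q2)"
    then have "e \<subseteq> set ?q1 \<inter> set ?q2" using path_edges_verts by blast
    also have "\<dots> \<subseteq> {c, v}" using dist vN a aa unfolding N_def by auto
    finally have ecv: "e \<subseteq> {c, v}" .
    have "e \<in> edges T" using e path_lam unfolding successively_path_edges by blast
    then have "card e = 2" using surface_edge_card[OF N.surface] by blast
    moreover have "card {c, v} \<le> 2" by (simp add: card_insert_if)
    ultimately have "e = {c, v}" using ecv by (intro card_seteq) auto
    then have "X2 = []" "Y2 = []" using e path_edges_last_edge[of "a' # X1" c X2 v] path_edges_last_edge[of "a'' # Y1" c Y2 v] dq by auto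
    then have "last (a'' # R) = c" "last (a' # P) = c" using enter by auto
    then have "c \<in> set (a' # P)" "c \<in> set (a'' # R)" by (metis last_in_set list.distinct(1))+
    then have "1 \<le> count (mset (a' # P)) c" "1 \<le> count (mset (a'' # R)) c"
      by (simp_all only: count_greater_eq_one_iff set_mset_mset)
    moreover have "count (visits \<gamma>) c =
        count (mset (v # A)) c + count (mset (a' # P)) c + (count (mset (v # B)) c + count (mset (a'' # R)) c)"
      unfolding mset_\<gamma> by simp
    ultimately have "2 \<le> count (visits \<gamma>) c" by linarith
    then have "c \<in> crossings \<gamma>" using N.visit_count[of c] unfolding crossings_def by simp
    then show False using cN unfolding N_def by auto
  qed
  then have dpq: "distinct (path_edges ?q1 @ path_edges ?q2)" using path_edges_distinct[OF dq(1)] path_edges_distinct[OF dq(2)] by simp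
  have edge_new: "e \<inter> N \<noteq> {}" if "e \<in> set (path_edges ?q1 @ path_edges ?q2)" for e
    using that path_edges_meets[of "X1 @ c # X2" e a' v] path_edges_meets[of "Y1 @ c # Y2" e a'' v] unfolding N_def by auto
  have edge_old: "e \<inter> N = {}" if "e \<in> set (path_edges (v # A @ [a'])) \<union> set (path_edges (v # B @ [a'']))" for e
    using that new path_edges_verts[of e] unfolding N_def by fastforce

  have normal_\<delta>: "pl_normal T ?\<delta>"
  proof (rule pl_normal_reroute[OF N.normal_curve_axioms])
    show "d \<noteq> []" if "d \<in># ?\<delta>" for d using that cyc_class_length[OF \<delta>] by auto
    show "set_mset (edge_visits ?\<delta>) \<subseteq> edges T"
    proof
      fix e assume "e \<in># edge_visits ?\<delta>"
      then have "e \<in># edge_visits \<gamma> \<or> e \<in> set (path_edges ?q1) \<or> e \<in> set (path_edges ?q2)" unfolding ev_\<gamma> ev_\<delta> by auto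
      then show "e \<in> edges T" using N.edge_in path_lam path_sig unfolding successively_path_edges by blast
    qed
    show "count (edge_visits ?\<delta>) e \<le> 1" for e
    \<comment> \<open>Edges missing \<open>N\<close> lie on the retained arcs and are bounded by the
      old count; edges meeting \<open>N\<close> lie on the rerouted arcs, whose edges are pairwise
      distinct.\<close>
    proof (cases "e \<inter> N = {}")
      case True
      then have "e \<notin> set (path_edges ?q1 @ path_edges ?q2)" using edge_new by blast
      then have "count (mset (path_edges ?q1 @ path_edges ?q2)) e = 0" by (simp only: count_mset_0_iff not_False_eq_True)
      then have "count (edge_visits ?\<delta>) e \<le> count (edge_visits \<gamma>) e" unfolding ev_\<gamma> ev_\<delta> count_union by linarith
      then show ?thesis using N.edge_count[of e] by linarith
    next
      case False
      then have "e \<notin> set (path_edges (v # A @ [a']))" "e \<notin> set (path_edges (v # B @ [a'']))" using edge_old by blast+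
      then have "count (mset (path_edges (v # A @ [a']))) e = 0" "count (mset (path_edges (v # B @ [a'']))) e = 0"
        by (simp_all only: count_mset_0_iff not_False_eq_True)
      moreover have "count (mset (path_edges ?q1 @ path_edges ?q2)) e \<le> 1" using dpq
        by (metis count_mset_0_iff distinct_count_atmost_1 le_numeral_extra(4) zero_le)
      ultimately show ?thesis unfolding ev_\<delta> count_union by linarith
    qed
    show "count (visits ?\<delta>) x \<le> 2" for x
    proof (cases "x \<in> N")
      case True then show ?thesis using count_N by simp
    next
      case False then show ?thesis using count_old[OF False] N.visit_count[of x] by linarith
    qed
    show "x \<in> crossings \<gamma> \<and> {s \<in> strands_of ?\<delta>. fst (snd s) = x} = {s \<in> strands_of \<gamma>. fst (snd s) = x} \<or>
      (\<exists>s t. {s \<in> strands_of ?\<delta>. fst (snd s) = x} = {s, t} \<and> crossed_left_to_right T s t)"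
      if "x \<in> crossings ?\<delta>" for x
      using that at_old at_c cross unfolding crossings_\<delta> s1_def s2_def by blast
  qed

  have sign_c: "travels_positively T ?\<delta> s1" "\<not> travels_positively T ?\<delta> s2"
    using travels_positively_pair[of ?\<delta> s1 s2 T] at_c mids cross unfolding s1_def s2_def by auto
  have letters: "gauss_letters T ?\<delta> lab' ss = gauss_letters T \<gamma> lab ss" if "\<And>s. s \<in> set ss \<Longrightarrow> fst (snd s) \<noteq> c" for ss
    by (rule gauss_letters_cong) (use that lab'(1) travels_positively_cong[OF at_old] in \<open>auto simp: crossings_\<delta>\<close>)
  have ne_c: "fst (snd s) \<noteq> c" if "s \<in> set CA \<union> set CB" for s
  proof -
    have "fst (snd s) \<in> set (v # A) \<union> set (v # B)" using that mid_in_path_strands[of s "last (a' # P)" "v # A" a'] mid_in_path_strands[of s "last (a'' # R)" "v # B" a'']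
      unfolding CA_def CB_def by (metis Un_iff)
    moreover have "c \<notin> set (v # A) \<union> set (v # B)" using new by auto
    ultimately show ?thesis by metis
  qed
  have "gauss_letters T ?\<delta> lab' (path_strands (last (v # A)) (a' # X1) c) = []"
    "gauss_letters T ?\<delta> lab' (path_strands c X2 v) = []" "gauss_letters T ?\<delta> lab' (path_strands (last (v # B)) (a'' # Y1) c) = []"
    "gauss_letters T ?\<delta> lab' (path_strands c Y2 v) = []"
    using dist ord cN vN unfolding N_def
    by (auto intro!: gauss_letters_empty dest!: mid_in_path_strands simp: crossings_\<delta> simp del: path_strands.simps)
  then have word_\<delta>: "gauss_letters T ?\<delta> lab' (cyc_strands ?d) =
      gauss_letters T \<gamma> lab CA @ (n + 1, True) # gauss_letters T \<gamma> lab CB @ [(n + 1, False)]"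
    unfolding str_\<delta> using letters ne_c sign_c mids lab'(2) by (simp add: crossings_\<delta> del: path_strands.simps)
  have "gauss_letters T \<gamma> lab (path_strands (last (v # A)) (a' # P) v) = []"
    "gauss_letters T \<gamma> lab (path_strands (last (v # B)) (a'' # R) v) = []"
    using ordinary by (auto intro!: gauss_letters_empty dest!: mid_in_path_strands simp del: path_strands.simps)
  then have "gauss_letters T \<gamma> lab CA \<in> cyc_class ((1, True) # w1)" "gauss_letters T \<gamma> lab CB \<in> cyc_class ((1, False) # w2)"
    using gauss_word_cyc_class[OF lam] gauss_word_cyc_class[OF sig] word_lam word_sig
    unfolding str_lam str_sig cyc_class_eq_iff by (auto simp flip: cyc_class_eq_iff)
  moreover obtain b1 r1 where CA': "gauss_letters T \<gamma> lab CA = (1, b1) # r1"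
    unfolding CA_def using v lab_v by simp
  moreover obtain b2 r2 where CB': "gauss_letters T \<gamma> lab CB = (1, b2) # r2"
    unfolding CB_def using v lab_v by simp
  ultimately have c12: "(1, b1) # r1 \<in> cyc_class ((1, True) # w1)" "(1, b2) # r2 \<in> cyc_class ((1, False) # w2)" by auto
  have dw: "distinct ((1, True) # w1 @ (1, False) # w2)" using gauss_paragraph_distinct[OF gauss] by simp
  \<comment> \<open>The sign of the letter at \<open>v\<close> is read off from the words: in each
    of them the index 1 occurs with one sign only. Starting at this letter then fixes the
    rotation.\<close>
  have "(1, b1) \<in> set ((1, True) # w1)" "(1, b2) \<in> set ((1, False) # w2)"
    using cyc_class_set[OF c12(1)] cyc_class_set[OF c12(2)] by (metis list.set_intros(1))+
  moreover have "(1, False) \<notin> set ((1, True) # w1)" "(1, True) \<notin> set ((1, False) # w2)" using dw by auto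
  ultimately have "b1 = True" "b2 = False" by metis+
  then have "gauss_letters T \<gamma> lab CA = (1, True) # w1" "gauss_letters T \<gamma> lab CB = (1, False) # w2"
    using cyc_class_Cons_distinct[of "(1, True)" r1 w1] cyc_class_Cons_distinct[of "(1, False)" r2 w2]
      c12 CA' CB' dw by simp_all
  then have "cyc_class (gauss_word T ?\<delta> lab' \<delta>) =
      cyc_class ((1, True) # w1 @ (n + 1, True) # (1, False) # w2 @ [(n + 1, False)])"
    using gauss_word_cyc_class[OF cyc_class_sym[OF \<delta>]] word_\<delta> by simp
  moreover have "inj_on lab' (crossings ?\<delta>)"
  proof -
    have "lab x \<noteq> n + 1" if x: "x \<in> crossings \<gamma>" for x
    proof -
      obtain w b where "w \<in># {#(1, True) # w1, (1, False) # w2#}" "(lab x, b) \<in> set w"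
        using realization_crossing_letter[OF real x] by blast
      then have "(lab x, b) \<in> {1..n} \<times> UNIV" using gauss_paragraph_letter[OF gauss] by blast
      then show ?thesis by simp
    qed
    then have "lab' c \<notin> lab' ` crossings \<gamma>" using lab' by (metis imageE)
    moreover have "inj_on lab' (crossings \<gamma>)"
      using realizationD(2)[OF real] lab'(1) by (simp add: inj_on_def)
    ultimately show ?thesis unfolding crossings_\<delta> by (simp add: inj_on_insert image_iff)
  qed
  ultimately show ?thesis using N.surface normal_\<delta> unfolding realization_def gauss_paragraph_def by simp
qed

section \<open>Smoothing a crossing\<close>

text \<open>
  The oriented smoothing at \<open>c\<close> splits \<open>d\<close> into two closed curves that touch at \<open>c\<close>; the one through
  \<open>e1\<close> and \<open>e2\<close> is pushed off \<open>c\<close> along the arc \<open>M\<close> of the link of \<open>c\<close>.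
\<close>

lemma smooth_realization:
  fixes d :: "nat list" and w1 w2 :: word and n c e1 e2 :: nat
  assumes gauss: "signed_gauss_paragraph n {#(1, True) # w1, (1, False) # w2#}"
    and real: "realization T {#d#} lab {#(1, True) # w1 @ (n + 1, True) # (1, False) # w2 @ [(n + 1, False)]#}"
    and d: "c # (e1 # E @ [e2]) @ c # F \<in> cyc_class d" and F: "F \<noteq> []"
    and lab_c: "lab c = n + 1"
    and cross: "crossed_left_to_right T (last F, c, e1) (e2, c, hd F)"
    and link: "link_cycle T c (e1 # M @ e2 # N)"
    and M: "M \<noteq> []" "set M \<inter> set d = {}"
    and ord: "e1 \<notin> crossings {#d#}" "e2 \<notin> crossings {#d#}"
  shows "realization T {#c # F, e1 # E @ e2 # rev M#} lab {#(1, True) # w1, (1, False) # w2#}"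
proof -
  \<comment> \<open>The two visits to \<open>c\<close> cut the curve into two loops, one through e1,
    E, e2 and one through F.\<close>
  let ?d = "c # (e1 # E @ [e2]) @ c # F"
  \<comment> \<open>This loop avoids \<open>c\<close>: from e2 it returns to e1 backwards along M,
    since M leads counterclockwise from e1 to e2.\<close>
  let ?k = "e1 # E @ e2 # rev M"
  let ?\<gamma> = "{#d#}" and ?\<gamma>' = "{#c # F, ?k#}"
  interpret N: normal_curve T ?\<gamma> using realizationD(1)[OF real] .
  define s1 where "s1 = (last F, c, e1)"
  define s2 where "s2 = (e2, c, hd F)"
  define t1 where "t1 = (c, e1, hd (E @ [e2]))"
  define t2 where "t2 = (last (e1 # E), e2, c)"
  define CE where "CE = path_strands e1 E e2"
  define CF where "CF = path_strands c F c"
  have distM: "distinct (e1 # M @ e2 # N)" using link unfolding link_cycle_def by blast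
  have set_d: "set d = set ?d" using cyc_class_set[OF d] by simp
  have visits_d: "visits ?\<gamma> = mset ?d" using cyc_class_mset[OF d] by simp
  have visits': "visits ?\<gamma>' = mset (c # F) + mset (e1 # E @ [e2]) + mset M" by simp
  have "2 \<le> count (visits ?\<gamma>) c" unfolding visits_d by simp
  then have c2: "count (visits ?\<gamma>) c = 2" using N.visit_count[of c] by linarith
  then have c: "c \<in> crossings ?\<gamma>" unfolding crossings_def by blast
  have "distinct M" using distM by simp
  have visits_M: "count (visits ?\<gamma>) x = 0" if "x \<in> set M" for x
  proof -
    have "x \<notin> set d" using M(2) that by blast
    then show ?thesis by simp
  qed
  \<comment> \<open>\<open>c\<close> keeps one of its two visits, the formerly unvisited vertices of
    M gain one, all others are unchanged.\<close>
  have count': "count (visits ?\<gamma>') x = (if x = c then 1 else if x \<in> set M then 1 else count (visits ?\<gamma>) x)" for x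
  proof -
    define q q' r m where "q = count (visits ?\<gamma>) x" and "q' = count (visits ?\<gamma>') x"
      and "r = count (mset (c # F) + mset (e1 # E @ [e2])) x" and "m = count (mset M) x"
    have "q = r + (if x = c then 1 else 0)" unfolding q_def r_def visits_d by simp
    moreover have "q' = r + m" unfolding q'_def r_def m_def visits' by simp
    moreover have "m = (if x \<in> set M then 1 else 0)"
      using \<open>distinct M\<close> unfolding distinct_count_atmost_1 m_def by blast
    moreover have "x \<in> set M \<Longrightarrow> q = 0" unfolding q_def by (rule visits_M)
    moreover have "x = c \<Longrightarrow> q = 2" using c2 unfolding q_def by simp
    ultimately have "q' = (if x = c then 1 else if x \<in> set M then 1 else q)" by (auto split: if_splits)
    then show ?thesis unfolding q_def q'_def .
  qed
  have crossings': "crossings ?\<gamma>' = crossings ?\<gamma> - {c}"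
  proof (rule set_eqI)
    fix x show "x \<in> crossings ?\<gamma>' \<longleftrightarrow> x \<in> crossings ?\<gamma> - {c}"
      unfolding crossings_def using count'[of x] visits_M[of x] by (simp del: visits_simps split: if_splits)
  qed

  have str_d: "cyc_strands ?d = s1 # t1 # CE @ t2 # s2 # CF"
  proof -
    have "cyc_strands ?d = path_strands (last F) ([c] @ [e1] @ E @ [e2] @ [c] @ F) c"
      unfolding cyc_strands_def using F by simp
    also have "\<dots> = s1 # t1 # CE @ t2 # s2 # CF"
      unfolding path_strands_append using F by (simp add: s1_def s2_def t1_def t2_def CE_def CF_def hd_append)
    finally show ?thesis .
  qed
  have str_F: "cyc_strands (c # F) = (last F, c, hd F) # CF"
    unfolding cyc_strands_def CF_def using F by (simp add: hd_append)
  have str_k: "\<exists>p. cyc_strands ?k = p # CE @ path_strands (last (e1 # E)) (e2 # rev M) e1 \<and> fst (snd p) = e1"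
  proof -
    have "cyc_strands ?k = path_strands (last ?k) ([e1] @ E @ (e2 # rev M)) e1" unfolding cyc_strands_def by simp
    also have "\<dots> = (last ?k, e1, hd (E @ [e2])) # CE @ path_strands (last (e1 # E)) (e2 # rev M) e1"
      unfolding path_strands_append by (simp add: CE_def hd_append)
    finally show ?thesis by auto
  qed
  then obtain p where p: "cyc_strands ?k = p # CE @ path_strands (last (e1 # E)) (e2 # rev M) e1" "fst (snd p) = e1" by blast
  have strands: "strands_of ?\<gamma> = {s1, t1, t2, s2} \<union> set CE \<union> set CF"
  proof -
    have "strands_of ?\<gamma> = set (cyc_strands ?d)" unfolding strands_of_def set_cyc_strands[OF d] by simp
    then show ?thesis unfolding str_d by auto
  qed
  have strands': "strands_of ?\<gamma>' = {(last F, c, hd F), p} \<union> set CE \<union> set CF \<union> set (path_strands (last (e1 # E)) (e2 # rev M) e1)"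
    unfolding strands_of_cyc_strands using str_F p(1) by (auto simp del: path_strands.simps)
  have mids: "fst (snd s1) = c" "fst (snd s2) = c" "fst (snd t1) = e1" "fst (snd t2) = e2"
    by (simp_all add: s1_def s2_def t1_def t2_def)
  have at_old: "{s \<in> strands_of ?\<gamma>'. fst (snd s) = x} = {s \<in> strands_of ?\<gamma>. fst (snd s) = x}"
    if x: "x \<in> crossings ?\<gamma>" "x \<noteq> c" for x
  proof -
    have "x \<in> set d" using crossing_in_curve[OF x(1)] by simp
    then have "x \<notin> set (e2 # rev M)" "x \<noteq> e1" using x ord M(2) by auto
    then show ?thesis unfolding strands strands' using x(2) mids p(2) by (auto dest!: mid_in_path_strands simp del: path_strands.simps)
  qed
  have c_notin: "c \<notin> set F" "c \<notin> set E" "c \<noteq> e1" "c \<noteq> e2"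
  proof -
    have "visits ?\<gamma> = add_mset c (add_mset c (mset (F @ e1 # E @ [e2])))" unfolding visits_d by simp
    then have "count (mset (F @ e1 # E @ [e2])) c = 0" using c2
      by (simp only: count_add_mset if_True simp_thms)
    then have "c \<notin> set (F @ e1 # E @ [e2])" by (simp only: count_mset_0_iff not_False_eq_True)
    then show "c \<notin> set F" "c \<notin> set E" "c \<noteq> e1" "c \<noteq> e2" by auto
  qed
  have at_c: "{s \<in> strands_of ?\<gamma>. fst (snd s) = c} = {s1, s2}"
    unfolding strands CE_def CF_def using c_notin mids by (auto dest!: mid_in_path_strands)

  have ev: "edge_visits ?\<gamma> = mset (path_edges (c # F @ [c])) + mset (path_edges (e1 # E @ [e2])) + {#{c, e1}, {e2, c}#}"
    using edge_visits_cyc_class[of c "(e1 # E @ [e2]) @ c # F" d] d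
      path_edges_append[of "c # e1 # E @ [e2]" c "F @ [c]"] path_edges_append[of "c # e1 # E" e2 "[c]"] by simp
  have ev': "edge_visits ?\<gamma>' = mset (path_edges (c # F @ [c])) + mset (path_edges (e1 # E @ [e2])) + mset (path_edges (e2 # rev M @ [e1]))"
    using edge_visits_cyc_class[OF cyc_class_self, of c F] edge_visits_cyc_class[OF cyc_class_self, of e1 "E @ e2 # rev M"]
      path_edges_append[of "e1 # E" e2 "rev M @ [e1]"] by simp
  \<comment> \<open>Consecutive vertices of the link of \<open>c\<close> span a triangle with
    \<open>c\<close>, hence an edge.\<close>
  have new_edges: "set (path_edges (e2 # rev M @ [e1])) \<subseteq> edges T"
  proof
    fix e assume "e \<in> set (path_edges (e2 # rev M @ [e1]))"
    then obtain us a b vs where e: "e = {a, b}" "e2 # rev M @ [e1] = us @ a # b # vs" using path_edges_E by blast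
    then have "rev (e2 # rev M @ [e1]) = rev (us @ a # b # vs)" by simp
    then have "e1 # M @ [e2] = rev vs @ b # a # rev us" by simp
    then have eq: "e1 # M @ e2 # N = rev vs @ b # a # rev us @ N" by (metis append.assoc append_Cons append_Nil)
    have "(b, a) \<in> set (cyc_pairs (e1 # M @ e2 # N))" unfolding eq by (rule cyc_pairs_Cons2)
    then have "(c, b, a) \<in> T" using link_cycle_iff[OF link] by blast
    then show "e \<in> edges T" unfolding e(1) edges_def by blast
  qed
  have normal': "pl_normal T ?\<gamma>'"
  proof (rule pl_normal_reroute[OF N.normal_curve_axioms])
    show "b \<noteq> []" if "b \<in># ?\<gamma>'" for b using that by auto
    show "set_mset (edge_visits ?\<gamma>') \<subseteq> edges T"
    proof
      fix e assume "e \<in># edge_visits ?\<gamma>'"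
      then have "e \<in># edge_visits ?\<gamma> \<or> e \<in> set (path_edges (e2 # rev M @ [e1]))" unfolding ev ev' by auto
      then show "e \<in> edges T" using N.edge_in new_edges by blast
    qed
    show "count (edge_visits ?\<gamma>') e \<le> 1" for e
    proof (cases "e \<inter> set M = {}")
      case True
      then have "e \<notin> set (path_edges (e2 # rev M @ [e1]))" using path_edges_meets[of "rev M" e e2 e1] M(1) by auto
      then have "count (mset (path_edges (e2 # rev M @ [e1]))) e = 0" by (simp only: count_mset_0_iff not_False_eq_True)
      then have "count (edge_visits ?\<gamma>') e \<le> count (edge_visits ?\<gamma>) e" unfolding ev ev' count_union by linarith
      then show ?thesis using N.edge_count[of e] by linarith
    next
      case False
      then have "\<not> e \<subseteq> set d" using M(2) by blast
      then have "\<not> e \<subseteq> set (c # F @ [c])" "\<not> e \<subseteq> set (e1 # E @ [e2])" unfolding set_d by auto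
      then have "e \<notin> set (path_edges (c # F @ [c]))" "e \<notin> set (path_edges (e1 # E @ [e2]))" using path_edges_verts by blast+
      then have "count (mset (path_edges (c # F @ [c]))) e = 0" "count (mset (path_edges (e1 # E @ [e2]))) e = 0"
        by (simp_all only: count_mset_0_iff not_False_eq_True)
      moreover have "distinct (path_edges (e2 # rev M @ [e1]))" by (rule path_edges_distinct) (use distM in auto)
      then have "count (mset (path_edges (e2 # rev M @ [e1]))) e \<le> 1"
        by (metis count_mset_0_iff distinct_count_atmost_1 le_numeral_extra(4) zero_le)
      ultimately show ?thesis unfolding ev' count_union by linarith
    qed
    show "count (visits ?\<gamma>') x \<le> 2" for x using count'[of x] N.visit_count[of x] by (auto split: if_splits)
    show "x \<in> crossings ?\<gamma> \<and> {s \<in> strands_of ?\<gamma>'. fst (snd s) = x} = {s \<in> strands_of ?\<gamma>. fst (snd s) = x} \<or>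
      (\<exists>s t. {s \<in> strands_of ?\<gamma>'. fst (snd s) = x} = {s, t} \<and> crossed_left_to_right T s t)"
      if "x \<in> crossings ?\<gamma>'" for x
      using that at_old unfolding crossings' by blast
  qed

  have sign_c: "travels_positively T ?\<gamma> s1" "\<not> travels_positively T ?\<gamma> s2"
    using travels_positively_pair[of ?\<gamma> s1 s2 T] at_c mids cross unfolding s1_def s2_def by auto
  have letters: "gauss_letters T ?\<gamma>' lab ss = gauss_letters T ?\<gamma> lab ss"
    if "\<And>s. s \<in> set ss \<Longrightarrow> fst (snd s) \<noteq> c" for ss
    by (rule gauss_letters_cong) (use that travels_positively_cong[OF at_old] in \<open>auto simp: crossings'\<close>)
  have CEF: "gauss_letters T ?\<gamma>' lab CE = gauss_letters T ?\<gamma> lab CE" "gauss_letters T ?\<gamma>' lab CF = gauss_letters T ?\<gamma> lab CF"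
    using c_notin unfolding CE_def CF_def by (auto intro!: letters dest!: mid_in_path_strands)
  have word_d: "gauss_letters T ?\<gamma> lab (cyc_strands ?d) = (n + 1, True) # gauss_letters T ?\<gamma> lab CE @ (n + 1, False) # gauss_letters T ?\<gamma> lab CF"
    unfolding str_d using mids ord c sign_c lab_c by simp
  \<comment> \<open>The strand through \<open>c\<close> yields no letter, as \<open>c\<close> is no
    longer a crossing.\<close>
  have word_F: "gauss_letters T ?\<gamma>' lab (cyc_strands (c # F)) = gauss_letters T ?\<gamma> lab CF"
    unfolding str_F using CEF crossings' by simp
  have "gauss_letters T ?\<gamma>' lab (path_strands (last (e1 # E)) (e2 # rev M) e1) = []"
  proof (rule gauss_letters_empty)
    fix s assume "s \<in> set (path_strands (last (e1 # E)) (e2 # rev M) e1)"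
    then have "fst (snd s) \<in> set (e2 # rev M)" by (rule mid_in_path_strands)
    then show "fst (snd s) \<notin> crossings ?\<gamma>'"
      using ord M(2) crossing_in_curve[of "fst (snd s)" ?\<gamma>] unfolding crossings' by auto
  qed
  then have word_k: "gauss_letters T ?\<gamma>' lab (cyc_strands ?k) = gauss_letters T ?\<gamma> lab CE"
    unfolding p(1) using p(2) CEF ord crossings' by (simp del: path_strands.simps)

  let ?W = "(1, True) # w1 @ (n + 1, True) # (1, False) # w2 @ [(n + 1, False)]"
  \<comment> \<open>The remainder of the cyclic word when it is rotated to start with the positive
    letter of index n + 1; \<open>s1\<close> is the strand producing that letter.\<close>
  let ?W' = "((1, False) # w2) @ (n + 1, False) # (1, True) # w1"
  have "cyc_class (gauss_word T ?\<gamma> lab d) = cyc_class ?W"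
    using realizationD(3)[OF real] unfolding gauss_paragraph_def by simp
  then have "gauss_letters T ?\<gamma> lab (cyc_strands ?d) \<in> cyc_class ?W"
    using gauss_word_cyc_class[OF d] cyc_class_eq_iff by metis
  moreover have "?W \<in> cyc_class ((n + 1, True) # ?W')"
    using cyc_class_append[of "(1, True) # w1" "(n + 1, True) # (1, False) # w2 @ [(n + 1, False)]"] by simp
  ultimately have W: "(n + 1, True) # gauss_letters T ?\<gamma> lab CE @ (n + 1, False) # gauss_letters T ?\<gamma> lab CF
      \<in> cyc_class ((n + 1, True) # ?W')"
    unfolding word_d by (rule cyc_class_trans)
  have "distinct ((1, True) # w1 @ (1, False) # w2)" using gauss_paragraph_distinct[OF gauss] by simp
  moreover have "(n + 1, b) \<notin> set ((1, True) # w1)" "(n + 1, b) \<notin> set ((1, False) # w2)" for b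
    using gauss_paragraph_letter[OF gauss, of _ "(n + 1, b)"] by fastforce+
  ultimately have dW: "distinct ((n + 1, True) # ?W')" "(n + 1, False) \<notin> set ((1, False) # w2)" "(n + 1, False) \<notin> set ((1, True) # w1)"
    by auto
  have eq: "gauss_letters T ?\<gamma> lab CE @ (n + 1, False) # gauss_letters T ?\<gamma> lab CF = ?W'"
    by (rule cyc_class_Cons_distinct[OF W dW(1)])
  \<comment> \<open>The negative letter of index n + 1 occurs in neither given word, so the place
    where the remainder splits is forced.\<close>
  then have "gauss_letters T ?\<gamma> lab CE = (1, False) # w2 \<and> gauss_letters T ?\<gamma> lab CF = (1, True) # w1"
    using append_Cons_eq_iff[OF dW(2,3)] by metis
  then have "cyc_class (gauss_word T ?\<gamma>' lab (c # F)) = cyc_class ((1, True) # w1)"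
    "cyc_class (gauss_word T ?\<gamma>' lab ?k) = cyc_class ((1, False) # w2)"
    using gauss_word_cyc_class[OF cyc_class_self] word_F word_k by metis+
  moreover have "inj_on lab (crossings ?\<gamma>')"
    using realizationD(2)[OF real] unfolding crossings' by (rule inj_on_subset) blast
  ultimately show ?thesis using N.surface normal' unfolding realization_def gauss_paragraph_def by simp
qed

section \<open>Curves in general position to the links of their crossings\<close>

text \<open>
  Tameness holds after one subdivision.  It ensures that a sector of a link bounded by two consecutive
  strands of the curve is free, so that strands can be rerouted inside it.
\<close>

definition tame :: "triangles \<Rightarrow> curve \<Rightarrow> bool" where
  "tame T \<gamma> \<longleftrightarrow> (\<forall>v\<in>crossings \<gamma>. \<forall>y z. (v, y, z) \<in> T \<longrightarrow>
     (y \<in># visits \<gamma> \<longrightarrow> y \<notin> crossings \<gamma> \<and> {v, y} \<in># edge_visits \<gamma>) \<and>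
     \<not> (y \<in># visits \<gamma> \<and> z \<in># visits \<gamma>))"

lemma in_sum_mset_image: "y \<in># g e \<Longrightarrow> e \<in># M \<Longrightarrow> y \<in># (\<Sum>e\<in>#M. g e)"
  by (induction M) auto

context normal_curve
begin

lemma sd_vertex_visited: "sd_vertex x \<in># visits \<gamma>' \<longleftrightarrow> x \<in># visits \<gamma>"
  using count_visits_sd_vertex[of x] by (metis count_eq_zero_iff)

lemma sd_edge_visited:
  assumes "a \<noteq> b" "sd_edge a b \<in># visits \<gamma>'"
  shows "{a, b} \<in># edge_visits \<gamma>"
proof -
  have "sd_edge a b \<notin> range sd_vertex" using sd_vertex_neq_sd_edge[OF assms(1)] by fastforce
  then have "sd_edge a b \<in># image_mset set_encode (edge_visits \<gamma>)" using assms(2) unfolding visits_sd by auto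
  then obtain e where e: "e \<in># edge_visits \<gamma>" "set_encode e = set_encode {a, b}" unfolding sd_edge_def by auto
  then have "e = {a, b}" using edge_card[OF e(1)] by (simp add: set_encode_eq)
  then show ?thesis using e(1) by simp
qed

lemma sd_face_not_visited: "(a, b, c) \<in> T \<Longrightarrow> sd_face a b c \<notin># visits \<gamma>'"
proof
  assume T: "(a, b, c) \<in> T" and v: "sd_face a b c \<in># visits \<gamma>'"
  have "sd_face a b c \<notin> range sd_vertex" using sd_codes_neq(4)[OF surface T] by blast
  then have "sd_face a b c \<in># image_mset set_encode (edge_visits \<gamma>)" using v unfolding visits_sd by auto
  then obtain e where e: "e \<in># edge_visits \<gamma>" "set_encode e = set_encode {a, b, c}" unfolding sd_face_def by auto
  then have "e = {a, b, c}" using edge_card[OF e(1)] by (simp add: set_encode_eq)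
  moreover have "card {a, b, c} = 3" using surface_neq[OF surface T] by auto
  ultimately show False using edge_card[OF e(1)] by simp
qed

text \<open>The neighbours of an old vertex alternate between midpoints of edges and barycentres of
  faces. The latter are never visited, and a midpoint is visited only if the curve runs along its
  edge; midpoints are not crossings either.\<close>

lemma tame_sd: "tame T' \<gamma>'"
  unfolding tame_def
proof (intro ballI allI impI)
  fix x y z assume "x \<in> crossings \<gamma>'" and T': "(x, y, z) \<in> T'"
  then obtain v where v: "v \<in> crossings \<gamma>" "x = sd_vertex v" using crossings_sd by blast
  obtain a b where T: "(v, a, b) \<in> T" and yz: "(y, z) \<in> {(sd_edge v a, sd_face v a b), (sd_face v a b, sd_edge v b)}"
    using T' sd_at_vertex[OF surface] v(2) by metis
  have nF: "sd_face v a b \<notin># visits \<gamma>'" by (rule sd_face_not_visited[OF T])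
  have "v \<noteq> a" using surface_neq[OF surface T] by blast
  have "sd_edge v a \<notin> crossings \<gamma>'" unfolding crossings_sd using sd_vertex_neq_sd_edge[OF \<open>v \<noteq> a\<close>] by fastforce
  moreover have "{sd_vertex v, sd_edge v a} \<in># edge_visits \<gamma>'" if "sd_edge v a \<in># visits \<gamma>'"
  proof -
    have e: "{v, a} \<in># edge_visits \<gamma>" using sd_edge_visited[OF \<open>v \<noteq> a\<close> that] .
    let ?g = "\<lambda>e. mset_set ((\<lambda>x. {sd_vertex x, set_encode e}) ` e)"
    have "{sd_vertex v, sd_edge v a} \<in># ?g {v, a}" unfolding sd_edge_def by simp
    then have "{sd_vertex v, sd_edge v a} \<in># (\<Sum>e\<in>#edge_visits \<gamma>. ?g e)" using e by (rule in_sum_mset_image)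
    moreover have "edge_visits \<gamma>' = (\<Sum>e\<in>#edge_visits \<gamma>. ?g e)" by (rule edge_visits_sd[OF edge_neq])
    ultimately show ?thesis by (simp only:)
  qed
  ultimately show "(y \<in># visits \<gamma>' \<longrightarrow> y \<notin> crossings \<gamma>' \<and> {x, y} \<in># edge_visits \<gamma>') \<and>
     \<not> (y \<in># visits \<gamma>' \<and> z \<in># visits \<gamma>')"
    using yz nF v(2) by auto
qed

end

text \<open>Only the first and the last edge can contain \<open>c\<close>, since the interior avoids
  it.\<close>

lemma path_edges_at_vertex:
  assumes "c \<notin> set E" "E \<noteq> []" "e \<in> set (path_edges (c # E @ [c]))" "c \<in> e"
  shows "e = {c, hd E} \<or> e = {c, last E}"
proof -
  obtain x E' where E: "E = x # E'" using assms(2) by (cases E) auto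
  have 1: "path_edges (c # E @ [c]) = {c, x} # path_edges (E @ [c])" using E by simp
  have 2: "E @ [c] = butlast E @ last E # [c]" using assms(2) by simp
  have "path_edges (butlast E @ last E # [c]) = path_edges (butlast E @ [last E]) @ [{last E, c}]"
    using path_edges_append[of "butlast E" "last E" "[c]"] by simp
  also have "butlast E @ [last E] = E" using assms(2) by simp
  finally have "path_edges (c # E @ [c]) = {c, x} # path_edges E @ [{last E, c}]"
    using 1 unfolding 2[symmetric] by simp
  then have "e = {c, x} \<or> e \<in> set (path_edges E) \<or> e = {last E, c}" using assms(3) by simp blast
  moreover have "e \<notin> set (path_edges E)" using path_edges_verts assms(1,4) by blast
  ultimately show ?thesis using E by (auto simp: insert_commute)
qed

lemma image_mset_single:
  assumes "image_mset f \<gamma> = {#a#}"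
  obtains x where "\<gamma> = {#x#}" "f x = a"
  using assms by (auto dest!: msed_map_invR)

lemma image_mset_pair:
  assumes "image_mset f \<gamma> = {#a, b#}"
  obtains x y where "\<gamma> = {#x, y#}" "f x = a" "f y = b"
  using assms by (auto dest!: msed_map_invR)

lemma letter_strand:
  assumes "cyc_class (gauss_word T \<gamma> lab d) = cyc_class W" "(a, b) \<in> set W"
  obtains s where "s \<in> set (cyc_strands d)" "fst (snd s) \<in> crossings \<gamma>" "lab (fst (snd s)) = a"
    "travels_positively T \<gamma> s = b" "fst (snd s) \<in> set d"
proof -
  have "gauss_letters T \<gamma> lab (cyc_strands d) \<in> cyc_class W"
    using assms(1) gauss_word_cyc_class[OF cyc_class_self] cyc_class_eq_iff by metis
  then have "(a, b) \<in> set (gauss_letters T \<gamma> lab (cyc_strands d))" using assms(2) cyc_class_set by metis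
  then obtain s where s: "s \<in> set (cyc_strands d)" "fst (snd s) \<in> crossings \<gamma>" "lab (fst (snd s)) = a"
    "travels_positively T \<gamma> s = b" unfolding gauss_letters_def by auto
  moreover have "fst (snd s) \<in> set d" using mid_in_path_strands s(1) unfolding cyc_strands_def by metis
  ultimately show thesis using that by blast
qed

text \<open>By tameness a visited neighbour of \<open>v\<close> is joined to \<open>v\<close> by an
  edge of the curve, and by assumption all those edges end outside M.\<close>

lemma sector_avoids_curve:
  assumes tame: "tame T \<gamma>" and v: "v \<in> crossings \<gamma>"
    and link: "link_cycle T v (x # M @ y # N)"
    and at_v: "\<And>z. {v, z} \<in># edge_visits \<gamma> \<Longrightarrow> z \<in> set (x # y # N)"
  shows "set M \<inter> set_mset (visits \<gamma>) = {}"
proof (rule equals0I)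
  fix z assume z: "z \<in> set M \<inter> set_mset (visits \<gamma>)"
  then obtain z' where "(v, z, z') \<in> T"
    using cyc_pairs_succ[of z "x # M @ y # N"] link_cycle_iff[OF link] by auto
  then have "{v, z} \<in># edge_visits \<gamma>" using tame v z unfolding tame_def by blast
  then have "z \<in> set (x # y # N)" by (rule at_v)
  then show False using z link unfolding link_cycle_def by auto
qed

text \<open>Supplies the arc for \<open>smooth_realization\<close>: at a crossing of a tame curve,
  the sector between the first and last edge of a loop is nonempty and free.\<close>

lemma smooth_exists:
  fixes w1 w2 :: word and n :: nat
  assumes gauss: "signed_gauss_paragraph n {#(1, True) # w1, (1, False) # w2#}"
    and real: "realization T \<gamma> lab {#(1, True) # w1 @ (n + 1, True) # (1, False) # w2 @ [(n + 1, False)]#}"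
    and tame: "tame T \<gamma>"
  shows "\<exists>\<gamma>'. realization T \<gamma>' lab {#(1, True) # w1, (1, False) # w2#}"
proof -
  let ?W = "(1, True) # w1 @ (n + 1, True) # (1, False) # w2 @ [(n + 1, False)]"
  interpret N: normal_curve T \<gamma> using realizationD(1)[OF real] .
  obtain d where \<gamma>: "\<gamma> = {#d#}" and word: "cyc_class (gauss_word T \<gamma> lab d) = cyc_class ?W"
    using realizationD(3)[OF real] unfolding gauss_paragraph_def by (auto elim: image_mset_single)
  obtain c where c: "c \<in> crossings \<gamma>" "lab c = n + 1" "c \<in> set d"
    using letter_strand[OF word, of "n + 1" True] by auto
  have c2: "count (mset d) c = 2" using c(1) unfolding crossings_def \<gamma> by simp
  obtain Z where Z: "c # Z \<in> cyc_class d" using cyc_class_hd_in[OF c(3)] by blast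
  then have "count (mset (c # Z)) c = 2" using c2 cyc_class_mset by metis
  then have "count (mset Z) c = 1" by simp
  then have "c \<in> set Z" by (metis count_mset_0_iff zero_neq_one)
  then obtain E0 F0 where "Z = E0 @ c # F0" by (meson split_list)
  moreover from this have "c \<notin> set E0" "c \<notin> set F0" using \<open>count (mset Z) c = 1\<close> by (auto simp: count_mset_0_iff)
  ultimately have d0: "c # E0 @ c # F0 \<in> cyc_class d" and nc: "c \<notin> set E0" "c \<notin> set F0" using Z by auto
  have d1: "c # F0 @ c # E0 \<in> cyc_class d"
    using cyc_class_append[of "c # F0" "c # E0"] cyc_class_trans[OF _ d0] by simp
  have no_loop: "{c, c} \<notin># edge_visits \<gamma>" using N.edge_neq by blast
  have ev: "edge_visits \<gamma> = mset (path_edges (c # E @ [c])) + mset (path_edges (c # F @ [c]))"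
    if "c # E @ c # F \<in> cyc_class d" for E F
    using edge_visits_cyc_class[OF that] path_edges_append[of "c # E" c "F @ [c]"] unfolding \<gamma> by simp
  have ne: "E0 \<noteq> []" "F0 \<noteq> []" using no_loop ev[OF d0] ev[OF d1] by auto
  have str_d: "cyc_strands (c # E0 @ c # F0) = (last F0, c, hd E0) # path_strands c E0 c @ (last E0, c, hd F0) # path_strands c F0 c"
    unfolding cyc_strands_def using ne path_strands_append[of _ "c # E0" "c # F0"] by (simp add: hd_append)
  have st: "(last F0, c, hd E0) \<in> strands_of \<gamma>" "(last E0, c, hd F0) \<in> strands_of \<gamma>"
    unfolding strands_of_def \<gamma> using set_cyc_strands[OF d0] str_d by auto
  \<comment> \<open>Equal strands would leave \<open>c\<close> along the same edge, which would then
    be visited twice.\<close>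
  have "(last F0, c, hd E0) \<noteq> (last E0, c, hd F0)"
  proof
    assume "(last F0, c, hd E0) = (last E0, c, hd F0)"
    moreover obtain x E' y F' where EF: "E0 = x # E'" "F0 = y # F'" using ne by (metis neq_Nil_conv)
    ultimately have "x = y" by simp
    then have "2 \<le> count (edge_visits \<gamma>) {c, x}" using ev[OF d0] EF by simp
    then show False using N.edge_count[of "{c, x}"] by simp
  qed
  then have "crossed_left_to_right T (last F0, c, hd E0) (last E0, c, hd F0) \<or>
      crossed_left_to_right T (last E0, c, hd F0) (last F0, c, hd E0)"
    using N.strands_cross[OF c(1) st] by simp
  \<comment> \<open>The loops are named by sign: E is the one entered when \<open>c\<close> is
    travelled positively.\<close>
  then obtain E F where EF: "c # E @ c # F \<in> cyc_class d" "E \<noteq> []" "F \<noteq> []" "c \<notin> set E" "c \<notin> set F"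
    and cross: "crossed_left_to_right T (last F, c, hd E) (last E, c, hd F)"
    using d0 d1 ne nc by blast
  \<comment> \<open>The crossing places both ends of E next to each other in the cyclic order, so M
    lies between them and meets neither end of F.\<close>
  from cross have ccw: "ccw T c [hd E, last E, last F, hd F]" by simp
  then obtain M p2 p3 p4 where link: "link_cycle T c (hd E # M @ last E # p2 @ last F # p3 @ hd F # p4)"
    by (rule ccw_decomp)
  let ?N = "p2 @ last F # p3 @ hd F # p4"
  have "hd E \<noteq> last E" using ccw_distinct[OF ccw] by simp
  obtain x E1 where "E = x # E1" using EF(2) by (cases E) auto
  then have "E1 \<noteq> []" using \<open>hd E \<noteq> last E\<close> by auto
  then obtain E' where E: "E = hd E # E' @ [last E]"
    using \<open>E = x # E1\<close> by (metis append_butlast_last_id last_ConsR list.sel(1))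
  have edges_c: "z \<in> set (hd E # last E # ?N)" if z: "{c, z} \<in># edge_visits \<gamma>" for z
  proof -
    have "c \<noteq> z" using z no_loop by auto
    have "{c, z} = {c, hd E} \<or> {c, z} = {c, last E} \<or> {c, z} = {c, hd F} \<or> {c, z} = {c, last F}"
      using z path_edges_at_vertex[OF EF(4,2), of "{c, z}"] path_edges_at_vertex[OF EF(5,3), of "{c, z}"] unfolding ev[OF EF(1)] by auto
    then show ?thesis using \<open>c \<noteq> z\<close> by (auto simp: doubleton_eq_iff)
  qed
  have vis: "set_mset (visits \<gamma>) = set d" "set d = set (c # E @ c # F)"
    using cyc_class_set[OF EF(1)] unfolding \<gamma> by auto
  have "set M \<inter> set_mset (visits \<gamma>) = {}" by (rule sector_avoids_curve[OF tame c(1) link edges_c])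
  then have M: "set M \<inter> set d = {}" using vis by simp
  have v: "hd E \<in># visits \<gamma>" "last E \<in># visits \<gamma>" using vis EF(2) by auto
  have on_link: "\<exists>y. (c, z, y) \<in> T" if "z \<in> set (hd E # M @ last E # ?N)" for z
    using cyc_pairs_succ[OF that] link_cycle_iff[OF link] by blast
  have ord: "hd E \<notin> crossings \<gamma>" "last E \<notin> crossings \<gamma>"
    using tame c(1) v on_link[of "hd E"] on_link[of "last E"] unfolding tame_def by auto
  \<comment> \<open>Otherwise the visited vertices \<open>hd E\<close> and \<open>last E\<close>
    would be consecutive in the link, against tameness.\<close>
  have "M \<noteq> []"
  proof
    assume "M = []"
    then have "(c, hd E, last E) \<in> T" using link_cycle_iff[OF link] cyc_pairs_Cons2[of "hd E" "last E" "[]" ?N] by simp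
    then show False using tame c(1) v unfolding tame_def by blast
  qed
  have "realization T {#c # F, hd E # E' @ last E # rev M#} lab {#(1, True) # w1, (1, False) # w2#}"
  proof (rule smooth_realization[OF gauss])
    show "c # (hd E # E' @ [last E]) @ c # F \<in> cyc_class d" using EF(1) E by simp
    show "link_cycle T c (hd E # M @ last E # ?N)" by (rule link)
  qed (use real \<gamma> EF(3) c(2) cross \<open>M \<noteq> []\<close> M ord in auto)
  then show ?thesis by blast
qed

section \<open>Subdivided arcs and strands at a crossing of two components\<close>

lemma path_edges_rev: "path_edges (rev xs) = rev (path_edges xs)"
proof (induction xs rule: path_edges.induct)
  case (1 x y xs)
  have "path_edges (rev (x # y # xs)) = path_edges (rev xs @ y # [x])" by simp
  also have "\<dots> = path_edges (rev (y # xs)) @ [{y, x}]" using path_edges_append[of "rev xs" y "[x]"] by simp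
  finally show ?case using 1 by (simp add: insert_commute)
qed auto

lemma path_edges_interleave:
  assumes "e \<in> set (path_edges (interleave f g xs b @ [f b]))"
  obtains us x y vs where "xs @ [b] = us @ x # y # vs" "e = {f x, g x y} \<or> e = {g x y, f y}"
proof -
  have "\<exists>us x y vs. xs @ [b] = us @ x # y # vs \<and> (e = {f x, g x y} \<or> e = {g x y, f y})"
    using assms
  proof (induction xs)
    case (Cons x xs)
    let ?y = "hd (xs @ [b])"
    have y: "x # xs @ [b] = [] @ x # ?y # tl (xs @ [b])" by (cases xs) auto
    have "path_edges (interleave f g (x # xs) b @ [f b]) = {f x, g x ?y} # {g x ?y, f ?y} # path_edges (interleave f g xs b @ [f b])"
      by (cases xs) auto
    then consider "e = {f x, g x ?y} \<or> e = {g x ?y, f ?y}" | "e \<in> set (path_edges (interleave f g xs b @ [f b]))"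
      using Cons.prems by auto
    then show ?case
    proof cases
      case 1
      then show ?thesis using y by (metis append_Cons)
    next
      case 2
      then obtain us a c vs where "xs @ [b] = us @ a # c # vs" "e = {f a, g a c} \<or> e = {g a c, f c}"
        using Cons.IH by blast
      then show ?thesis by (metis append_Cons)
    qed
  qed simp
  then show thesis using that by blast
qed

lemma set_interleave:
  assumes "z \<in> set (interleave f g xs b)"
  obtains x where "x \<in> set xs" "z = f x" | us x y vs where "xs @ [b] = us @ x # y # vs" "z = g x y" "x \<in> set xs"
proof -
  have "(\<exists>x\<in>set xs. z = f x) \<or> (\<exists>us x y vs. xs @ [b] = us @ x # y # vs \<and> z = g x y \<and> x \<in> set xs)"
    using assms
  proof (induction xs)
    case (Cons x xs)
    let ?y = "hd (xs @ [b])"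
    have y: "x # xs @ [b] = [] @ x # ?y # tl (xs @ [b])" by (cases xs) auto
    from Cons.prems consider "z = f x" | "z = g x ?y" | "z \<in> set (interleave f g xs b)" by auto
    then show ?case
    proof cases
      case 1 then show ?thesis by simp
    next
      case 2 then show ?thesis using y by (metis append_Cons list.set_intros(1))
    next
      case 3
      then consider x' where "x' \<in> set xs" "z = f x'"
        | us a c vs where "xs @ [b] = us @ a # c # vs" "z = g a c" "a \<in> set xs" using Cons.IH by blast
      then show ?thesis
      proof cases
        case 1 then show ?thesis by auto
      next
        case 2
        then have "(x # xs) @ [b] = (x # us) @ a # c # vs" by simp
        then show ?thesis using 2 by (metis list.set_intros(2))
      qed
    qed
  qed simp
  then show thesis using that by blast
qed

text \<open>A crossing lying on both components uses up its two visits with one on each.\<close>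

lemma crossing_count_split:
  assumes "count (mset lam + mset sig) v = 2" "v # L \<in> cyc_class lam" "v # K \<in> cyc_class sig"
  shows "v \<notin> set L" "v \<notin> set K"
proof -
  have "mset lam + mset sig = add_mset v (add_mset v (mset (L @ K)))"
    using cyc_class_mset[OF assms(2), symmetric] cyc_class_mset[OF assms(3), symmetric] by simp
  then have "count (mset (L @ K)) v = 0" using assms(1) by (simp only: count_add_mset if_True simp_thms)
  then have "v \<notin> set (L @ K)" by (simp only: count_mset_0_iff not_False_eq_True)
  then show "v \<notin> set L" "v \<notin> set K" by auto
qed

text \<open>
  Let \<open>q, x\<^sub>1, \<dots>, x\<^sub>k, p\<close> be the sector of the link of \<open>v\<close> between the incoming strands of \<open>\<sigma>\<close> and \<open>\<lambda>\<close>.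
  In the subdivision the new crossing is the barycentre of the triangle \<open>v q x\<^sub>1\<close>: the strand of \<open>\<lambda>\<close>
  reaches it from \<open>p\<close> along the outer boundary \<open>I\<close> of the sector, the strand of \<open>\<sigma>\<close> leaves it along
  the inner ring \<open>J\<close> formed by the link of \<open>v\<close>.
\<close>

lemma join_exists:
  fixes w1 w2 :: word and n :: nat
  assumes gauss: "signed_gauss_paragraph n {#(1, True) # w1, (1, False) # w2#}"
    and real: "realization T \<gamma> lab {#(1, True) # w1, (1, False) # w2#}"
    and tame: "tame T \<gamma>"
  shows "\<exists>\<delta> lab'. realization (sd T) {#\<delta>#} lab' {#(1, True) # w1 @ (n + 1, True) # (1, False) # w2 @ [(n + 1, False)]#}"
proof -
  interpret N: normal_curve T \<gamma> using realizationD(1)[OF real] .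
  obtain lam sig where \<gamma>: "\<gamma> = {#lam, sig#}"
    and word_lam: "cyc_class (gauss_word T \<gamma> lab lam) = cyc_class ((1, True) # w1)"
    and word_sig: "cyc_class (gauss_word T \<gamma> lab sig) = cyc_class ((1, False) # w2)"
    using realizationD(3)[OF real] unfolding gauss_paragraph_def by (auto elim: image_mset_pair)
  obtain s where s: "s \<in> set (cyc_strands lam)" "fst (snd s) \<in> crossings \<gamma>" "lab (fst (snd s)) = 1"
    "travels_positively T \<gamma> s" "fst (snd s) \<in> set lam"
    using letter_strand[OF word_lam, of 1 True] by auto
  obtain t where t: "t \<in> set (cyc_strands sig)" "fst (snd t) \<in> crossings \<gamma>" "lab (fst (snd t)) = 1" "fst (snd t) \<in> set sig"
    by (rule letter_strand[OF word_sig, of 1 False], simp, blast)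
  define v where "v = fst (snd s)"
  \<comment> \<open>Both letters of index 1 come from the same crossing because labels are
    injective.\<close>
  have vt: "fst (snd t) = v" using s(2,3) t(2,3) realizationD(2)[OF real] unfolding v_def inj_on_def by auto
  have v: "v \<in> crossings \<gamma>" "lab v = 1" "v \<in> set lam" "v \<in> set sig" using s t vt unfolding v_def by auto
  obtain L K where L: "v # L \<in> cyc_class lam" and K: "v # K \<in> cyc_class sig"
    using cyc_class_hd_in v(3,4) by metis
  have c2: "count (mset lam + mset sig) v = 2" using v(1) unfolding crossings_def \<gamma> by simp
  note vLK = crossing_count_split[OF c2 L K]
  have ev: "edge_visits \<gamma> = mset (path_edges (v # L @ [v])) + mset (path_edges (v # K @ [v]))"
    using edge_visits_cyc_class[OF L] edge_visits_cyc_class[OF K] unfolding \<gamma> by simp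
  have no_loop: "{v, v} \<notin># edge_visits \<gamma>" using N.edge_neq by blast
  have ne: "L \<noteq> []" "K \<noteq> []" using no_loop ev by auto
  have strands: "strands_of \<gamma> = set (cyc_strands (v # L)) \<union> set (cyc_strands (v # K))"
    unfolding strands_of_def \<gamma> set_cyc_strands[OF L] set_cyc_strands[OF K] by simp
  have str_L: "cyc_strands (v # L) = (last L, v, hd L) # path_strands v L v"
    and str_K: "cyc_strands (v # K) = (last K, v, hd K) # path_strands v K v"
    unfolding cyc_strands_def using ne by (simp_all add: hd_append)
  have at_v: "r = (last L, v, hd L) \<or> r = (last K, v, hd K)" if "r \<in> strands_of \<gamma>" "fst (snd r) = v" for r
    using that vLK mid_in_path_strands[of r v L v] mid_in_path_strands[of r v K v] unfolding strands str_L str_K by auto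
  have "s = (last L, v, hd L)"
  proof -
    have "s \<in> set (cyc_strands (v # L))" using s(1) set_cyc_strands[OF L] set_cyc_strands[OF cyc_class_self] by metis
    then have "s = (last L, v, hd L) \<or> s \<in> set (path_strands v L v)" unfolding str_L by simp
    moreover have "s \<notin> set (path_strands v L v)" using vLK(1) mid_in_path_strands[of s v L v] by (auto simp flip: v_def)
    ultimately show ?thesis by blast
  qed
  then obtain r where "r \<in> strands_of \<gamma>" "crossed_left_to_right T (last L, v, hd L) r"
    using s(4) unfolding travels_positively_def by blast
  moreover from this have "r = (last K, v, hd K)" using at_v[of r] crossed_mid crossed_irrefl by fastforce
  ultimately have ccw: "ccw T v [hd L, last K, last L, hd K]" by simp
  define p q where "p = last L" and "q = last K"
  obtain L' K' where L': "L = L' @ [p]" and K': "K = K' @ [q]" using ne unfolding p_def q_def by (metis append_butlast_last_id)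
  \<comment> \<open>Rotated so that the sector swept counterclockwise from the incoming edge of
    \<sigma> to that of \<lambda> comes first; M is its interior.\<close>
  have "ccw T v [q, p, hd K, hd L]" using ccw ccw_rotate1 unfolding p_def q_def by blast
  then obtain M p2 p3 p4 where link: "link_cycle T v (q # M @ p # p2 @ hd K # p3 @ hd L # p4)" by (rule ccw_decomp)
  let ?N = "p2 @ hd K # p3 @ hd L # p4"
  let ?xs = "q # M @ p # ?N"
  have distxs: "distinct ?xs" using link unfolding link_cycle_def by blast
  have pq: "p \<noteq> q" using distxs by auto
  have edges_v: "z \<in> set (q # p # ?N)" if z: "{v, z} \<in># edge_visits \<gamma>" for z
  proof -
    have "v \<noteq> z" using z no_loop by auto
    have "{v, z} = {v, hd L} \<or> {v, z} = {v, p} \<or> {v, z} = {v, hd K} \<or> {v, z} = {v, q}"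
      using z path_edges_at_vertex[OF vLK(1) ne(1), of "{v, z}"] path_edges_at_vertex[OF vLK(2) ne(2), of "{v, z}"] 
      unfolding ev p_def q_def by auto
    then show ?thesis using \<open>v \<noteq> z\<close> by (auto simp: doubleton_eq_iff)
  qed
  have Mvis: "set M \<inter> set_mset (visits \<gamma>) = {}" by (rule sector_avoids_curve[OF tame v(1) link edges_v])
  have vis: "set_mset (visits \<gamma>) = set (v # L) \<union> set (v # K)"
    unfolding \<gamma> using cyc_class_set[OF L] cyc_class_set[OF K] by simp
  have pq_vis: "p \<in># visits \<gamma>" "q \<in># visits \<gamma>" using vis L' K' by auto
  have on_link: "\<exists>y. (v, z, y) \<in> T" if "z \<in> set ?xs" for z
    using cyc_pairs_succ[OF that] link_cycle_iff[OF link] by blast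
  have ord: "p \<notin> crossings \<gamma>" "q \<notin> crossings \<gamma>"
    using tame v(1) pq_vis on_link[of p] on_link[of q] unfolding tame_def by auto
  have consec: "(v, x, y) \<in> T" if "q # M @ [p] = us @ x # y # vs" for us x y vs
  proof -
    have eq: "?xs = us @ x # y # vs @ ?N" using that by (metis append.assoc append_Cons append_Nil)
    have "(x, y) \<in> set (cyc_pairs ?xs)" unfolding eq by (rule cyc_pairs_Cons2)
    then show ?thesis using link_cycle_iff[OF link] by blast
  qed
  have consecM: "(v, x, y) \<in> T" if "M @ [p] = us @ x # y # vs" for us x y vs
    by (rule consec[of "q # us" x y vs]) (use that in simp)
  have vxs: "v \<notin> set ?xs" using on_link surface_neq[OF N.surface] by blast

  \<comment> \<open>The neighbour of \<open>q\<close> on the sector side, written so that it is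
    \<open>p\<close> when M is empty.\<close>
  define x1 where "x1 = hd (M @ [p])"
  have x1: "(v, q, x1) \<in> T" by (rule consec[of "[]" q x1 "tl (M @ [p])"]) (cases M; simp add: x1_def)
  have x1_in: "x1 \<in> set (M @ [p])" unfolding x1_def by (cases M) auto
  define c where "c = sd_face v q x1"
  define I where "I = interleave sd_vertex sd_edge M p"
  define J where "J = interleave (sd_edge v) (sd_face v) M p"
  let ?T = "sd T" and ?\<gamma> = "image_mset sd_path \<gamma>"
  \<comment> \<open>Labels are carried to the subdivision by the inverse of the injective map
    \<open>sd_vertex\<close>.\<close>
  define lab2 where "lab2 = (\<lambda>y. lab (inv sd_vertex y))"
  have inj_sd: "inj sd_vertex" by (rule injI) (simp add: sd_code_eq)
  have lab2: "\<forall>x\<in>crossings \<gamma>. lab2 (sd_vertex x) = lab x" unfolding lab2_def using inj_sd by simp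
  define lab3 where "lab3 = lab2(c := n + 1)"
  have real2: "realization ?T ?\<gamma> lab2 {#(1, True) # w1, (1, False) # w2#}" by (rule realization_sd[OF real lab2])
  \<comment> \<open>A and B are the retained arcs in the subdivision; the discarded pieces P and R
    are just the midpoints of the final edges pv and qv.\<close>
  define A where "A = sd_edge v (hd (L' @ [p])) # interleave sd_vertex sd_edge L' p"
  define B where "B = sd_edge v (hd (K' @ [q])) # interleave sd_vertex sd_edge K' q"
  have path_L: "sd_path (v # L) = sd_vertex v # A @ sd_vertex p # [sd_edge p v]"
    unfolding sd_path_interleave A_def L' using interleave_append[of sd_vertex sd_edge "v # L'" "[p]"] by simp
  have path_K: "sd_path (v # K) = sd_vertex v # B @ sd_vertex q # [sd_edge q v]"
    unfolding sd_path_interleave B_def K' using interleave_append[of sd_vertex sd_edge "v # K'" "[q]"] by simp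
  have lamA: "sd_vertex v # A @ sd_vertex p # [sd_edge p v] \<in> cyc_class (sd_path lam)"
    using sd_path_cyc_class[OF L] path_L by simp
  have sigB: "sd_vertex v # B @ sd_vertex q # [sd_edge q v] \<in> cyc_class (sd_path sig)"
    using sd_path_cyc_class[OF K] path_K by simp
  have vis2: "visits ?\<gamma> = mset (sd_vertex v # A @ sd_vertex p # [sd_edge p v]) + mset (sd_vertex v # B @ sd_vertex q # [sd_edge q v])"
    using cyc_class_mset[OF lamA] cyc_class_mset[OF sigB] unfolding \<gamma> by simp
  have nvp: "v \<noteq> p" "v \<noteq> q" using vxs by auto
  let ?old = "set (sd_vertex v # A @ sd_vertex p # B @ [sd_vertex q])"
  have old_vis: "?old \<subseteq> set_mset (visits ?\<gamma>)" unfolding vis2 by auto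
  \<comment> \<open>The midpoint of a final edge is already visited by P or R. A further visit on A
    or B would make two, whereas midpoints are visited at most once.\<close>
  have E_old: "sd_edge v z \<notin> ?old" if "z = p \<or> z = q" for z
  proof
    assume "sd_edge v z \<in> ?old"
    moreover have "sd_edge v z \<noteq> sd_vertex y" for y using sd_vertex_neq_sd_edge nvp that by metis
    ultimately have "sd_edge v z \<in> set A \<union> set B" by auto
    then have "1 \<le> count (mset A + mset B) (sd_edge v z)"
      by (simp only: count_greater_eq_one_iff set_mset_mset set_mset_union)
    moreover have "count (visits ?\<gamma>) (sd_edge v z) \<ge> count (mset A + mset B) (sd_edge v z) + 1"
    proof -
      let ?X = "mset [sd_edge v p, sd_edge v q, sd_vertex v, sd_vertex v, sd_vertex p, sd_vertex q]"
      have eq: "visits ?\<gamma> = mset A + mset B + mset [sd_edge v p, sd_edge v q, sd_vertex v, sd_vertex v, sd_vertex p, sd_vertex q]"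
        unfolding vis2 sd_edge_commute[of v] by simp
      moreover have "1 \<le> count (mset [sd_edge v p, sd_edge v q, sd_vertex v, sd_vertex v, sd_vertex p, sd_vertex q]) (sd_edge v z)"
        using that by (simp only: count_greater_eq_one_iff set_mset_mset) auto
      moreover have "count (visits ?\<gamma>) (sd_edge v z) = count (mset A + mset B) (sd_edge v z) + count ?X (sd_edge v z)"
        unfolding eq by (rule count_union)
      ultimately show ?thesis by linarith
    qed
    moreover have "count (visits ?\<gamma>) (sd_edge v z) \<le> 1"
      by (rule N.count_visits_sd_other) (use \<open>\<And>y. sd_edge v z \<noteq> sd_vertex y\<close> in auto)
    ultimately show False by linarith
  qed
  \<comment> \<open>The curve visits no vertex of M, hence uses no edge ending there.\<close>
  have E_new: "sd_edge x y \<notin># visits ?\<gamma>" if "x \<in> set M \<or> y \<in> set M" "x \<noteq> y" for x y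
  proof
    assume "sd_edge x y \<in># visits ?\<gamma>"
    then have "{x, y} \<in># edge_visits \<gamma>" by (rule N.sd_edge_visited[OF that(2)])
    then have "{x, y} \<in> set (path_edges (v # L @ [v])) \<union> set (path_edges (v # K @ [v]))" unfolding ev by simp
    then have "{x, y} \<subseteq> set (v # L @ [v]) \<or> {x, y} \<subseteq> set (v # K @ [v])" using path_edges_verts by (metis UnE)
    then have "{x, y} \<subseteq> set_mset (visits \<gamma>)" unfolding vis by auto
    then show False using that(1) Mvis by blast
  qed

  have I_elem: "(\<exists>x\<in>set M. z = sd_vertex x) \<or> (\<exists>x\<in>set M. \<exists>y. z = sd_edge x y \<and> (v, x, y) \<in> T)" if "z \<in> set I" for z
    using that[unfolded I_def] by (rule set_interleave) (use consecM in blast)+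
  have J_elem: "(\<exists>x\<in>set M. z = sd_edge v x) \<or> (\<exists>x\<in>set M. \<exists>y. z = sd_face v x y \<and> (v, x, y) \<in> T)" if "z \<in> set J" for z
    using that[unfolded J_def] by (rule set_interleave) (use consecM in blast)+
  have dist_link: "distinct (interleave (sd_edge v) (sd_face v) ?xs (hd ?xs))"
    using sd_link_vertex[OF N.surface link] unfolding link_cycle_def by blast
  \<comment> \<open>The ring from the midpoint of vq through \<open>c\<close> and J to the midpoint
    of vp is a segment of the link of v in the subdivision, hence free of repetitions.\<close>
  have cJ: "interleave (sd_edge v) (sd_face v) ?xs (hd ?xs) = sd_edge v q # c # J @ sd_edge v p # tl (interleave (sd_edge v) (sd_face v) (p # ?N) q)"
    unfolding c_def J_def x1_def using interleave_append[of "sd_edge v" "sd_face v" M "p # ?N" q] by (cases M) simp_all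
  have distJ: "distinct (sd_edge v q # c # J @ [sd_edge v p])" using dist_link unfolding cJ by auto
  \<comment> \<open>I is a segment of the subdivided link of v. Its midpoints differ since v a b and
    v b a are never both triangles.\<close>
  have distI: "distinct I"
  proof -
    have "distinct (interleave sd_vertex sd_edge ?xs (hd ?xs))"
    proof (rule distinct_interleave_cyc[OF distxs])
      show "inj_on sd_vertex (set ?xs)" using inj_sd by (rule inj_on_subset) simp
      show "inj_on (\<lambda>(x, y). sd_edge x y) (set (cyc_pairs ?xs))"
      proof (intro inj_onI, clarsimp simp del: insert_iff)
        fix a b a' b' assume *: "(a, b) \<in> set (cyc_pairs ?xs)" "(a', b') \<in> set (cyc_pairs ?xs)" "sd_edge a b = sd_edge a' b'"
        then have T: "(v, a, b) \<in> T" "(v, a', b') \<in> T" using link_cycle_iff[OF link] by auto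
        then have "(v, b', a') \<notin> T" using surface_no_opposite[OF N.surface] by blast
        then show "a = a' \<and> b = b'" using *(3) T by (auto simp: sd_code_eq doubleton_eq_iff)
      qed
      have neq: "sd_edge a b \<noteq> sd_vertex x" if "(a, b) \<in> set (cyc_pairs ?xs)" for a b x
      proof -
        have "(v, a, b) \<in> T" using that link_cycle_iff[OF link] by blast
        then have "a \<noteq> b" using surface_neq[OF N.surface] by blast
        then show ?thesis using sd_vertex_neq_sd_edge by metis
      qed
      show "sd_vertex ` set ?xs \<inter> (\<lambda>(x, y). sd_edge x y) ` set (cyc_pairs ?xs) = {}"
      proof (rule equals0I)
        fix z assume "z \<in> sd_vertex ` set ?xs \<inter> (\<lambda>(x, y). sd_edge x y) ` set (cyc_pairs ?xs)"
        then obtain x ab where "z = sd_vertex x" "ab \<in> set (cyc_pairs ?xs)" "z = (\<lambda>(x, y). sd_edge x y) ab" by blast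
        then show False using neq[of "fst ab" "snd ab" x] by (simp add: case_prod_unfold)
      qed
    qed
    moreover have "interleave sd_vertex sd_edge ?xs (hd ?xs) = sd_vertex q # sd_edge q x1 # I @ interleave sd_vertex sd_edge (p # ?N) q"
      unfolding I_def x1_def using interleave_append[of sd_vertex sd_edge M "p # ?N" q] by (cases M) simp_all
    ultimately show ?thesis by simp
  qed
  \<comment> \<open>The outer boundary carries vertices and edges of the link of v; the ring carries
    edges at v and faces.\<close>
  have IJ: "set I \<inter> set (sd_edge v q # c # J @ [sd_edge v p]) = {}"
  proof (rule equals0I)
    fix z assume z: "z \<in> set I \<inter> set (sd_edge v q # c # J @ [sd_edge v p])"
    then consider y where "z = sd_edge v y" "y \<in> set ?xs" | x y where "z = sd_face v x y" "(v, x, y) \<in> T"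
      using J_elem[of z] x1 unfolding c_def by auto
    then show False
    proof cases
      case (1 y)
      then have "z \<noteq> sd_vertex x" for x using sd_vertex_neq_sd_edge vxs by metis
      then obtain x y' where "x \<in> set M" "z = sd_edge x y'" "(v, x, y') \<in> T" using I_elem[of z] z by blast
      then show False using 1 surface_neq[OF N.surface, of v x y'] by (auto simp: sd_code_eq doubleton_eq_iff)
    next
      case (2 x y)
      have "z \<in> set I" using z by blast
      from I_elem[OF this] obtain u w where "z = sd_vertex u \<or> z = sd_edge u w" by blast
      then show False using 2(1) sd_codes_neq(3,5)[OF N.surface 2(2)] by metis
    qed
  qed

  have triE: "{sd_edge a b, sd_face a b c'} \<in> edges ?T" "{sd_vertex a, sd_edge a b} \<in> edges ?T" "{sd_edge a b, sd_vertex b} \<in> edges ?T"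
    "{sd_vertex a, sd_face a b c'} \<in> edges ?T" if "(a, b, c') \<in> T" for a b c'
    using sd_edge_vertex[OF N.surface that] by (simp_all add: insert_commute)
  have rot: "(b, c', a) \<in> T" if "(a, b, c') \<in> T" for a b c' using surface_rot[OF N.surface that] .
  have edgesI: "set (path_edges (I @ [sd_vertex p])) \<subseteq> edges ?T"
  proof
    fix e assume "e \<in> set (path_edges (I @ [sd_vertex p]))"
    then obtain us x y vs where "M @ [p] = us @ x # y # vs" "e = {sd_vertex x, sd_edge x y} \<or> e = {sd_edge x y, sd_vertex y}"
      unfolding I_def by (rule path_edges_interleave)
    then show "e \<in> edges ?T" using triE(2,3)[OF rot[OF consecM]] by blast
  qed
  have edgesJ: "set (path_edges (J @ [sd_edge v p])) \<subseteq> edges ?T"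
  proof
    fix e assume "e \<in> set (path_edges (J @ [sd_edge v p]))"
    then obtain us x y vs where M: "M @ [p] = us @ x # y # vs" and e: "e = {sd_edge v x, sd_face v x y} \<or> e = {sd_face v x y, sd_edge v y}"
      unfolding J_def by (rule path_edges_interleave)
    have t: "(v, x, y) \<in> T" by (rule consecM[OF M])
    have "{sd_edge y v, sd_face y v x} \<in> edges ?T" using triE(1)[OF rot[OF rot[OF t]]] .
    then have "{sd_face v x y, sd_edge v y} \<in> edges ?T" using sd_edge_commute[of v y] sd_face_rot[of y v x] by (simp add: insert_commute)
    then show "e \<in> edges ?T" using e triE(1)[OF t] by blast
  qed
  have hdI: "hd (I @ [sd_vertex p]) = sd_vertex x1" unfolding I_def x1_def by (rule hd_interleave)
  have hdJ: "hd (J @ [sd_edge v p]) = sd_edge v x1" unfolding J_def x1_def by (rule hd_interleave)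
  have path_edges_hd: "path_edges (a # xs @ [b]) = {a, hd (xs @ [b])} # path_edges (xs @ [b])" for a b xs by (cases xs) auto
  have c_edges: "{c, sd_edge v q} \<in> edges ?T" "{c, sd_vertex x1} \<in> edges ?T" "{sd_vertex q, c} \<in> edges ?T" "{c, sd_edge v x1} \<in> edges ?T"
  proof -
    have r: "sd_face q x1 v = c" "sd_face x1 v q = c" unfolding c_def using sd_face_rot by metis+
    show "{c, sd_edge v q} \<in> edges ?T" using triE(1)[OF x1] unfolding c_def by (simp add: insert_commute)
    show "{sd_vertex q, c} \<in> edges ?T" using triE(4)[OF rot[OF x1]] r by simp
    show "{c, sd_vertex x1} \<in> edges ?T" using triE(4)[OF rot[OF rot[OF x1]]] r by (simp add: insert_commute)
    show "{c, sd_edge v x1} \<in> edges ?T" using triE(1)[OF rot[OF rot[OF x1]]] r sd_edge_commute[of v x1] by (simp add: insert_commute)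
  qed
  have path_lam: "set (path_edges (sd_vertex p # rev I @ c # [sd_edge v q] @ [sd_vertex v])) \<subseteq> edges ?T"
  proof -
    \<comment> \<open>I runs from x1 to \<open>p\<close>, but the strand of \<lambda> travels from
      \<open>p\<close> towards \<open>c\<close>; reversing the path reduces the check to edges
      already known.\<close>
    have "sd_vertex p # rev I @ c # [sd_edge v q] @ [sd_vertex v] = rev (sd_vertex v # sd_edge v q # c # I @ [sd_vertex p])" by simp
    then have "set (path_edges (sd_vertex p # rev I @ c # [sd_edge v q] @ [sd_vertex v])) =
        {{sd_vertex v, sd_edge v q}, {sd_edge v q, c}, {c, sd_vertex x1}} \<union> set (path_edges (I @ [sd_vertex p]))"
      by (simp only: path_edges_rev set_rev) (simp add: path_edges_hd hdI insert_commute)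
    then show ?thesis using edgesI c_edges triE(2)[OF x1] by (simp add: insert_commute)
  qed
  have path_sig: "set (path_edges (sd_vertex q # [] @ c # (J @ [sd_edge v p]) @ [sd_vertex v])) \<subseteq> edges ?T"
  proof -
    obtain y where "(v, p, y) \<in> T" using on_link[of p] by auto
    then have "{sd_edge v p, sd_vertex v} \<in> edges ?T" using triE(2) by (simp add: insert_commute)
    moreover have "path_edges (sd_vertex q # [] @ c # (J @ [sd_edge v p]) @ [sd_vertex v]) =
       {sd_vertex q, c} # {c, sd_edge v x1} # path_edges (J @ [sd_edge v p]) @ [{sd_edge v p, sd_vertex v}]"
      using path_edges_append[of "sd_vertex q # c # J" "sd_edge v p" "[sd_vertex v]"] path_edges_hd[of c J "sd_edge v p"] hdJ by simp
    ultimately show ?thesis using edgesJ c_edges by simp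
  qed
  have vE: "sd_edge v q \<notin> set I \<union> set J" "sd_edge v p \<notin> set I \<union> set J" "sd_edge v p \<noteq> sd_edge v q" using distJ IJ by auto

  have "realization ?T {#sd_vertex v # A @ sd_vertex p # rev I @ c # [sd_edge v q] @ sd_vertex v # B @ sd_vertex q # [] @ c # (J @ [sd_edge v p])#} lab3
      {#(1, True) # w1 @ (n + 1, True) # (1, False) # w2 @ [(n + 1, False)]#}"
  \<comment> \<open>Here X1 is \<open>rev I\<close>, X2 the midpoint of vq, Y1 is empty and Y2 is J
    followed by the midpoint of vp.\<close>
  proof (rule join_realization[OF gauss, where lam = "sd_path lam" and sig = "sd_path sig" and lab = lab2 and P = "[sd_edge p v]" and R = "[sd_edge q v]"])
    show "realization ?T {#sd_path lam, sd_path sig#} lab2 {#(1, True) # w1, (1, False) # w2#}" using real2 unfolding \<gamma> by simp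
    show "cyc_class (gauss_word ?T {#sd_path lam, sd_path sig#} lab2 (sd_path lam)) = cyc_class ((1, True) # w1)"
      using N.gauss_word_sd[of lam, OF _ lab2] word_lam unfolding \<gamma> by simp
    show "cyc_class (gauss_word ?T {#sd_path lam, sd_path sig#} lab2 (sd_path sig)) = cyc_class ((1, False) # w2)"
      using N.gauss_word_sd[of sig, OF _ lab2] word_sig unfolding \<gamma> by simp
    show "lab2 (sd_vertex v) = 1" using lab2 v by simp
    show "sd_vertex v # A @ sd_vertex p # [sd_edge p v] \<in> cyc_class (sd_path lam)" by (rule lamA)
    show "sd_vertex v # B @ sd_vertex q # [sd_edge q v] \<in> cyc_class (sd_path sig)" by (rule sigB)
    show "set (sd_vertex p # [sd_edge p v] @ sd_vertex q # [sd_edge q v]) \<inter> crossings {#sd_path lam, sd_path sig#} = {}"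
    proof -
      have "crossings {#sd_path lam, sd_path sig#} = sd_vertex ` crossings \<gamma>" using N.crossings_sd unfolding \<gamma> by simp
      then show ?thesis using ord nvp by (auto simp: sd_code_eq)
    qed
    show "successively (\<lambda>x y. {x, y} \<in> edges ?T) (sd_vertex p # rev I @ c # [sd_edge v q] @ [sd_vertex v])"
      unfolding successively_path_edges by (rule path_lam)
    show "successively (\<lambda>x y. {x, y} \<in> edges ?T) (sd_vertex q # [] @ c # (J @ [sd_edge v p]) @ [sd_vertex v])"
      unfolding successively_path_edges by (rule path_sig)
    show "last (c # [sd_edge v q]) = last (sd_vertex q # [sd_edge q v])" "last (c # J @ [sd_edge v p]) = last (sd_vertex p # [sd_edge p v])"
      using sd_edge_commute by simp_all
    show "distinct (c # rev I @ [sd_edge v q] @ [] @ J @ [sd_edge v p])" using distI distJ IJ by auto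
    show "set (c # rev I @ [sd_edge v q] @ [] @ J @ [sd_edge v p]) \<inter> ?old = {}"
    proof (rule equals0I)
      fix z assume z: "z \<in> set (c # rev I @ [sd_edge v q] @ [] @ J @ [sd_edge v p]) \<inter> ?old"
      then have zv: "z \<in># visits ?\<gamma>" using old_vis by blast
      consider "z = c" | "z \<in> set I" | "z = sd_edge v p \<or> z = sd_edge v q" | "z \<in> set J" using z by auto
      then show False
      proof cases
        case 1 then show False using zv N.sd_face_not_visited[OF x1] unfolding c_def by simp
      next
        case 2
        then consider x where "x \<in> set M" "z = sd_vertex x" | x y where "x \<in> set M" "z = sd_edge x y" "(v, x, y) \<in> T"
          using I_elem by blast
        then show False
        proof cases
          case 1 then show False using zv N.sd_vertex_visited Mvis by blast
        next
          case 2 then show False using zv E_new surface_neq[OF N.surface 2(3)] by blast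
        qed
      next
        case 3 then show False using z E_old by blast
      next
        case 4
        then consider x where "x \<in> set M" "z = sd_edge v x" | x y where "x \<in> set M" "z = sd_face v x y" "(v, x, y) \<in> T"
          using J_elem by blast
        then show False
        proof cases
          case 1
          then have "v \<noteq> x" using vxs by auto
          then show False using 1 zv E_new by blast
        next
          case 2 then show False using zv N.sd_face_not_visited by blast
        qed
      qed
    qed
    show "crossed_left_to_right ?T (last (sd_vertex p # rev I), c, hd ([sd_edge v q] @ [sd_vertex v]))
        (last (sd_vertex q # []), c, hd ((J @ [sd_edge v p]) @ [sd_vertex v]))"
    proof -
      have "last (sd_vertex p # rev I) = hd (I @ [sd_vertex p])" by (cases I) auto
      moreover have "hd ((J @ [sd_edge v p]) @ [sd_vertex v]) = hd (J @ [sd_edge v p])" by (cases J) auto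
      \<comment> \<open>Four of the six vertices of the hexagonal link of \<open>c\<close>:
        \<lambda> passes from x1 to the midpoint of vq, \<sigma> from \<open>q\<close> to the
        midpoint of v x1.\<close>
      moreover have "ccw ?T c [sd_edge v q, sd_vertex q, sd_vertex x1, sd_edge x1 v]"
        unfolding ccw_def c_def using sd_link_face[OF N.surface x1] by (intro exI conjI, assumption) simp
      ultimately show ?thesis using hdI hdJ sd_edge_commute[of x1 v] by simp
    qed
    show "\<forall>x\<in>crossings {#sd_path lam, sd_path sig#}. lab3 x = lab2 x"
    proof
      fix x assume "x \<in> crossings {#sd_path lam, sd_path sig#}"
      then have "x \<in> crossings ?\<gamma>" unfolding \<gamma> by simp
      then have "x \<noteq> c" using N.crossings_sd sd_codes_neq(4)[OF N.surface x1] unfolding c_def by blast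
      then show "lab3 x = lab2 x" unfolding lab3_def by simp
    qed
    show "lab3 c = n + 1" unfolding lab3_def by simp
  qed (rule cyc_class_self)
  then show ?thesis by blast
qed

section \<open>Iterated subdivision and the join\<close>

text \<open>The words of the individual components are carried along because the paragraph, a
  multiset, forgets which component reads which word.\<close>

lemma realization_sd_pow:
  assumes "realization T \<gamma> lab W" "\<forall>x\<in>crossings \<gamma>. lab' ((sd_vertex ^^ k) x) = lab x"
  shows "realization ((sd ^^ k) T) (image_mset (sd_path ^^ k) \<gamma>) lab' W \<and>
    crossings (image_mset (sd_path ^^ k) \<gamma>) = (sd_vertex ^^ k) ` crossings \<gamma> \<and>
    (\<forall>c\<in>#\<gamma>. cyc_class (gauss_word ((sd ^^ k) T) (image_mset (sd_path ^^ k) \<gamma>) lab' ((sd_path ^^ k) c)) =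
      cyc_class (gauss_word T \<gamma> lab c))"
  using assms(2)
proof (induction k arbitrary: lab')
  case 0
  interpret N: normal_curve T \<gamma> using realizationD(1)[OF assms(1)] .
  have "gauss_letters T \<gamma> lab' ss = gauss_letters T \<gamma> lab ss" for ss
    by (rule gauss_letters_cong) (use 0 in auto)
  then have "gauss_word T \<gamma> lab' c = gauss_word T \<gamma> lab c" for c
    unfolding gauss_word_def gauss_letters_def by blast
  moreover have "inj_on lab' (crossings \<gamma>)"
    using 0 realizationD(2)[OF assms(1)] by (simp add: inj_on_def)
  ultimately show ?case using assms(1) unfolding realization_def gauss_paragraph_def by simp
next
  case (Suc k)
  let ?T = "(sd ^^ k) T" and ?\<gamma> = "image_mset (sd_path ^^ k) \<gamma>"
  \<comment> \<open>Labels for the stage before the last subdivision, pulled back along one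
    \<open>sd_vertex\<close>.\<close>
  define lab'' where "lab'' = (\<lambda>x. lab' (sd_vertex x))"
  have IH: "realization ?T ?\<gamma> lab'' W" "crossings ?\<gamma> = (sd_vertex ^^ k) ` crossings \<gamma>"
    "\<And>c. c \<in># \<gamma> \<Longrightarrow> cyc_class (gauss_word ?T ?\<gamma> lab'' ((sd_path ^^ k) c)) = cyc_class (gauss_word T \<gamma> lab c)"
    using Suc.IH[of lab''] Suc.prems unfolding lab''_def by simp_all
  interpret N: normal_curve ?T ?\<gamma> using realizationD(1)[OF IH(1)] .
  have lab: "\<forall>x\<in>crossings ?\<gamma>. lab' (sd_vertex x) = lab'' x" unfolding lab''_def by simp
  have eq: "image_mset (sd_path ^^ Suc k) \<gamma> = image_mset sd_path ?\<gamma>"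
    by (simp add: image_mset.compositionality comp_def)
  have "cyc_class (gauss_word (sd ?T) (image_mset sd_path ?\<gamma>) lab' (sd_path ((sd_path ^^ k) c))) = cyc_class (gauss_word T \<gamma> lab c)"
    if "c \<in># \<gamma>" for c
  proof -
    have "(sd_path ^^ k) c \<in># ?\<gamma>" using that by simp
    then show ?thesis using N.gauss_word_sd[OF _ lab] IH(3)[OF that] by simp
  qed
  moreover have "crossings (image_mset sd_path ?\<gamma>) = (sd_vertex ^^ Suc k) ` crossings \<gamma>"
    unfolding N.crossings_sd IH(2) by (simp add: image_image)
  ultimately show ?case unfolding eq using realization_sd[OF IH(1) lab] by simp
qed

text \<open>Stated for any set of triangles because it is applied to a star, which is not a closed
  surface.\<close>

lemma sd_vertex_in_verts: "sd_vertex x \<in> verts (sd K) \<Longrightarrow> x \<in> verts K"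
proof -
  assume "sd_vertex x \<in> verts (sd K)"
  then obtain a b c where "(a, b, c) \<in> sd K" "sd_vertex x \<in> {a, b, c}" unfolding verts_def by auto
  moreover from this obtain y z u where K: "(y, z, u) \<in> K" and "(a, b, c) \<in>
      {(sd_vertex y, sd_edge y z, sd_face y z u), (sd_edge y z, sd_face y z u, sd_vertex y), (sd_face y z u, sd_vertex y, sd_edge y z),
       (sd_edge y z, sd_vertex z, sd_face y z u), (sd_vertex z, sd_face y z u, sd_edge y z), (sd_face y z u, sd_edge y z, sd_vertex z)}"
    unfolding sd_mem by blast
  ultimately have "sd_vertex x \<in> {sd_vertex y, sd_vertex z, sd_edge y z, sd_face y z u}" by (elim insertE emptyE) simp_all
  then have "x = y \<or> x = z" unfolding insert_iff empty_iff sd_code_eq by blast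
  then show ?thesis using K unfolding verts_def by blast
qed

lemma sd_vertex_pow_in_verts: "(sd_vertex ^^ k) x \<in> verts ((sd ^^ k) K) \<Longrightarrow> x \<in> verts K"
  by (induction k) (auto dest: sd_vertex_in_verts)

text \<open>A small triangle has exactly one corner at an old vertex, so the star of one old vertex
  contains no other.\<close>

lemma star_sd_vertex:
  assumes S: "closed_connected_surface T" and "sd_vertex x \<in> verts (star (sd T) (sd_vertex v))"
  shows "x = v"
proof -
  obtain a b c where abc: "(a, b, c) \<in> sd T" "sd_vertex v \<in> {a, b, c}" "sd_vertex x \<in> {a, b, c}"
    using assms(2) unfolding verts_def star_def by auto
  then obtain y z u where T: "(y, z, u) \<in> T" and *: "(a, b, c) \<in>
      {(sd_vertex y, sd_edge y z, sd_face y z u), (sd_edge y z, sd_face y z u, sd_vertex y), (sd_face y z u, sd_vertex y, sd_edge y z),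
       (sd_edge y z, sd_vertex z, sd_face y z u), (sd_vertex z, sd_face y z u, sd_edge y z), (sd_face y z u, sd_edge y z, sd_vertex z)}"
    unfolding sd_mem by blast
  have "{a, b, c} = {sd_vertex y, sd_edge y z, sd_face y z u} \<or> {a, b, c} = {sd_vertex z, sd_edge y z, sd_face y z u}"
    using * by (elim insertE emptyE) (simp_all add: insert_commute)
  then obtain w where "{a, b, c} = {sd_vertex w, sd_edge y z, sd_face y z u}" by blast
  then have "sd_vertex v = sd_vertex w" "sd_vertex x = sd_vertex w"
    using abc(2,3) sd_codes_neq[OF S T] by (metis insertE singletonD)+
  then show ?thesis by (simp add: sd_code_eq)
qed

lemma sd_pow_mono: "A \<subseteq> B \<Longrightarrow> (sd ^^ k) A \<subseteq> (sd ^^ k) B"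
  by (induction k) (auto intro: sd_mono[THEN subsetD])

lemma sector_subset:
  assumes S: "closed_connected_surface T"
  shows "sector T v q p \<subseteq> T"
proof
  fix t assume "t \<in> sector T v q p"
  then obtain xs i j where link: "link_cycle T v xs" and i: "i < j" "j < length xs" and t: "t \<in> rots (v, xs ! i, xs ! Suc i)"
    unfolding sector_def by blast
  have "(xs ! i, xs ! Suc i) \<in> set (cyc_pairs xs)" unfolding cyc_pairs_mem using i by (intro exI[of _ i]) simp
  then have "(v, xs ! i, xs ! Suc i) \<in> T" using link_cycle_iff[OF link] by blast
  then show "t \<in> T" using t surface_rot[OF S] unfolding rots_def by auto
qed

text \<open>Translates the disc and sector conditions of \<open>is_join\<close> into the conditions
  of \<open>join_realization\<close> on the final triangulation.\<close>

lemma is_join_realization: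
  assumes gauss: "signed_gauss_paragraph n {#(1, True) # w1, (1, False) # w2#}"
    and real: "realization S {#lam, sig#} lab {#(1, True) # w1, (1, False) # w2#}"
    and word_lam: "cyc_class (gauss_word S {#lam, sig#} lab lam) = cyc_class ((1, True) # w1)"
    and word_sig: "cyc_class (gauss_word S {#lam, sig#} lab sig) = cyc_class ((1, False) # w2)"
    and v: "v \<in> crossings {#lam, sig#}" "lab v = 1"
    and join: "is_join S lam sig v m \<delta> c"
    and lab': "\<forall>x\<in>crossings {#lam, sig#}. lab' ((sd_vertex ^^ (m + 2)) x) = lab x" "lab' c = n + 1"
  shows "realization ((sd ^^ (m + 2)) S) {#\<delta>#} lab'
    {#(1, True) # w1 @ (n + 1, True) # (1, False) # w2 @ [(n + 1, False)]#}"
proof -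
  let ?T = "(sd ^^ (m + 2)) S" and ?v = "(sd_vertex ^^ (m + 2)) v" and ?T2 = "(sd ^^ 2) S" and ?v2 = "(sd_vertex ^^ 2) v"
  let ?lam = "(sd_path ^^ (m + 2)) lam" and ?sig = "(sd_path ^^ (m + 2)) sig"
  have S: "closed_connected_surface S" using real unfolding realization_def by blast
  have S2: "closed_connected_surface ?T2" using closed_connected_surface_sd_pow[OF S] .
  obtain A B P R X1 X2 Y1 Y2 a' a'' p q where
    lam: "?v # A @ a' # P \<in> cyc_class ?lam" and sig: "?v # B @ a'' # R \<in> cyc_class ?sig"
    and disc: "set (a' # P) \<subseteq> verts ((sd ^^ m) (star ?T2 ?v2))" "set (a'' # R) \<subseteq> verts ((sd ^^ m) (star ?T2 ?v2))"
    and paths: "successively (\<lambda>x y. {x, y} \<in> edges ((sd ^^ m) (sector ?T2 ?v2 q p))) (a' # X1 @ c # X2 @ [?v])"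
      "successively (\<lambda>x y. {x, y} \<in> edges ((sd ^^ m) (sector ?T2 ?v2 q p))) (a'' # Y1 @ c # Y2 @ [?v])"
    and enter: "last (c # X2) = last (a'' # R)" "last (c # Y2) = last (a' # P)"
    and dist: "distinct (c # X1 @ X2 @ Y1 @ Y2)"
    and new: "set (c # X1 @ X2 @ Y1 @ Y2) \<inter> set (?v # A @ a' # B @ [a'']) = {}"
    and cross: "crossed_left_to_right ?T (last (a' # X1), c, hd (X2 @ [?v])) (last (a'' # Y1), c, hd (Y2 @ [?v]))"
    and \<delta>: "\<delta> \<in> cyc_class (?v # A @ a' # X1 @ c # X2 @ ?v # B @ a'' # Y1 @ c # Y2)"
    using join unfolding is_join_def by blast
  have pow: "realization ?T {#?lam, ?sig#} lab' {#(1, True) # w1, (1, False) # w2#}"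
    "crossings {#?lam, ?sig#} = (sd_vertex ^^ (m + 2)) ` crossings {#lam, sig#}"
    "cyc_class (gauss_word ?T {#?lam, ?sig#} lab' ?lam) = cyc_class ((1, True) # w1)"
    "cyc_class (gauss_word ?T {#?lam, ?sig#} lab' ?sig) = cyc_class ((1, False) # w2)"
    using realization_sd_pow[OF real lab'(1)] word_lam word_sig by simp_all
  have "?v \<in> crossings {#?lam, ?sig#}" using v(1) pow(2) by blast
  then have "count (mset ?lam + mset ?sig) ?v = 2" unfolding crossings_def by simp
  note v_notin = crossing_count_split[OF this lam sig]
  \<comment> \<open>Crossings survive only as iterated copies of old vertices, and the only such
    copy in the disc is that of \<open>v\<close>. The final pieces of the two components do not meet
    it, since each component visits it just once.\<close>
  have ordinary: "set (a' # P @ a'' # R) \<inter> crossings {#?lam, ?sig#} = {}"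
  proof (rule equals0I)
    fix z assume z: "z \<in> set (a' # P @ a'' # R) \<inter> crossings {#?lam, ?sig#}"
    then obtain x where x: "z = (sd_vertex ^^ (m + 2)) x" using pow(2) by blast
    have "(sd_vertex ^^ m) ((sd_vertex ^^ 2) x) \<in> verts ((sd ^^ m) (star ?T2 ?v2))"
    proof -
      have "z = (sd_vertex ^^ m) ((sd_vertex ^^ 2) x)" unfolding x funpow_add comp_apply ..
      then show ?thesis using z disc by auto
    qed
    then have "(sd_vertex ^^ 2) x \<in> verts (star ?T2 ?v2)" by (rule sd_vertex_pow_in_verts)
    then have "sd_vertex (sd_vertex x) \<in> verts (star (sd (sd S)) (sd_vertex (sd_vertex v)))"
      by (simp add: numeral_2_eq_2)
    then have "x = v" using star_sd_vertex[OF closed_connected_surface_sd[OF S]] by (metis sd_code_eq(1))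
    then show False using z x v_notin by auto
  qed
  have "(sd ^^ m) (sector ?T2 ?v2 q p) \<subseteq> ?T"
    unfolding funpow_add comp_apply by (rule sd_pow_mono[OF sector_subset[OF S2]])
  then have edges: "edges ((sd ^^ m) (sector ?T2 ?v2 q p)) \<subseteq> edges ?T" unfolding edges_def by blast
  show ?thesis
  proof (rule join_realization[OF gauss pow(1) pow(3) pow(4) _ lam sig ordinary _ _ enter dist new cross \<delta>])
    show "lab' ?v = 1" using lab'(1) v by simp
    show "successively (\<lambda>x y. {x, y} \<in> edges ?T) (a' # X1 @ c # X2 @ [?v])"
      "successively (\<lambda>x y. {x, y} \<in> edges ?T) (a'' # Y1 @ c # Y2 @ [?v])"
      using paths edges unfolding successively_path_edges by blast+
  qed (use lab' in auto)
qed

lemma exists_relabelling: "\<exists>lab'. \<forall>x\<in>crossings \<gamma>. lab' (sd_vertex x) = lab x"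
proof -
  have "inj sd_vertex" by (rule injI) (simp add: sd_code_eq)
  then show ?thesis by (intro exI[of _ "\<lambda>y. lab (inv sd_vertex y)"]) simp
qed

lemma tame_realization:
  assumes "realization T \<gamma> lab W"
  shows "\<exists>\<gamma>' lab'. realization (sd T) \<gamma>' lab' W \<and> tame (sd T) \<gamma>'"
  using exists_relabelling realization_sd[OF assms] normal_curve.tame_sd[OF realizationD(1)[OF assms]] by metis

theorem theorem6:
  fixes n m c v :: nat
    and S :: triangles
    and lam sig \<delta> :: "nat list"
    and w1 w2 :: word
    and lab lab' :: "nat \<Rightarrow> nat"
  defines "w \<equiv> {# (1, True) # w1, (1, False) # w2 #}"
    and "w_hat \<equiv> {# (1, True) # w1 @ (n + 1, True) # (1, False) # w2 @ [(n + 1, False)] #}"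
    and "\<gamma> \<equiv> {# lam, sig #}"
    and "S' \<equiv> (sd ^^ (m + 2)) S"
  assumes "signed_gauss_paragraph n w"
    and "realization S \<gamma> lab w"
    and "cyc_class (gauss_word S \<gamma> lab lam) = cyc_class ((1, True) # w1)"
    and "cyc_class (gauss_word S \<gamma> lab sig) = cyc_class ((1, False) # w2)"
    and "v \<in> crossings \<gamma>" and "lab v = 1"
    and "is_join S lam sig v m \<delta> c"
    and "\<forall>x\<in>crossings \<gamma>. lab' ((sd_vertex ^^ (m + 2)) x) = lab x"
    and "lab' c = n + 1"
  shows "realization S' {# \<delta> #} lab' w_hat \<and>
    (minimal_realization S \<gamma> lab w \<longleftrightarrow> minimal_realization S' {# \<delta> #} lab' w_hat)"
proof -
  note gauss = \<open>signed_gauss_paragraph n w\<close>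
  note real = \<open>realization S \<gamma> lab w\<close>
  have real': "realization S' {#\<delta>#} lab' w_hat"
    unfolding w_hat_def S'_def
    by (rule is_join_realization) (use assms(5-) in \<open>unfold w_def \<gamma>_def\<close>)
  have surface: "closed_connected_surface T" if "realization T \<gamma> lab W" for T \<gamma> lab W
    using that unfolding realization_def by blast
  have genus_sd: "genus (sd T) = genus T" if "closed_connected_surface T" for T
    using genus_sd_pow[OF that, of 1] by simp
  have genus: "genus S' = genus S" unfolding S'_def by (rule genus_sd_pow[OF surface[OF real]])
  \<comment> \<open>The first subdivision makes the curve tame, the second holds the rerouted
    strands; neither changes the genus.\<close>
  have join: "\<exists>T' \<gamma>' lab'. realization T' \<gamma>' lab' w_hat \<and> genus T' = genus T" if r: "realization T \<gamma> lab w" for T \<gamma> lab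
  proof -
    obtain \<gamma>1 lab1 where 1: "realization (sd T) \<gamma>1 lab1 w" "tame (sd T) \<gamma>1" using tame_realization[OF r] by blast
    obtain \<delta> lab2 where "realization (sd (sd T)) {#\<delta>#} lab2 w_hat"
      using join_exists[OF gauss[unfolded w_def] 1[unfolded w_def]] unfolding w_hat_def by blast
    moreover have "genus (sd (sd T)) = genus T" using genus_sd surface r 1(1) by metis
    ultimately show ?thesis by blast
  qed
  have smooth: "\<exists>T' \<gamma>' lab'. realization T' \<gamma>' lab' w \<and> genus T' = genus T" if r: "realization T \<gamma> lab w_hat" for T \<gamma> lab
  proof -
    obtain \<gamma>1 lab1 where 1: "realization (sd T) \<gamma>1 lab1 w_hat" "tame (sd T) \<gamma>1" using tame_realization[OF r] by blast
    obtain \<gamma>2 where "realization (sd T) \<gamma>2 lab1 w"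
      using smooth_exists[OF gauss[unfolded w_def] 1[unfolded w_hat_def]] unfolding w_def by blast
    then show ?thesis using genus_sd[OF surface[OF r]] by blast
  qed
  \<comment> \<open>By \<open>join\<close> and \<open>smooth\<close> both paragraphs attain the same
    genera, and the two given surfaces have equal genus, so a competitor for one is a competitor for
    the other.\<close>
  have "minimal_realization S \<gamma> lab w \<longleftrightarrow> minimal_realization S' {#\<delta>#} lab' w_hat"
    unfolding minimal_realization_def genus using real real' join smooth by metis
  then show ?thesis using real' by blast
qed

end
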